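(* Let $(M^n,g)$ be an $n$-dimensional Riemannian manifold, $n\ge 2$. Then $M$ has constant sectional curvature $-1$ if, and only if, given any point $p_0\in M$ and any orthonormal vectors $v_1^0,\dots,v_n^0$ tangent to $M$ at $p_0$, there exists an orthonormal frame field $v_1,\dots,v_n$, locally defined (on a neighborhood of $p_0$), such that $v_i(p_0)=v_i^0$ for $i=1,\dots,n$ and such that the associated dual forms $\theta_1,\dots,\theta_n$ and connection forms $\theta_{ij}$ satisfy $$\theta_{1i}+\theta_i=0\quad \text{for all } i\ge 2,\qquad\qquad \theta_{ij}=0\quad\text{for all } i\ne j,\ 2\le i,j\le n.$$ In this case, $\theta_1$ is a closed form. In particular, $v_1$ is tangent to geodesics and each $v_i$, $i\ge 2$, is tangent to horocycles.
   Context: Manifolds, metrics and frames are smooth. For a local orthonormal frame field $v_1,\dots,v_n$ on $(M^n,g)$ with Levi-Civita connection $\nabla$, the dual forms are the 1-forms $\theta_i$ with $\theta_i(v_j)=\delta_{ij}$, and the connection forms are $\theta_{ij}(X)=g(\nabla_X v_i,v_j)$, so $\theta_{ij}=-\theta_{ji}$. They satisfy the structure equations $d\theta_i=\sum_{j\ne i}\theta_j\wedge\theta_{ji}$ and $d\theta_{ij}=\sum_{k}\theta_{ik}\wedge\theta_{kj}+\Omega_{ij}$, where constant sectional curvature $K$ is characterized by $\Omega_{ij}=-K\,\theta_i\wedge\theta_j$. "$v$ is tangent to geodesics (resp. horocycles)" means that the integral curves of $v$ are geodesics (resp. horocycles). A horocycle in a manifold of constant sectional curvature $-1$ is a curve which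 under local isometries with hyperbolic space $\mathbb{H}^n$ corresponds to an arc of a horocycle; equivalently, a unit-speed curve $\gamma$ admitting a unit normal field $N$ along it with $\nabla_{\gamma'}\gamma'=N$ and $\nabla_{\gamma'}N=-\gamma'$. When $n=2$ the second family of conditions ($\theta_{ij}=0$, $2\le i\neq j\le n$) is vacuous. *)

theory Defs
  imports "HOL-Analysis.Analysis"
begin

section \<open>Smooth maps between Euclidean spaces\<close>

text \<open>
  Meant for open \<^term>\<open>S\<close>. On a finite-dimensional space, being k+1 times continuously
  differentiable amounts to being differentiable with all directional derivatives k times
  continuously differentiable.
\<close>

primrec Ck_on ::
  "nat \<Rightarrow> 'a::euclidean_space set \<Rightarrow> ('a \<Rightarrow> 'b::real_normed_vector) \<Rightarrow> bool" where
  "Ck_on 0 S f \<longleftrightarrow> continuous_on S f"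
| "Ck_on (Suc k) S f \<longleftrightarrow>
     (\<forall>x\<in>S. f differentiable at x) \<and> (\<forall>v. Ck_on k S (\<lambda>x. frechet_derivative f (at x) v))"

definition smooth_on :: "'a::euclidean_space set \<Rightarrow> ('a \<Rightarrow> 'b::real_normed_vector) \<Rightarrow> bool" where
  "smooth_on S f \<longleftrightarrow> (\<forall>k. Ck_on k S f)"


section \<open>Smooth manifolds\<close>

text \<open>
  The underlying space is an arbitrary topology \<^term>\<open>M\<close>, and the model space is the Euclidean
  type \<open>'e\<close>, so that \<open>DIM('e)\<close> is the dimension of the manifold. A chart is a pair of its
  domain and its coordinate map, whose values outside the domain are irrelevant. The smooth
  structure is given by an atlas, which need not be maximal.
\<close>

type_synonym ('m, 'e) chart = "'m set \<times> ('m \<Rightarrow> 'e)"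

definition chart_inv :: "('m, 'e) chart \<Rightarrow> 'e \<Rightarrow> 'm" where
  "chart_inv c = inv_into (fst c) (snd c)"

definition is_chart :: "'m topology \<Rightarrow> ('m, 'e::euclidean_space) chart \<Rightarrow> bool" where
  "is_chart M c \<longleftrightarrow> openin M (fst c) \<and> open (snd c ` fst c) \<and>
     homeomorphic_map (subtopology M (fst c)) (top_of_set (snd c ` fst c)) (snd c)"

definition smooth_manifold :: "'m topology \<Rightarrow> ('m, 'e::euclidean_space) chart set \<Rightarrow> bool" where
  "smooth_manifold M A \<longleftrightarrow>
     Hausdorff_space M \<and> second_countable M \<and>
     (\<forall>c\<in>A. is_chart M c) \<and> (\<Union>c\<in>A. fst c) = topspace M \<and>
     (\<forall>c\<in>A. \<forall>d\<in>A. smooth_on (snd c ` (fst c \<inter> fst d)) (snd d \<circ> chart_inv c))"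


section \<open>Tangent vectors, vector fields, 1-forms\<close>

text \<open>
  A tangent vector at \<open>p\<close> is the family of its components in the charts around \<open>p\<close>; the components
  in two such charts are related by the derivative of the transition map. At all other
  arguments the family is zero, so that tangent vectors are equal iff they are equal as functions.
\<close>

type_synonym ('m, 'e) tvec = "('m, 'e) chart \<Rightarrow> 'e"

definition transition_deriv ::
  "('m, 'e::euclidean_space) chart \<Rightarrow> ('m, 'e) chart \<Rightarrow> 'm \<Rightarrow> 'e \<Rightarrow> 'e" where
  "transition_deriv c d p = frechet_derivative (snd d \<circ> chart_inv c) (at (snd c p))"

definition tangent_space ::
  "('m, 'e::euclidean_space) chart set \<Rightarrow> 'm \<Rightarrow> ('m, 'e) tvec set" where
  "tangent_space A p =
     {X. (\<forall>c\<in>A. \<forall>d\<in>A. p \<in> fst c \<inter> fst d \<longrightarrow> X d = transition_deriv c d p (X c)) \<and>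
         (\<forall>c. \<not> (c \<in> A \<and> p \<in> fst c) \<longrightarrow> X c = 0)}"

text \<open>The tangent vector at \<open>p\<close> with component \<open>u\<close> in the chart \<open>c\<close>.\<close>

definition coord_vec ::
  "('m, 'e::euclidean_space) chart set \<Rightarrow> ('m, 'e) chart \<Rightarrow> 'm \<Rightarrow> 'e \<Rightarrow> ('m, 'e) tvec" where
  "coord_vec A c p u = (\<lambda>d. if d \<in> A \<and> p \<in> fst d then transition_deriv c d p u else 0)"

definition vector_field_on ::
  "('m, 'e::euclidean_space) chart set \<Rightarrow> 'm set \<Rightarrow> ('m \<Rightarrow> ('m, 'e) tvec) \<Rightarrow> bool" where
  "vector_field_on A U V \<longleftrightarrow>
     (\<forall>p\<in>U. V p \<in> tangent_space A p) \<and>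
     (\<forall>c\<in>A. smooth_on (snd c ` (U \<inter> fst c)) (\<lambda>x. V (chart_inv c x) c))"

type_synonym ('m, 'e) form1 = "'m \<Rightarrow> ('m, 'e) tvec \<Rightarrow> real"

definition one_form_on ::
  "('m, 'e::euclidean_space) chart set \<Rightarrow> 'm set \<Rightarrow> ('m, 'e) form1 \<Rightarrow> bool" where
  "one_form_on A U \<omega> \<longleftrightarrow>
     (\<forall>c\<in>A. (\<forall>p\<in>U \<inter> fst c. linear (\<lambda>u. \<omega> p (coord_vec A c p u))) \<and>
            (\<forall>u. smooth_on (snd c ` (U \<inter> fst c))
                   (\<lambda>x. \<omega> (chart_inv c x) (coord_vec A c (chart_inv c x) u))))"

text \<open>
  The exterior derivative of a 1-form, in the chart \<open>c\<close> at the coordinate point \<open>x\<close>, evaluated on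
  the coordinate vectors \<open>u\<close> and \<open>w\<close>.
\<close>

definition ext_deriv ::
  "('m, 'e::euclidean_space) chart set \<Rightarrow> ('m, 'e) form1 \<Rightarrow> ('m, 'e) chart \<Rightarrow>
     'e \<Rightarrow> 'e \<Rightarrow> 'e \<Rightarrow> real" where
  "ext_deriv A \<omega> c x u w =
     (let \<omega>c = (\<lambda>z y. \<omega> (chart_inv c y) (coord_vec A c (chart_inv c y) z))
      in frechet_derivative (\<omega>c w) (at x) u - frechet_derivative (\<omega>c u) (at x) w)"

definition closed_form_on ::
  "('m, 'e::euclidean_space) chart set \<Rightarrow> 'm set \<Rightarrow> ('m, 'e) form1 \<Rightarrow> bool" where
  "closed_form_on A U \<omega> \<longleftrightarrow>
     (\<forall>c\<in>A. \<forall>x\<in>snd c ` (U \<inter> fst c). \<forall>u w. ext_deriv A \<omega> c x u w = 0)"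


section \<open>Riemannian metrics\<close>

type_synonym ('m, 'e) metric = "'m \<Rightarrow> ('m, 'e) tvec \<Rightarrow> ('m, 'e) tvec \<Rightarrow> real"

text \<open>The metric in the chart \<open>c\<close>, at the coordinate point \<open>x\<close>.\<close>

definition local_metric ::
  "('m, 'e::euclidean_space) chart set \<Rightarrow> ('m, 'e) metric \<Rightarrow> ('m, 'e) chart \<Rightarrow>
     'e \<Rightarrow> 'e \<Rightarrow> 'e \<Rightarrow> real" where
  "local_metric A g c x u w =
     g (chart_inv c x) (coord_vec A c (chart_inv c x) u) (coord_vec A c (chart_inv c x) w)"

definition riemannian_manifold ::
  "'m topology \<Rightarrow> ('m, 'e::euclidean_space) chart set \<Rightarrow> ('m, 'e) metric \<Rightarrow> bool" where
  "riemannian_manifold M A g \<longleftrightarrow>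
     smooth_manifold M A \<and>
     (\<forall>c\<in>A.
        (\<forall>x\<in>snd c ` fst c.
           bilinear (local_metric A g c x) \<and>
           (\<forall>u w. local_metric A g c x u w = local_metric A g c x w u) \<and>
           (\<forall>u. u \<noteq> 0 \<longrightarrow> local_metric A g c x u u > 0)) \<and>
        (\<forall>u w. smooth_on (snd c ` fst c) (\<lambda>x. local_metric A g c x u w)))"

text \<open>
  The Levi-Civita connection in the chart \<open>c\<close> is \<open>\<nabla>\<^sub>u W = D\<^sub>u W + \<Gamma> u W\<close>, where the bilinear map
  \<open>\<Gamma>\<close> is determined at each point by vanishing torsion and compatibility with the metric.
\<close>

definition christoffel ::
  "('m, 'e::euclidean_space) chart set \<Rightarrow> ('m, 'e) metric \<Rightarrow> ('m, 'e) chart \<Rightarrow>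
     'e \<Rightarrow> 'e \<Rightarrow> 'e \<Rightarrow> 'e" where
  "christoffel A g c x =
     (THE \<Gamma>. bilinear \<Gamma> \<and> (\<forall>u w. \<Gamma> u w = \<Gamma> w u) \<and>
        (\<forall>z u w. frechet_derivative (\<lambda>y. local_metric A g c y u w) (at x) z =
           local_metric A g c x (\<Gamma> z u) w + local_metric A g c x u (\<Gamma> z w)))"

text \<open>
  The covariant derivative at \<open>p\<close> of a vector field \<open>V\<close> (defined near \<open>p\<close>) in the direction \<open>X\<close>,
  given by its components in the charts around \<open>p\<close>.
\<close>

definition cov_deriv ::
  "('m, 'e::euclidean_space) chart set \<Rightarrow> ('m, 'e) metric \<Rightarrow> ('m \<Rightarrow> ('m, 'e) tvec) \<Rightarrow>
     'm \<Rightarrow> ('m, 'e) tvec \<Rightarrow> ('m, 'e) tvec" where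
  "cov_deriv A g V p X =
     (\<lambda>c. if c \<in> A \<and> p \<in> fst c
          then frechet_derivative (\<lambda>y. V (chart_inv c y) c) (at (snd c p)) (X c)
               + christoffel A g c (snd c p) (X c) (V p c)
          else 0)"

text \<open>\<open>R(X,Y)Z = \<nabla>\<^sub>X\<nabla>\<^sub>YZ - \<nabla>\<^sub>Y\<nabla>\<^sub>XZ - \<nabla>\<^bsub>[X,Y]\<^esub>Z\<close>, computed for constant coordinate fields.\<close>

definition curvature ::
  "('m, 'e::euclidean_space) chart set \<Rightarrow> ('m, 'e) metric \<Rightarrow> 'm \<Rightarrow>
     ('m, 'e) tvec \<Rightarrow> ('m, 'e) tvec \<Rightarrow> ('m, 'e) tvec \<Rightarrow> ('m, 'e) tvec" where
  "curvature A g p X Y Z =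
     (\<lambda>c. if c \<in> A \<and> p \<in> fst c
          then let \<Gamma> = christoffel A g c; x = snd c p in
               frechet_derivative (\<lambda>y. \<Gamma> y (Y c) (Z c)) (at x) (X c)
               - frechet_derivative (\<lambda>y. \<Gamma> y (X c) (Z c)) (at x) (Y c)
               + \<Gamma> x (X c) (\<Gamma> x (Y c) (Z c)) - \<Gamma> x (Y c) (\<Gamma> x (X c) (Z c))
          else 0)"

definition lin_indep2 :: "('m, 'e::euclidean_space) tvec \<Rightarrow> ('m, 'e) tvec \<Rightarrow> bool" where
  "lin_indep2 X Y \<longleftrightarrow>
     (\<forall>a b :: real. (\<forall>c. a *\<^sub>R X c + b *\<^sub>R Y c = 0) \<longrightarrow> a = 0 \<and> b = 0)"

definition sectional_curvature ::
  "('m, 'e::euclidean_space) chart set \<Rightarrow> ('m, 'e) metric \<Rightarrow> 'm \<Rightarrow>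
     ('m, 'e) tvec \<Rightarrow> ('m, 'e) tvec \<Rightarrow> real" where
  "sectional_curvature A g p X Y =
     g p (curvature A g p X Y Y) X / (g p X X * g p Y Y - (g p X Y)\<^sup>2)"

definition constant_sectional_curvature ::
  "'m topology \<Rightarrow> ('m, 'e::euclidean_space) chart set \<Rightarrow> ('m, 'e) metric \<Rightarrow> real \<Rightarrow> bool" where
  "constant_sectional_curvature M A g K \<longleftrightarrow>
     (\<forall>p\<in>topspace M. \<forall>X\<in>tangent_space A p. \<forall>Y\<in>tangent_space A p.
        lin_indep2 X Y \<longrightarrow> sectional_curvature A g p X Y = K)"


section \<open>Orthonormal frames, dual forms and connection forms\<close>

text \<open>Frames and coframes are indexed by \<open>{1..DIM('e)}\<close>; other indices are irrelevant.\<close>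

definition orthonormal_basis_at ::
  "('m, 'e::euclidean_space) chart set \<Rightarrow> ('m, 'e) metric \<Rightarrow> 'm \<Rightarrow>
     (nat \<Rightarrow> ('m, 'e) tvec) \<Rightarrow> bool" where
  "orthonormal_basis_at A g p b \<longleftrightarrow>
     (\<forall>i\<in>{1..DIM('e)}. b i \<in> tangent_space A p) \<and>
     (\<forall>i\<in>{1..DIM('e)}. \<forall>j\<in>{1..DIM('e)}. g p (b i) (b j) = (if i = j then 1 else 0))"

definition orthonormal_frame_on ::
  "('m, 'e::euclidean_space) chart set \<Rightarrow> ('m, 'e) metric \<Rightarrow> 'm set \<Rightarrow>
     (nat \<Rightarrow> 'm \<Rightarrow> ('m, 'e) tvec) \<Rightarrow> bool" where
  "orthonormal_frame_on A g U v \<longleftrightarrow>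
     (\<forall>i\<in>{1..DIM('e)}. vector_field_on A U (v i)) \<and>
     (\<forall>p\<in>U. orthonormal_basis_at A g p (\<lambda>i. v i p))"

definition dual_forms_on ::
  "('m, 'e::euclidean_space) chart set \<Rightarrow> 'm set \<Rightarrow> (nat \<Rightarrow> 'm \<Rightarrow> ('m, 'e) tvec) \<Rightarrow>
     (nat \<Rightarrow> ('m, 'e) form1) \<Rightarrow> bool" where
  "dual_forms_on A U v \<theta> \<longleftrightarrow>
     (\<forall>i\<in>{1..DIM('e)}. one_form_on A U (\<theta> i)) \<and>
     (\<forall>i\<in>{1..DIM('e)}. \<forall>j\<in>{1..DIM('e)}. \<forall>p\<in>U. \<theta> i p (v j p) = (if i = j then 1 else 0))"

definition connection_form ::
  "('m, 'e::euclidean_space) chart set \<Rightarrow> ('m, 'e) metric \<Rightarrow>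
     (nat \<Rightarrow> 'm \<Rightarrow> ('m, 'e) tvec) \<Rightarrow> nat \<Rightarrow> nat \<Rightarrow> ('m, 'e) form1" where
  "connection_form A g v i j p X = g p (cov_deriv A g (v i) p X) (v j p)"


section \<open>Curves, geodesics and horocycles\<close>

text \<open>All curves are defined on an open interval \<open>I\<close>.\<close>

definition open_interval :: "real set \<Rightarrow> bool" where
  "open_interval I \<longleftrightarrow> open I \<and> is_interval I"

definition smooth_curve ::
  "'m topology \<Rightarrow> ('m, 'e::euclidean_space) chart set \<Rightarrow> real set \<Rightarrow> (real \<Rightarrow> 'm) \<Rightarrow> bool" where
  "smooth_curve M A I \<gamma> \<longleftrightarrow>
     open_interval I \<and> continuous_map (top_of_set I) M \<gamma> \<and>
     (\<forall>c\<in>A. smooth_on (I \<inter> \<gamma> -` fst c) (snd c \<circ> \<gamma>))"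

definition velocity ::
  "('m, 'e::euclidean_space) chart set \<Rightarrow> (real \<Rightarrow> 'm) \<Rightarrow> real \<Rightarrow> ('m, 'e) tvec" where
  "velocity A \<gamma> t =
     (\<lambda>c. if c \<in> A \<and> \<gamma> t \<in> fst c then vector_derivative (snd c \<circ> \<gamma>) (at t) else 0)"

definition field_along ::
  "('m, 'e::euclidean_space) chart set \<Rightarrow> real set \<Rightarrow> (real \<Rightarrow> 'm) \<Rightarrow>
     (real \<Rightarrow> ('m, 'e) tvec) \<Rightarrow> bool" where
  "field_along A I \<gamma> W \<longleftrightarrow>
     (\<forall>t\<in>I. W t \<in> tangent_space A (\<gamma> t)) \<and>
     (\<forall>c\<in>A. smooth_on (I \<inter> \<gamma> -` fst c) (\<lambda>t. W t c))"

text \<open>The covariant derivative along \<open>\<gamma>\<close> of a field along \<open>\<gamma>\<close>.\<close>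

definition cov_deriv_along ::
  "('m, 'e::euclidean_space) chart set \<Rightarrow> ('m, 'e) metric \<Rightarrow> (real \<Rightarrow> 'm) \<Rightarrow>
     (real \<Rightarrow> ('m, 'e) tvec) \<Rightarrow> real \<Rightarrow> ('m, 'e) tvec" where
  "cov_deriv_along A g \<gamma> W t =
     (\<lambda>c. if c \<in> A \<and> \<gamma> t \<in> fst c
          then vector_derivative (\<lambda>s. W s c) (at t)
               + christoffel A g c (snd c (\<gamma> t)) (velocity A \<gamma> t c) (W t c)
          else 0)"

definition geodesic ::
  "'m topology \<Rightarrow> ('m, 'e::euclidean_space) chart set \<Rightarrow> ('m, 'e) metric \<Rightarrow>
     real set \<Rightarrow> (real \<Rightarrow> 'm) \<Rightarrow> bool" where
  "geodesic M A g I \<gamma> \<longleftrightarrow>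
     smooth_curve M A I \<gamma> \<and>
     (\<forall>t\<in>I. cov_deriv_along A g \<gamma> (velocity A \<gamma>) t = (\<lambda>_. 0))"

text \<open>
  The intrinsic description of (unit-speed) horocycles in a manifold of constant sectional
  curvature -1.
\<close>

definition horocycle ::
  "'m topology \<Rightarrow> ('m, 'e::euclidean_space) chart set \<Rightarrow> ('m, 'e) metric \<Rightarrow>
     real set \<Rightarrow> (real \<Rightarrow> 'm) \<Rightarrow> bool" where
  "horocycle M A g I \<gamma> \<longleftrightarrow>
     smooth_curve M A I \<gamma> \<and>
     (\<forall>t\<in>I. g (\<gamma> t) (velocity A \<gamma> t) (velocity A \<gamma> t) = 1) \<and>
     (\<exists>N. field_along A I \<gamma> N \<and>
        (\<forall>t\<in>I. g (\<gamma> t) (N t) (N t) = 1 \<and> g (\<gamma> t) (N t) (velocity A \<gamma> t) = 0 \<and>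
           cov_deriv_along A g \<gamma> (velocity A \<gamma>) t = N t \<and>
           cov_deriv_along A g \<gamma> N t = (\<lambda>c. - velocity A \<gamma> t c)))"

text \<open>Integral curves are only required to be differentiable here; smoothness follows.\<close>

definition integral_curve ::
  "'m topology \<Rightarrow> ('m, 'e::euclidean_space) chart set \<Rightarrow> 'm set \<Rightarrow> ('m \<Rightarrow> ('m, 'e) tvec) \<Rightarrow>
     real set \<Rightarrow> (real \<Rightarrow> 'm) \<Rightarrow> bool" where
  "integral_curve M A U V I \<gamma> \<longleftrightarrow>
     open_interval I \<and> continuous_map (top_of_set I) M \<gamma> \<and> \<gamma> ` I \<subseteq> U \<and>
     (\<forall>t\<in>I. \<forall>c\<in>A. \<gamma> t \<in> fst c \<longrightarrow>
        ((snd c \<circ> \<gamma>) has_vector_derivative V (\<gamma> t) c) (at t))"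

definition tangent_to_geodesics ::
  "'m topology \<Rightarrow> ('m, 'e::euclidean_space) chart set \<Rightarrow> ('m, 'e) metric \<Rightarrow> 'm set \<Rightarrow>
     ('m \<Rightarrow> ('m, 'e) tvec) \<Rightarrow> bool" where
  "tangent_to_geodesics M A g U V \<longleftrightarrow>
     (\<forall>I \<gamma>. integral_curve M A U V I \<gamma> \<longrightarrow> geodesic M A g I \<gamma>)"

definition tangent_to_horocycles ::
  "'m topology \<Rightarrow> ('m, 'e::euclidean_space) chart set \<Rightarrow> ('m, 'e) metric \<Rightarrow> 'm set \<Rightarrow>
     ('m \<Rightarrow> ('m, 'e) tvec) \<Rightarrow> bool" where
  "tangent_to_horocycles M A g U V \<longleftrightarrow>
     (\<forall>I \<gamma>. integral_curve M A U V I \<gamma> \<longrightarrow> horocycle M A g I \<gamma>)"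


section \<open>The frame equations\<close>

definition frame_equations_on ::
  "('m, 'e::euclidean_space) chart set \<Rightarrow> ('m, 'e) metric \<Rightarrow> 'm set \<Rightarrow>
     (nat \<Rightarrow> 'm \<Rightarrow> ('m, 'e) tvec) \<Rightarrow> (nat \<Rightarrow> ('m, 'e) form1) \<Rightarrow> bool" where
  "frame_equations_on A g U v \<theta> \<longleftrightarrow>
     (\<forall>p\<in>U. \<forall>X\<in>tangent_space A p.
        (\<forall>i\<in>{2..DIM('e)}. connection_form A g v 1 i p X + \<theta> i p X = 0) \<and>
        (\<forall>i\<in>{2..DIM('e)}. \<forall>j\<in>{2..DIM('e)}. i \<noteq> j \<longrightarrow> connection_form A g v i j p X = 0))"

end

theory Submission
  imports Defs
begin

text \<open>
  Locally, curvature \<open>-1\<close> means that the connection \<open>(W, \<phi>) \<mapsto> (\<nabla> W - \<phi> \<cdot> id, d\<phi> - g(W, \<cdot>))\<close> on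
  \<open>TM \<oplus> \<real>\<close> is flat, and that it preserves the Lorentzian form \<open>g(W, W') - \<phi> \<phi>'\<close>. Extending
  \<open>(-v\<^sub>1, 1)\<close> and \<open>(v\<^sub>i, 0)\<close> to parallel sections \<open>(W\<^sub>i, \<phi>\<^sub>i)\<close> turns the nonlinear frame equations into
  linear ones: \<open>-W\<^sub>1 / \<phi>\<^sub>1\<close> and \<open>W\<^sub>i - (\<phi>\<^sub>i / \<phi>\<^sub>1) W\<^sub>1\<close> form the required frame. Conversely,
  the frame equations read \<open>\<nabla>\<^sub>u v\<^sub>1 = g(u, v\<^sub>1) v\<^sub>1 - u\<close> and \<open>\<nabla>\<^sub>u v\<^sub>i = g(u, v\<^sub>i) v\<^sub>1\<close>; differentiating them
  once more determines the curvature tensor, and inserting \<open>u = v\<^sub>i\<close> gives the geodesics and horocycles.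
\<close>

section \<open>Calculus of smooth maps\<close>

text \<open>The initial value \<open>(-v_1, 1)\<close> has Lorentzian square 0, so the pair
  \<open>(W_1, \<phi>_1)\<close> plays the role of a light-like vector of Minkowski space, that is,
  of a point at infinity. The level sets of \<open>\<phi>_1\<close> are the horospheres centred
  there, and \<open>v_1\<close> is their normal. As \<open>\<phi>_1\<close> has differential
  \<open>g(W_1, .)\<close>, the form \<open>\<theta>_1\<close> of the constructed frame is
  \<open>- d log \<phi>_1\<close>, hence closed; for an arbitrary frame that satisfies the
  equations, closedness comes from the symmetry of the endomorphism \<open>\<nabla> v_1\<close>. The
  frame lives only where \<open>\<phi>_1\<close> is positive, which is why it is local. The passage
  from charts to the manifold has an obstacle of its own. A tangent vector is a family of
  components, and \<open>g\<close> is constrained only on families that transform correctly. Before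
  \<open>g\<close> can be evaluated on a covariant derivative or on a curvature vector, these must
  be shown to be tangent vectors. The transformation law of the Christoffel symbols behind this is
  obtained from the uniqueness of the Levi-Civita connection, without computing with metric
  coefficients.\<close>

abbreviation FD :: "('a::real_normed_vector \<Rightarrow> 'b::real_normed_vector) \<Rightarrow> 'a \<Rightarrow> 'a \<Rightarrow> 'b" where
  "FD f x \<equiv> frechet_derivative f (at x)"

text \<open>Differentiability is not at issue: both functions have the same candidates for a
  derivative at the point, so the choice in \<open>frechet_derivative\<close> falls on the same
  one.\<close>

lemma frechet_derivative_cong_open:
  assumes "open S" "x \<in> S" "\<And>y. y \<in> S \<Longrightarrow> f y = g y"
  shows "FD f x = FD g x"
proof -
  have "(f has_derivative D) (at x) \<longleftrightarrow> (g has_derivative D) (at x)" for D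
    using assms by (metis has_derivative_transform_within_open)
  then show ?thesis
    unfolding frechet_derivative_def by presburger
qed

lemma Ck_on_cong:
  assumes "open S" "\<And>x. x \<in> S \<Longrightarrow> f x = g x" "Ck_on k S f"
  shows "Ck_on k S g"
  using assms(2,3)
proof (induction k arbitrary: f g)
  case 0
  then show ?case by (metis Ck_on.simps(1) continuous_on_cong)
next
  case (Suc k)
  have "g differentiable at x" if "x \<in> S" for x
    using Suc.prems that assms(1)
    by (metis Ck_on.simps(2) differentiable_def has_derivative_transform_within_open)
  moreover have "Ck_on k S (\<lambda>x. FD g x v)" for v
  proof (rule Suc.IH[of "\<lambda>x. FD f x v"])
    show "FD f x v = FD g x v" if "x \<in> S" for x
      using frechet_derivative_cong_open[OF assms(1) that] Suc.prems(1) by metis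
  qed (use Suc.prems(2) in auto)
  ultimately show ?case by simp
qed

text \<open>\<open>Ck_on\<close> is phrased with \<open>frechet_derivative\<close>. This rule
  accepts an explicit formula for the derivative instead, and most inductions on the order of
  differentiability run through it.\<close>

lemma Ck_on_SucI:
  assumes "open S" "\<And>x. x \<in> S \<Longrightarrow> (f has_derivative f' x) (at x)" "\<And>v. Ck_on k S (\<lambda>x. f' x v)"
  shows "Ck_on (Suc k) S f"
proof -
  have "FD f x = f' x" if "x \<in> S" for x
    using assms(2)[OF that] by (metis frechet_derivative_at)
  then have "Ck_on k S (\<lambda>x. FD f x v)" for v
    using Ck_on_cong[OF assms(1) _ assms(3)[of v]] by auto
  then show ?thesis using assms(2) by (auto simp: differentiable_def)
qed

lemma Ck_on_subset: "Ck_on k S f \<Longrightarrow> T \<subseteq> S \<Longrightarrow> Ck_on k T f"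
  by (induction k arbitrary: f) (auto intro: continuous_on_subset)

lemma Ck_on_SucD: "Ck_on (Suc k) S f \<Longrightarrow> Ck_on k S f"
proof (induction k arbitrary: f)
  case 0
  then show ?case
    by (auto intro!: continuous_at_imp_continuous_on differentiable_imp_continuous_within)
next
  case (Suc k)
  then show ?case by (metis Ck_on.simps(2))
qed

lemma Ck_on_const: "Ck_on k S (\<lambda>x. a)"
  by (induction k arbitrary: a) auto

lemma Ck_on_has_derivative:
  "Ck_on (Suc k) S f \<Longrightarrow> x \<in> S \<Longrightarrow> (f has_derivative FD f x) (at x)"
  by (simp add: frechet_derivative_works)

lemma Ck_on_bounded_linear:
  assumes "bounded_linear h" "open S" "Ck_on k S f"
  shows "Ck_on k S (\<lambda>x. h (f x))"
  using assms(3)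
proof (induction k arbitrary: f)
  case 0
  then show ?case using assms(1) by (simp add: bounded_linear.continuous_on)
next
  case (Suc k)
  show ?case
  proof (rule Ck_on_SucI[OF assms(2)])
    show "((\<lambda>x. h (f x)) has_derivative (\<lambda>v. h (FD f x v))) (at x)"
      if "x \<in> S" for x
      using bounded_linear.has_derivative[OF assms(1)] Ck_on_has_derivative[OF Suc.prems that] .
  qed (use Suc assms(2) in auto)
qed

lemma Ck_on_ident:
  assumes "open S" shows "Ck_on k S (\<lambda>x. x)"
  by (cases k) (auto simp: Ck_on_const intro: Ck_on_SucI[OF assms])

lemma Ck_on_add:
  assumes "open S" "Ck_on k S f" "Ck_on k S g"
  shows "Ck_on k S (\<lambda>x. f x + g x)"
  using assms(2,3)
proof (induction k arbitrary: f g)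
  case 0
  then show ?case by (simp add: continuous_on_add)
next
  case (Suc k)
  show ?case
  proof (rule Ck_on_SucI[OF assms(1)])
    show "((\<lambda>x. f x + g x) has_derivative
      (\<lambda>v. FD f x v + FD g x v)) (at x)" if "x \<in> S" for x
      using Ck_on_has_derivative[OF Suc.prems(1) that] Ck_on_has_derivative[OF Suc.prems(2) that]
      by (rule has_derivative_add)
  qed (use Suc assms(1) in auto)
qed

lemma Ck_on_sum:
  assumes "open S" "\<And>i. i \<in> I \<Longrightarrow> Ck_on k S (f i)"
  shows "Ck_on k S (\<lambda>x. \<Sum>i\<in>I. f i x)"
  using assms(2) by (induction I rule: infinite_finite_induct)
    (auto simp: Ck_on_const intro: Ck_on_add[OF assms(1)])

lemma Ck_on_bounded_bilinear:
  assumes "bounded_bilinear h" "open S" "Ck_on k S f" "Ck_on k S g"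
  shows "Ck_on k S (\<lambda>x. h (f x) (g x))"
  using assms(3,4)
proof (induction k arbitrary: f g)
  case 0
  then show ?case using assms(1) by (simp add: bounded_bilinear.continuous_on)
next
  case (Suc k)
  show ?case
  proof (rule Ck_on_SucI[OF assms(2)])
    show "((\<lambda>x. h (f x) (g x)) has_derivative (\<lambda>v. h (f x) (FD g x v)
        + h (FD f x v) (g x))) (at x)" if "x \<in> S" for x
      using bounded_bilinear.FDERIV[OF assms(1) Ck_on_has_derivative[OF Suc.prems(1) that]
        Ck_on_has_derivative[OF Suc.prems(2) that]] .
    show "Ck_on k S (\<lambda>x. h (f x) (FD g x v)
        + h (FD f x v) (g x))" for v
      using Suc.prems Ck_on_SucD[OF Suc.prems(1)] Ck_on_SucD[OF Suc.prems(2)]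
      by (intro Ck_on_add assms(2) Suc.IH) auto
  qed
qed

lemma linear_expand_Basis:
  assumes "linear h"
  shows "h v = (\<Sum>b\<in>Basis. (v \<bullet> b) *\<^sub>R h (b::'a::euclidean_space))"
proof -
  have "h v = h (\<Sum>b\<in>Basis. (v \<bullet> b) *\<^sub>R b)" by (simp add: euclidean_representation)
  then show ?thesis using assms by (simp add: linear_sum linear_cmul)
qed

text \<open>In the chain rule the direction \<open>FD h x v\<close> in which \<open>f\<close> is
  differentiated moves with \<open>x\<close>, whereas the induction hypothesis is about fixed
  directions. Expanding this direction in \<open>Basis\<close> leaves only the functions
  \<open>FD f (h x) b\<close> with \<open>b\<close> fixed.\<close>

lemma Ck_on_compose:
  fixes f :: "'b::euclidean_space \<Rightarrow> 'c::real_normed_vector"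
    and h :: "'a::euclidean_space \<Rightarrow> 'b"
  assumes "open S" "Ck_on k T f" "Ck_on k S h" "h ` S \<subseteq> T"
  shows "Ck_on k S (\<lambda>x. f (h x))"
  using assms(2,3)
proof (induction k arbitrary: f)
  case 0
  then show ?case
    using assms(4) by (auto intro: continuous_on_compose2)
next
  case (Suc k)
  have h: "Ck_on k S h" using Suc.prems(2) by (rule Ck_on_SucD)
  show ?case
  proof (rule Ck_on_SucI[OF assms(1)])
    show "((\<lambda>x. f (h x)) has_derivative
      (\<lambda>v. \<Sum>b\<in>Basis. (FD h x v \<bullet> b) *\<^sub>R FD f (h x) b)) (at x)"
      if "x \<in> S" for x
    proof -
      have f': "(f has_derivative FD f (h x)) (at (h x))"
        using Ck_on_has_derivative[OF Suc.prems(1)] that assms(4) by blast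
      have "((\<lambda>x. f (h x)) has_derivative
         (\<lambda>v. FD f (h x) (FD h x v))) (at x)"
        using has_derivative_compose[OF Ck_on_has_derivative[OF Suc.prems(2) that] f'] .
      then show ?thesis
        by (rule has_derivative_eq_rhs) (rule ext, rule linear_expand_Basis[OF has_derivative_linear[OF f']])
    qed
    show "Ck_on k S (\<lambda>x. \<Sum>b\<in>Basis.
       (FD h x v \<bullet> b) *\<^sub>R FD f (h x) b)" for v
    proof (intro Ck_on_sum Ck_on_bounded_bilinear[OF bounded_bilinear_scaleR] assms(1))
      show "Ck_on k S (\<lambda>x. FD h x v \<bullet> b)" for b
        using Suc.prems(2) by (intro Ck_on_bounded_linear[OF bounded_linear_inner_left] assms(1)) auto
      show "Ck_on k S (\<lambda>x. FD f (h x) b)" for b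
        using Suc.prems(1) h by (intro Suc.IH) auto
    qed
  qed
qed

text \<open>The derivative is a polynomial in the inverse itself and the derivative of
  \<open>f\<close>, so the induction closes.\<close>

lemma Ck_on_inverse:
  fixes f :: "'a::euclidean_space \<Rightarrow> real"
  assumes "open S" "Ck_on k S f" "\<And>x. x \<in> S \<Longrightarrow> f x \<noteq> 0"
  shows "Ck_on k S (\<lambda>x. inverse (f x))"
  using assms(2)
proof (induction k)
  case 0
  then show ?case using assms(3) by (auto intro: continuous_on_inverse)
next
  case (Suc k)
  have i: "Ck_on k S (\<lambda>x. inverse (f x))" using Suc.prems Suc.IH Ck_on_SucD by blast
  show ?case
  proof (rule Ck_on_SucI[OF assms(1)])
    show "((\<lambda>x. inverse (f x)) has_derivative
      (\<lambda>v. - (inverse (f x) * (FD f x v * inverse (f x))))) (at x)" if "x \<in> S" for x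
      using Deriv.has_derivative_inverse[OF assms(3)[OF that] Ck_on_has_derivative[OF Suc.prems that]]
      by (simp add: mult.assoc)
    show "Ck_on k S (\<lambda>x. - (inverse (f x) * (FD f x v * inverse (f x))))" for v
      using Suc.prems
      by (intro Ck_on_bounded_linear[OF bounded_linear_minus[OF bounded_linear_ident]]
            Ck_on_bounded_bilinear[OF bounded_bilinear_mult] i assms(1)) auto
  qed
qed

lemma smooth_on_cong:
  assumes "open S" "smooth_on S f" "\<And>x. x \<in> S \<Longrightarrow> f x = g x"
  shows "smooth_on S g"
  using assms Ck_on_cong[of S f g] by (simp add: smooth_on_def)

lemma smooth_on_subset: "smooth_on S f \<Longrightarrow> T \<subseteq> S \<Longrightarrow> smooth_on T f"
  by (auto simp: smooth_on_def intro: Ck_on_subset)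

lemma smooth_on_const: "smooth_on S (\<lambda>x. a)"
  by (simp add: smooth_on_def Ck_on_const)

lemma smooth_on_bounded_linear:
  "bounded_linear h \<Longrightarrow> open S \<Longrightarrow> smooth_on S f \<Longrightarrow> smooth_on S (\<lambda>x. h (f x))"
  by (simp add: smooth_on_def Ck_on_bounded_linear)

lemma smooth_on_add:
  "open S \<Longrightarrow> smooth_on S f \<Longrightarrow> smooth_on S g \<Longrightarrow> smooth_on S (\<lambda>x. f x + g x)"
  by (simp add: smooth_on_def Ck_on_add)

lemma smooth_on_minus:
  "open S \<Longrightarrow> smooth_on S f \<Longrightarrow> smooth_on S (\<lambda>x. - f x)"
  by (rule smooth_on_bounded_linear[OF bounded_linear_minus[OF bounded_linear_ident]])

lemma smooth_on_diff:
  "open S \<Longrightarrow> smooth_on S f \<Longrightarrow> smooth_on S g \<Longrightarrow> smooth_on S (\<lambda>x. f x - g x)"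
  using smooth_on_add[of S f "\<lambda>x. - g x"] smooth_on_minus[of S g] by simp

lemma smooth_on_sum:
  "open S \<Longrightarrow> (\<And>i. i \<in> I \<Longrightarrow> smooth_on S (f i)) \<Longrightarrow> smooth_on S (\<lambda>x. \<Sum>i\<in>I. f i x)"
  by (simp add: smooth_on_def Ck_on_sum)

lemma smooth_on_scaleR:
  "open S \<Longrightarrow> smooth_on S f \<Longrightarrow> smooth_on S g \<Longrightarrow> smooth_on S (\<lambda>x. f x *\<^sub>R g x)"
  by (simp add: smooth_on_def Ck_on_bounded_bilinear[OF bounded_bilinear_scaleR])

lemma smooth_on_compose:
  fixes f :: "'b::euclidean_space \<Rightarrow> 'c::real_normed_vector"
    and h :: "'a::euclidean_space \<Rightarrow> 'b"
  shows "open S \<Longrightarrow> smooth_on T f \<Longrightarrow> smooth_on S h \<Longrightarrow> h ` S \<subseteq> T \<Longrightarrow> smooth_on S (\<lambda>x. f (h x))"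
  by (simp add: smooth_on_def Ck_on_compose[of S _ T])

lemma smooth_on_inverse:
  fixes f :: "'a::euclidean_space \<Rightarrow> real"
  shows "open S \<Longrightarrow> smooth_on S f \<Longrightarrow> (\<And>x. x \<in> S \<Longrightarrow> f x \<noteq> 0) \<Longrightarrow> smooth_on S (\<lambda>x. inverse (f x))"
  by (simp add: smooth_on_def Ck_on_inverse)

lemma smooth_on_Pair:
  assumes "open S" "smooth_on S f" "smooth_on S g"
  shows "smooth_on S (\<lambda>x. (f x, g x))"
proof -
  have "smooth_on S (\<lambda>x. (f x, 0) + (0, g x))"
    by (intro smooth_on_add assms smooth_on_bounded_linear[of "\<lambda>a. (a, 0)"]
        smooth_on_bounded_linear[of "\<lambda>a. (0, a)"])
      (auto intro!: bounded_linear_Pair bounded_linear_ident bounded_linear_zero)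
  then show ?thesis by simp
qed

lemma smooth_on_frechet_derivative:
  "smooth_on S f \<Longrightarrow> smooth_on S (\<lambda>x. FD f x v)"
  by (metis Ck_on.simps(2) smooth_on_def)

lemma smooth_on_has_derivative:
  "smooth_on S f \<Longrightarrow> x \<in> S \<Longrightarrow> (f has_derivative FD f x) (at x)"
  unfolding smooth_on_def using Ck_on_has_derivative by blast

lemma smooth_on_differentiable:
  "smooth_on S f \<Longrightarrow> x \<in> S \<Longrightarrow> f differentiable at x"
  using smooth_on_has_derivative differentiable_def by blast

lemma smooth_on_continuous: "smooth_on S f \<Longrightarrow> continuous_on S f"
  by (metis Ck_on.simps(1) smooth_on_def)

text \<open>Families of linear maps are called smooth here when they are smooth on each fixed
  vector. The finite expansion of \<open>V x\<close> in \<open>Basis\<close> reduces a moving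
  argument to this case.\<close>

lemma Ck_on_linear_apply:
  fixes \<Phi> :: "'a::euclidean_space \<Rightarrow> 'b::euclidean_space \<Rightarrow> 'c::real_normed_vector"
  assumes "open S" "\<And>x. x \<in> S \<Longrightarrow> linear (\<Phi> x)" "\<And>u. Ck_on k S (\<lambda>x. \<Phi> x u)" "Ck_on k S V"
  shows "Ck_on k S (\<lambda>x. \<Phi> x (V x))"
proof (rule Ck_on_cong[OF assms(1)])
  show "Ck_on k S (\<lambda>x. \<Sum>b\<in>Basis. (V x \<bullet> b) *\<^sub>R \<Phi> x b)"
    by (intro Ck_on_sum Ck_on_bounded_bilinear[OF bounded_bilinear_scaleR]
        Ck_on_bounded_linear[OF bounded_linear_inner_left] assms)
  show "(\<Sum>b\<in>Basis. (V x \<bullet> b) *\<^sub>R \<Phi> x b) = \<Phi> x (V x)" if "x \<in> S" for x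
    using linear_expand_Basis[OF assms(2)[OF that]] by metis
qed

lemma smooth_on_linear_apply:
  fixes \<Phi> :: "'a::euclidean_space \<Rightarrow> 'b::euclidean_space \<Rightarrow> 'c::real_normed_vector"
  assumes "open S" "\<And>x. x \<in> S \<Longrightarrow> linear (\<Phi> x)" "\<And>u. smooth_on S (\<lambda>x. \<Phi> x u)" "smooth_on S V"
  shows "smooth_on S (\<lambda>x. \<Phi> x (V x))"
  using assms by (simp add: smooth_on_def Ck_on_linear_apply)

lemma bilinear_linear: "bilinear B \<Longrightarrow> linear (B u)" "bilinear B \<Longrightarrow> linear (\<lambda>u. B u v)"
  by (auto simp: bilinear_def)

lemma smooth_on_bilinear_apply:
  fixes \<Phi> :: "'a::euclidean_space \<Rightarrow> 'b::euclidean_space \<Rightarrow> 'd::euclidean_space \<Rightarrow> 'c::real_normed_vector"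
  assumes "open S" "\<And>x. x \<in> S \<Longrightarrow> bilinear (\<Phi> x)" "\<And>u w. smooth_on S (\<lambda>x. \<Phi> x u w)"
    "smooth_on S V" "smooth_on S W"
  shows "smooth_on S (\<lambda>x. \<Phi> x (V x) (W x))"
proof (rule smooth_on_linear_apply[where \<Phi> = "\<lambda>x w. \<Phi> x (V x) w"])
  show "smooth_on S (\<lambda>x. \<Phi> x (V x) w)" for w
    by (rule smooth_on_linear_apply[where \<Phi> = "\<lambda>x u. \<Phi> x u w"])
      (use assms in \<open>auto simp: bilinear_linear\<close>)
qed (use assms in \<open>auto simp: bilinear_linear\<close>)

lemma has_derivative_linear_apply:
  fixes \<Phi> :: "'a::real_normed_vector \<Rightarrow> 'b::euclidean_space \<Rightarrow> 'c::real_normed_vector"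
  assumes "open S" "x \<in> S" "\<And>x. x \<in> S \<Longrightarrow> linear (\<Phi> x)"
    and D: "\<And>u. ((\<lambda>y. \<Phi> y u) has_derivative D u) (at x)"
    and V: "(V has_derivative V') (at x)"
  shows "((\<lambda>y. \<Phi> y (V y)) has_derivative (\<lambda>h. D (V x) h + \<Phi> x (V' h))) (at x)"
proof -
  have 1: "(\<Sum>b\<in>Basis. (V y \<bullet> b) *\<^sub>R \<Phi> y b) = \<Phi> y (V y)" if "y \<in> S" for y
    using linear_expand_Basis[OF assms(3)[OF that]] by metis
  have 2: "((\<lambda>y. \<Sum>b\<in>Basis. (V y \<bullet> b) *\<^sub>R \<Phi> y b) has_derivative
    (\<lambda>h. \<Sum>b\<in>Basis. (V x \<bullet> b) *\<^sub>R D b h + (V' h \<bullet> b) *\<^sub>R \<Phi> x b)) (at x)"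
    by (auto intro!: derivative_eq_intros D V)
  \<comment> \<open>Linearity of \<open>D\<close> in \<open>u\<close> is not assumed. It follows
    from that of \<open>\<Phi>\<close> by differentiating the expansion in \<open>Basis\<close> and
    using uniqueness of derivatives.\<close>
  have 3: "D u h = (\<Sum>b\<in>Basis. (u \<bullet> b) *\<^sub>R D b h)" for u h
  proof -
    have "((\<lambda>y. \<Sum>b\<in>Basis. (u \<bullet> b) *\<^sub>R \<Phi> y b) has_derivative
      (\<lambda>h. \<Sum>b\<in>Basis. (u \<bullet> b) *\<^sub>R D b h)) (at x)"
      by (auto intro!: derivative_eq_intros D)
    then have "((\<lambda>y. \<Phi> y u) has_derivative (\<lambda>h. \<Sum>b\<in>Basis. (u \<bullet> b) *\<^sub>R D b h)) (at x)"
      using has_derivative_transform_within_open[OF _ assms(1,2)]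
        linear_expand_Basis[OF assms(3)] by (metis (no_types, lifting))
    then show ?thesis using D has_derivative_unique by metis
  qed
  have 4: "\<Phi> x (V' h) = (\<Sum>b\<in>Basis. (V' h \<bullet> b) *\<^sub>R \<Phi> x b)" for h
    using linear_expand_Basis[OF assms(3)[OF assms(2)]] .
  have "((\<lambda>y. \<Phi> y (V y)) has_derivative
     (\<lambda>h. \<Sum>b\<in>Basis. (V x \<bullet> b) *\<^sub>R D b h + (V' h \<bullet> b) *\<^sub>R \<Phi> x b)) (at x)"
    using has_derivative_transform_within_open[OF 2 assms(1,2) 1] .
  then show ?thesis by (simp add: 3[of "V x"] 4 sum.distrib)
qed

lemma has_derivative_bilinear_apply:
  fixes \<Phi> :: "'a::real_normed_vector \<Rightarrow> 'b::euclidean_space \<Rightarrow> 'd::euclidean_space \<Rightarrow> 'c::real_normed_vector"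
  assumes "open S" "x \<in> S" "\<And>x. x \<in> S \<Longrightarrow> bilinear (\<Phi> x)"
    and D: "\<And>u w. ((\<lambda>y. \<Phi> y u w) has_derivative D u w) (at x)"
    and V: "(V has_derivative V') (at x)"
    and W: "(W has_derivative W') (at x)"
  shows "((\<lambda>y. \<Phi> y (V y) (W y)) has_derivative
      (\<lambda>h. D (V x) (W x) h + \<Phi> x (V' h) (W x) + \<Phi> x (V x) (W' h))) (at x)"
proof (rule has_derivative_linear_apply[where \<Phi> = "\<lambda>y w. \<Phi> y (V y) w"
      and D = "\<lambda>w h. D (V x) w h + \<Phi> x (V' h) w"])
  show "((\<lambda>y. \<Phi> y (V y) w) has_derivative (\<lambda>h. D (V x) w h + \<Phi> x (V' h) w)) (at x)" for w
    by (rule has_derivative_linear_apply[where \<Phi> = "\<lambda>y u. \<Phi> y u w" and D = "\<lambda>u. D u w"])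
      (use assms in \<open>auto simp: bilinear_linear\<close>)
qed (use assms in \<open>auto simp: bilinear_linear\<close>)

section \<open>Symmetry of second derivatives\<close>

lemma second_difference_estimate:
  fixes f :: "'a::real_normed_vector \<Rightarrow> 'b::real_normed_vector"
  assumes "open S" "x \<in> S" and f: "\<And>y. y \<in> S \<Longrightarrow> (f has_derivative f' y) (at y)"
    and D: "((\<lambda>y. f' y u) has_derivative D) (at x)" and "e > 0"
  shows "\<exists>d>0. \<forall>t. 0 < t \<and> t < d \<longrightarrow>
    norm (f (x + t *\<^sub>R u + t *\<^sub>R w) - f (x + t *\<^sub>R u) - f (x + t *\<^sub>R w) + f x - (t * t) *\<^sub>R D w) \<le> e * (t * t)"
proof -
  \<comment> \<open>The derivative of the auxiliary function below compares two points, hence the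
    factor 2; the summand 1 keeps \<open>K\<close> positive when \<open>u\<close> and
    \<open>w\<close> vanish.\<close>
  define K where "K = 2 * (norm u + norm w) + 1"
  have K: "K > 0" by (simp add: K_def add_nonneg_pos)
  obtain r where r: "r > 0" "ball x r \<subseteq> S" using assms(1,2) openE by blast
  have "e / K > 0" using K \<open>e > 0\<close> by simp
  then obtain d0 where d0: "d0 > 0"
    "\<And>y. norm (y - x) < d0 \<Longrightarrow> norm (f' y u - f' x u - D (y - x)) \<le> e / K * norm (y - x)"
    using D unfolding has_derivative_at_alt by blast
  have lin: "linear D" using D has_derivative_linear by blast
  define d where "d = min r d0 / K"
  have d: "d > 0" using r d0 K by (simp add: d_def)
  have "norm (f (x + t *\<^sub>R u + t *\<^sub>R w) - f (x + t *\<^sub>R u) - f (x + t *\<^sub>R w) + f x - (t * t) *\<^sub>R D w) \<le> e * (t * t)"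
    if t: "0 < t" "t < d" for t
  proof -
    have tK: "t * K < r" "t * K < d0"
      using t K by (auto simp: d_def pos_less_divide_eq)
    have near: "norm (s *\<^sub>R u + a *\<^sub>R w) \<le> t * (norm u + norm w)" if "0 \<le> s" "s \<le> t" "0 \<le> a" "a \<le> t" for s a
    proof -
      have "norm (s *\<^sub>R u + a *\<^sub>R w) \<le> s * norm u + a * norm w"
        using norm_triangle_ineq[of "s *\<^sub>R u" "a *\<^sub>R w"] that by simp
      also have "\<dots> \<le> t * norm u + t * norm w"
        using that by (intro add_mono mult_right_mono) auto
      finally show ?thesis by (simp add: distrib_left)
    qed
    have tk: "t * (norm u + norm w) < t * K"
      using t by (intro mult_strict_left_mono) (auto simp: K_def add_nonneg_pos intro: add_nonneg_pos)
    have nearr: "norm (s *\<^sub>R u + a *\<^sub>R w) < r" "norm (s *\<^sub>R u + a *\<^sub>R w) < d0"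
       if "0 \<le> s" "s \<le> t" "0 \<le> a" "a \<le> t" for s a
      using near[OF that] tK tk by linarith+
    let ?p = "\<lambda>s a. x + (s *\<^sub>R u + a *\<^sub>R w)"
    have inS: "?p s a \<in> S" if "0 \<le> s" "s \<le> t" "0 \<le> a" "a \<le> t" for s a
    proof -
      have "?p s a \<in> ball x r"
        using nearr(1)[OF that] dist_norm[of "?p s a" x] by (simp add: dist_commute)
      then show ?thesis using r(2) by blast
    qed
    \<comment> \<open>The second difference is the increment over \<open>[0, t]\<close> of a
      difference of \<open>f\<close> on two parallel segments. Subtracting the linear term reduces
      the claim to a mean value estimate, in which only the differentiability of
      \<open>f' y u\<close> at the single point \<open>x\<close> enters.\<close>
    define \<phi> where "\<phi> s = f (?p s t) - f (?p s 0) - s *\<^sub>R t *\<^sub>R D w" for s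
    have der: "(\<phi> has_derivative (\<lambda>h. h *\<^sub>R (f' (?p s t) u
        - f' (?p s 0) u - t *\<^sub>R D w))) (at s within {0..t})" if "s \<in> {0..t}" for s
    proof -
      have g: "((\<lambda>s. f (?p s a)) has_derivative
         (\<lambda>h. h *\<^sub>R f' (?p s a) u)) (at s within {0..t})" if "0 \<le> a" "a \<le> t" for a
      proof -
        have i: "?p s a \<in> S" using inS \<open>s \<in> {0..t}\<close> that by auto
        have "((\<lambda>s. ?p s a) has_derivative (\<lambda>h. h *\<^sub>R u)) (at s within {0..t})"
          by (auto intro!: derivative_eq_intros)
        then have "((\<lambda>s. f (?p s a)) has_derivative
         (\<lambda>h. f' (?p s a) (h *\<^sub>R u))) (at s within {0..t})"
          by (rule has_derivative_compose) (rule f[OF i])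
        then show ?thesis
          using linear_cmul[OF has_derivative_linear[OF f[OF i]]] by simp
      qed
      show ?thesis
        unfolding \<phi>_def using t
        by (auto intro!: derivative_eq_intros g simp: algebra_simps simp del: scaleR_zero_left)
    qed
    have bnd: "onorm (\<lambda>h. h *\<^sub>R (f' (?p s t) u
        - f' (?p s 0) u - t *\<^sub>R D w)) \<le> e * t" if "s \<in> {0..t}" for s
    proof (rule onorm_le)
      have A: "norm (f' (?p s a) u - f' x u - D (s *\<^sub>R u + a *\<^sub>R w)) \<le> e / K * (t * (norm u + norm w))"
        if "0 \<le> a" "a \<le> t" for a
      proof -
        have "norm (f' (?p s a) u - f' x u - D (s *\<^sub>R u + a *\<^sub>R w)) \<le> e / K * norm (s *\<^sub>R u + a *\<^sub>R w)"
          using d0(2)[of "?p s a"] nearr(2)[of s a] that \<open>s \<in> {0..t}\<close> by simp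
        also have "\<dots> \<le> e / K * (t * (norm u + norm w))"
          using near[of s a] that \<open>s \<in> {0..t}\<close> \<open>e / K > 0\<close> by (intro mult_left_mono) auto
        finally show ?thesis .
      qed
      have eq: "f' (?p s t) u - f' (?p s 0) u - t *\<^sub>R D w =
        (f' (?p s t) u - f' x u - D (s *\<^sub>R u + t *\<^sub>R w))
        - (f' (?p s 0) u - f' x u - D (s *\<^sub>R u + 0 *\<^sub>R w))"
        using lin by (simp add: linear_add linear_cmul)
      have "norm (f' (?p s t) u - f' (?p s 0) u - t *\<^sub>R D w)
        \<le> 2 * (e / K * (t * (norm u + norm w)))"
        unfolding eq mult_2
        by (rule order_trans[OF norm_triangle_ineq4 add_mono[OF A A]]) (use t in auto)
      also have "\<dots> = (e / K * t) * (2 * (norm u + norm w))" by (simp add: algebra_simps)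
      also have "\<dots> \<le> (e / K * t) * K"
        using \<open>e > 0\<close> t K by (intro mult_left_mono divide_nonneg_nonneg mult_nonneg_nonneg) (simp_all add: K_def)
      also have "\<dots> = e * t" using K by simp
      finally have main: "norm (f' (?p s t) u - f' (?p s 0) u - t *\<^sub>R D w) \<le> e * t" .
      show "norm (h *\<^sub>R (f' (?p s t) u
        - f' (?p s 0) u - t *\<^sub>R D w)) \<le> e * t * norm h" for h :: real
        using mult_left_mono[OF main, of "\<bar>h\<bar>"] by (simp add: mult.commute)
    qed
    have "norm (\<phi> t - \<phi> 0) \<le> e * t * norm (t - 0)"
      by (rule differentiable_bound[of "{0..t}", OF _ der bnd]) (use t in auto)
    then show ?thesis
      using t by (simp add: \<phi>_def algebra_simps)
  qed
  then show ?thesis using d by blast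
qed

text \<open>The second difference quotient of \<open>f\<close> is symmetric in \<open>u\<close> and
  \<open>w\<close>, and it tends to \<open>D w\<close> by one application of the estimate and to
  \<open>D' u\<close> by the other.\<close>

lemma symmetric_second_derivative:
  fixes f :: "'a::real_normed_vector \<Rightarrow> 'b::real_normed_vector"
  assumes "open S" "x \<in> S" and f: "\<And>y. y \<in> S \<Longrightarrow> (f has_derivative f' y) (at y)"
    and D: "((\<lambda>y. f' y u) has_derivative D) (at x)"
    and D': "((\<lambda>y. f' y w) has_derivative D') (at x)"
  shows "D w = D' u"
proof (rule ccontr)
  assume "D w \<noteq> D' u"
  define e where "e = norm (D w - D' u) / 3"
  have e: "e > 0" using \<open>D w \<noteq> D' u\<close> by (simp add: e_def)
  define \<Delta> where "\<Delta> t = f (x + t *\<^sub>R u + t *\<^sub>R w) - f (x + t *\<^sub>R u) - f (x + t *\<^sub>R w) + f x" for t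
  obtain d where d: "d > 0" "\<And>t. 0 < t \<Longrightarrow> t < d \<Longrightarrow> norm (\<Delta> t - (t * t) *\<^sub>R D w) \<le> e * (t * t)"
    using second_difference_estimate[OF assms(1,2) f D e, where w = w] unfolding \<Delta>_def by blast
  obtain d' where d': "d' > 0" "\<And>t. 0 < t \<Longrightarrow> t < d' \<Longrightarrow> norm (\<Delta> t - (t * t) *\<^sub>R D' u) \<le> e * (t * t)"
    using second_difference_estimate[OF assms(1,2) f D' e, where w = u] unfolding \<Delta>_def
    by (auto simp: algebra_simps)
  define t where "t = min d d' / 2"
  have t: "0 < t" "t < d" "t < d'" using d d' by (auto simp: t_def min_def)
  have "(t * t) * norm (D w - D' u) = norm ((\<Delta> t - (t * t) *\<^sub>R D' u) - (\<Delta> t - (t * t) *\<^sub>R D w))"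
  proof -
    have "(\<Delta> t - (t * t) *\<^sub>R D' u) - (\<Delta> t - (t * t) *\<^sub>R D w) = (t * t) *\<^sub>R (D w - D' u)"
      by (simp add: scaleR_diff_right)
    then show ?thesis by simp
  qed
  also have "\<dots> \<le> e * (t * t) + e * (t * t)"
    by (rule order_trans[OF norm_triangle_ineq4 add_mono[OF d'(2)[OF t(1,3)] d(2)[OF t(1,2)]]])
  also have "\<dots> = (t * t) * (2 * e)" by simp
  finally have "norm (D w - D' u) \<le> 2 * e" using t by (simp add: mult_le_cancel_left_pos)
  then show False using e by (simp add: e_def)
qed

lemma smooth_on_symmetric_second_derivative:
  assumes "open S" "x \<in> S" "smooth_on S f"
  shows "FD (\<lambda>y. FD f y u) x w =
         FD (\<lambda>y. FD f y w) x u"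
  using symmetric_second_derivative[OF assms(1,2) smooth_on_has_derivative[OF assms(3)]]
    smooth_on_has_derivative[OF smooth_on_frechet_derivative[OF assms(3)] assms(2)] by blast

section \<open>Parallel sections of flat connections\<close>

lemma norm_le_of_half_derivative:
  fixes h :: "real \<Rightarrow> 'b::real_normed_vector"
  assumes h: "\<And>t. t \<in> {0..1} \<Longrightarrow> (h has_vector_derivative h' t) (at t within {0..1})"
    and b: "\<And>t. t \<in> {0..1} \<Longrightarrow> norm (h' t) \<le> norm (h t) / 2 + e"
    and t: "t \<in> {0..1}"
  shows "norm (h t) \<le> 2 * (norm (h 0) + e)"
proof -
  have "continuous_on {0..1} (\<lambda>t. norm (h t))"
    using h by (intro continuous_on_norm) (meson continuous_on_eq_continuous_within has_vector_derivative_continuous)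
  \<comment> \<open>At the point where \<open>norm (h t)\<close> is largest, the mean value
    inequality bounds the maximum by \<open>norm (h 0)\<close>, \<open>e\<close> and half the
    maximum itself, which can be absorbed into the left-hand side.\<close>
  then obtain s where s: "s \<in> {0..1}" "\<And>t. t \<in> {0..1} \<Longrightarrow> norm (h t) \<le> norm (h s)"
    using continuous_attains_sup[of "{0..1::real}" "\<lambda>t. norm (h t)"] by auto
  have c: "norm (h' t) \<le> norm (h s) / 2 + e" if "t \<in> {0..1}" for t
    using b[OF that] s(2)[OF that] by linarith
  have "norm (h s - h 0) \<le> (norm (h s) / 2 + e) * norm (s - 0)"
  proof (rule differentiable_bound[of "{0..1}"])
    show "(h has_derivative (\<lambda>x. x *\<^sub>R h' t)) (at t within {0..1})" if "t \<in> {0..1}" for t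
      using h[OF that] by (simp add: has_vector_derivative_def)
    show "onorm (\<lambda>x. x *\<^sub>R h' t) \<le> norm (h s) / 2 + e" if "t \<in> {0..1}" for t
      by (rule onorm_le) (use c[OF that] in \<open>simp add: mult.commute mult_left_mono\<close>)
  qed (use s in auto)
  also have "\<dots> \<le> (norm (h s) / 2 + e) * 1"
    using c[of 0] norm_ge_zero[of "h' 0"] s(1) by (intro mult_left_mono) (auto simp del: norm_ge_zero)
  finally have "norm (h s) - norm (h 0) \<le> norm (h s) / 2 + e"
    using norm_triangle_ineq2[of "h s" "h 0"] unfolding mult_1_right by linarith
  then show ?thesis using s(2)[OF t] by (simp add: algebra_simps)
qed

text \<open>Picard iteration: on the unit interval, coefficients of norm at most 1/2 make the
  integral operator a contraction with factor 1/2, so a single application of the fixed point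
  theorem covers the whole interval.\<close>

lemma linear_ode_solution:
  fixes a :: "real \<Rightarrow> 'f::euclidean_space \<Rightarrow> 'f"
  assumes lin: "\<And>t. t \<in> {0..1} \<Longrightarrow> linear (a t)"
    and cont: "\<And>f. continuous_on {0..1} (\<lambda>t. a t f)"
    and bnd: "\<And>t f. t \<in> {0..1} \<Longrightarrow> norm (a t f) \<le> norm f / 2"
  shows "\<exists>\<phi>. \<phi> 0 = f0 \<and> (\<forall>t\<in>{0..1}. (\<phi> has_vector_derivative a t (\<phi> t)) (at t within {0..1}))"
proof -
  have cont_app: "continuous_on {0..1} (\<lambda>t. a t (u t))" if "continuous_on {0..1} u" for u
  proof -
    have "continuous_on {0..1} (\<lambda>t. \<Sum>b\<in>Basis. (u t \<bullet> b) *\<^sub>R a t b)"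
      by (intro continuous_intros that cont)
    then show ?thesis by (rule continuous_on_eq) (use linear_expand_Basis[OF lin] in metis)
  qed
  \<comment> \<open>\<open>c\<close> retracts the line onto the unit interval. Precomposing with it
    turns the integral operator into a self-map of the complete space of bounded continuous
    functions on the whole line.\<close>
  define c :: "real \<Rightarrow> real" where "c t = max 0 (min 1 t)" for t
  have c: "c t \<in> {0..1}" "continuous_on UNIV c" "t \<in> {0..1} \<Longrightarrow> c t = t" for t
    by (auto simp: c_def intro!: continuous_intros)
  define I where "I u t = f0 + integral {0..t} (\<lambda>s. a s (u s))" for u t
  have I_cont: "continuous_on {0..1} (I u)" if "continuous_on {0..1} u" for u
    unfolding I_def
    by (intro continuous_intros indefinite_integral_continuous_1 integrable_continuous_real cont_app that)
  have cu: "continuous_on {0..1} (apply_bcontfun u)" for u :: "real \<Rightarrow>\<^sub>C 'f"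
    by simp
  define T where "T u = Bcontfun (\<lambda>t. I (apply_bcontfun u) (c t))" for u
  have T: "apply_bcontfun (T u) t = I (apply_bcontfun u) (c t)" for u t
  proof -
    have "compact (I (apply_bcontfun u) ` {0..1})"
      by (intro compact_continuous_image I_cont cu) auto
    then obtain b where b: "\<And>x. x \<in> I (apply_bcontfun u) ` {0..1} \<Longrightarrow> norm x \<le> b"
      using compact_imp_bounded bounded_iff by metis
    have "(\<lambda>t. I (apply_bcontfun u) (c t)) \<in> bcontfun"
    proof (rule bcontfun_normI)
      show "continuous_on UNIV (\<lambda>t. I (apply_bcontfun u) (c t))"
        by (rule continuous_on_compose2[OF I_cont[OF cu] c(2)]) (use c(1) in blast)
      show "norm (I (apply_bcontfun u) (c t)) \<le> b" for t
        using b c(1) by blast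
    qed
    then show ?thesis unfolding T_def by (simp add: Bcontfun_inverse)
  qed
  have "dist (T u) (T v) \<le> (1/2) * dist u v" for u v
  proof (rule dist_bound)
    fix t
    have int: "(\<lambda>s. a s (apply_bcontfun w s)) integrable_on {0..c t}" for w
      by (rule integrable_continuous_real, rule continuous_on_subset[OF cont_app[OF cu]]) (use c(1)[of t] in auto)
    have "I (apply_bcontfun u) (c t) - I (apply_bcontfun v) (c t)
        = integral {0..c t} (\<lambda>s. a s (apply_bcontfun u s) - a s (apply_bcontfun v s))"
      by (simp add: I_def integral_diff[OF int int])
    also have "norm \<dots> \<le> ((1/2) * dist u v) * (c t - 0)"
    proof (rule integral_bound)
      show "continuous_on {0..c t} (\<lambda>s. a s (apply_bcontfun u s) - a s (apply_bcontfun v s))"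
        by (rule continuous_on_subset[of "{0..1}"])
          (use c(1)[of t] in \<open>auto intro!: continuous_on_diff cont_app cu\<close>)
      show "norm (a s (apply_bcontfun u s) - a s (apply_bcontfun v s)) \<le> (1/2) * dist u v"
        if "s \<in> {0..c t}" for s
      proof -
        have s: "s \<in> {0..1}" using that c(1)[of t] by auto
        have "norm (a s (apply_bcontfun u s) - a s (apply_bcontfun v s))
          \<le> norm (apply_bcontfun u s - apply_bcontfun v s) / 2"
          using bnd[OF s] linear_diff[OF lin[OF s]] by metis
        also have "\<dots> \<le> (1/2) * dist u v"
          using dist_bounded[of u s v] by (simp add: dist_norm)
        finally show ?thesis .
      qed
    qed (use c(1)[of t] in auto)
    also have "\<dots> \<le> ((1/2) * dist u v) * 1"
      using c(1)[of t] by (intro mult_left_mono) auto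
    finally show "dist (apply_bcontfun (T u) t) (apply_bcontfun (T v) t) \<le> (1/2) * dist u v"
      by (simp add: T dist_norm)
  qed
  then obtain u where u: "T u = u"
    using banach_fix_type[of "1/2" T] by auto
  have eq: "apply_bcontfun u t = f0 + integral {0..t} (\<lambda>s. a s (apply_bcontfun u s))" if "t \<in> {0..1}" for t
    using T[of u t] c(3)[OF that] by (simp add: u I_def)
  have "(apply_bcontfun u has_vector_derivative a t (apply_bcontfun u t)) (at t within {0..1})"
    if t: "t \<in> {0..1}" for t
  proof -
    have "((\<lambda>t. f0 + integral {0..t} (\<lambda>s. a s (apply_bcontfun u s))) has_vector_derivative
        0 + a t (apply_bcontfun u t)) (at t within {0..1})"
      by (intro has_vector_derivative_add has_vector_derivative_const
          integral_has_vector_derivative cont_app cu t)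
    then show ?thesis
      using has_vector_derivative_transform[OF t eq] by simp
  qed
  moreover have "apply_bcontfun u 0 = f0" using eq[of 0] by simp
  ultimately show ?thesis by blast
qed

section \<open>Bounds that are uniform on compact sets\<close>

lemma linear_norm_le_sum_Basis:
  assumes "linear L"
  shows "norm (L h) \<le> (\<Sum>b\<in>Basis. norm (L (b::'a::euclidean_space))) * norm h"
proof -
  have "norm (L h) \<le> (\<Sum>b\<in>Basis. norm ((h \<bullet> b) *\<^sub>R L b))"
    by (subst linear_expand_Basis[OF assms]) (rule norm_sum)
  also have "\<dots> \<le> (\<Sum>b\<in>Basis. norm (L b) * norm h)"
    by (intro sum_mono) (simp add: Basis_le_norm mult.commute[of _ "norm h"] mult_right_mono)
  finally show ?thesis by (simp add: sum_distrib_right)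
qed

lemma smooth_on_bounded:
  assumes "smooth_on S f" "compact K" "K \<subseteq> S"
  shows "\<exists>C\<ge>0. \<forall>p\<in>K. norm (f p) \<le> C"
proof -
  have "bounded (f ` K)"
    using smooth_on_continuous[OF assms(1)] assms(2,3)
    by (meson compact_continuous_image compact_imp_bounded continuous_on_subset)
  then obtain b where "b > 0" "\<forall>p\<in>K. norm (f p) \<le> b" unfolding bounded_pos by auto
  then show ?thesis by (intro exI[of _ b]) auto
qed

lemma smooth_on_derivative_bounded:
  fixes f :: "'a::euclidean_space \<Rightarrow> 'b::real_normed_vector"
  assumes "smooth_on S f" "compact K" "K \<subseteq> S"
  shows "\<exists>C\<ge>0. \<forall>p\<in>K. \<forall>h. norm (FD f p h) \<le> C * norm h"
proof -
  obtain C where C: "\<And>b. C b \<ge> 0" "\<And>p b. p \<in> K \<Longrightarrow> norm (FD f p b) \<le> C b"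
    using smooth_on_bounded[OF smooth_on_frechet_derivative[OF assms(1)] assms(2,3)] by metis
  have "norm (FD f p h) \<le> (\<Sum>b\<in>Basis. C b) * norm h" if p: "p \<in> K" for p h
  proof -
    have "linear (FD f p)"
      using smooth_on_has_derivative[OF assms(1)] p assms(3) has_derivative_linear by blast
    from linear_norm_le_sum_Basis[OF this, of h] show ?thesis
      by (rule order_trans) (intro mult_right_mono sum_mono norm_ge_zero C(2)[OF p])
  qed
  moreover have "(\<Sum>b\<in>Basis. C b) \<ge> 0" using C(1) by (simp add: sum_nonneg)
  ultimately show ?thesis by blast
qed

lemma smooth_on_lipschitz:
  fixes f :: "'a::euclidean_space \<Rightarrow> 'b::real_normed_vector"
  assumes "smooth_on S f" "compact K" "convex K" "K \<subseteq> S"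
  shows "\<exists>C\<ge>0. \<forall>p\<in>K. \<forall>q\<in>K. norm (f q - f p) \<le> C * norm (q - p)"
proof -
  obtain C where C: "C \<ge> 0" "\<And>p h. p \<in> K \<Longrightarrow> norm (FD f p h) \<le> C * norm h"
    using smooth_on_derivative_bounded[OF assms(1,2,4)] by blast
  have "norm (f q - f p) \<le> C * norm (q - p)" if "p \<in> K" "q \<in> K" for p q
  proof (rule differentiable_bound[OF assms(3)])
    show "(f has_derivative FD f x) (at x within K)" if "x \<in> K" for x
      using smooth_on_has_derivative[OF assms(1)] that assms(4) has_derivative_at_withinI by blast
    show "onorm (FD f x) \<le> C" if "x \<in> K" for x by (rule onorm_le) (rule C(2)[OF that])
  qed (use that in auto)
  then show ?thesis using C(1) by blast
qed

text \<open>The mean value inequality is applied on the segment from \<open>p\<close> to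
  \<open>q\<close> to \<open>f\<close> minus its linearization at \<open>p\<close>. The derivative
  of this difference is small because the derivative of \<open>f\<close> is Lipschitz on
  \<open>K\<close>.\<close>

lemma smooth_on_taylor:
  fixes f :: "'a::euclidean_space \<Rightarrow> 'b::real_normed_vector"
  assumes "smooth_on S f" "compact K" "convex K" "K \<subseteq> S"
  shows "\<exists>C\<ge>0. \<forall>p\<in>K. \<forall>q\<in>K. norm (f q - f p - FD f p (q - p)) \<le> C * (norm (q - p))\<^sup>2"
proof -
  let ?D = "\<lambda>p. FD f p"
  have "\<exists>C\<ge>0. \<forall>p\<in>K. \<forall>q\<in>K. norm (?D q b - ?D p b) \<le> C * norm (q - p)" for b
    by (rule smooth_on_lipschitz[OF smooth_on_frechet_derivative[OF assms(1)] assms(2-4)])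
  then obtain C where C: "\<And>b. C b \<ge> 0"
      "\<And>p q b. p \<in> K \<Longrightarrow> q \<in> K \<Longrightarrow> norm (?D q b - ?D p b) \<le> C b * norm (q - p)" by metis
  define C' where "C' = (\<Sum>b\<in>Basis. C b)"
  have C': "C' \<ge> 0" using C(1) by (simp add: C'_def sum_nonneg)
  have d: "(f has_derivative ?D x) (at x)" if "x \<in> K" for x
    using smooth_on_has_derivative[OF assms(1)] that assms(4) by blast
  have "norm (f q - f p - ?D p (q - p)) \<le> C' * (norm (q - p))\<^sup>2" if pq: "p \<in> K" "q \<in> K" for p q
  proof -
    have seg: "closed_segment p q \<subseteq> K" using assms(3) pq by (simp add: closed_segment_subset)
    have lp: "bounded_linear (?D p)" using d[OF pq(1)] has_derivative_bounded_linear by blast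
    have "norm ((f q - ?D p q) - (f p - ?D p p)) \<le> (C' * norm (q - p)) * norm (q - p)"
    proof (rule differentiable_bound[OF convex_closed_segment[of p q]])
      fix x assume x: "x \<in> closed_segment p q"
      then have xK: "x \<in> K" using seg by blast
      show "((\<lambda>x. f x - ?D p x) has_derivative (\<lambda>h. ?D x h - ?D p h)) (at x within closed_segment p q)"
        by (intro has_derivative_diff has_derivative_at_withinI[OF d[OF xK]]
            bounded_linear_imp_has_derivative[OF lp])
      show "onorm (\<lambda>h. ?D x h - ?D p h) \<le> C' * norm (q - p)"
      proof (rule onorm_le)
        fix h
        have "linear (\<lambda>h. ?D x h - ?D p h)"
          using d[OF xK] d[OF pq(1)] by (intro linear_compose_sub) (auto intro: has_derivative_linear)
        then have "norm (?D x h - ?D p h) \<le> (\<Sum>b\<in>Basis. norm (?D x b - ?D p b)) * norm h"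
          by (rule linear_norm_le_sum_Basis)
        also have "\<dots> \<le> (\<Sum>b\<in>Basis. C b * norm (q - p)) * norm h"
        proof (intro mult_right_mono sum_mono)
          show "norm (?D x b - ?D p b) \<le> C b * norm (q - p)" for b
            using C(2)[OF pq(1) xK, of b] C(1)[of b] segment_bound1[OF x]
            by (meson mult_left_mono order_trans)
        qed auto
        finally show "norm (?D x h - ?D p h) \<le> C' * norm (q - p) * norm h"
          by (simp add: C'_def sum_distrib_right)
      qed
    qed auto
    moreover have "(f q - ?D p q) - (f p - ?D p p) = f q - f p - ?D p (q - p)"
      using linear_diff[OF bounded_linear.linear[OF lp], of q p] by simp
    ultimately show ?thesis by (simp add: power2_eq_square mult.assoc)
  qed
  then show ?thesis using C' by blast
qed

text \<open>Turns bounds for each fixed pair of arguments into one operator bound: finitely many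
  basis pairs control a bilinear map. The weight \<open>w\<close> carries the dependence on the
  index, in the applications a power of the distance between two points.\<close>

lemma bilinear_uniform_bound:
  fixes T :: "'i \<Rightarrow> 'a::euclidean_space \<Rightarrow> 'b::euclidean_space \<Rightarrow> 'c::real_normed_vector"
  assumes bil: "\<And>i. i \<in> I \<Longrightarrow> bilinear (T i)" and w: "\<And>i. i \<in> I \<Longrightarrow> w i \<ge> 0"
    and ex: "\<And>u f. \<exists>C\<ge>0. \<forall>i\<in>I. norm (T i u f) \<le> C * w i"
  shows "\<exists>C\<ge>0. \<forall>i\<in>I. \<forall>u f. norm (T i u f) \<le> C * w i * norm u * norm f"
proof -
  obtain C where C: "\<And>u f. C u f \<ge> 0" "\<And>u f i. i \<in> I \<Longrightarrow> norm (T i u f) \<le> C u f * w i"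
    using ex by metis
  define C' where "C' = (\<Sum>b\<in>Basis. \<Sum>b'\<in>Basis. C b b')"
  have C': "C' \<ge> 0" using C(1) by (auto simp: C'_def intro!: sum_nonneg)
  have "norm (T i u f) \<le> C' * w i * norm u * norm f" if i: "i \<in> I" for i u f
  proof -
    have "norm (T i u f) \<le> (\<Sum>b\<in>Basis. norm (T i b f)) * norm u"
      by (rule linear_norm_le_sum_Basis[of "\<lambda>u. T i u f"]) (use bil[OF i] bilinear_linear in auto)
    also have "\<dots> \<le> (\<Sum>b\<in>Basis. (\<Sum>b'\<in>Basis. C b b' * w i) * norm f) * norm u"
    proof (intro mult_right_mono sum_mono)
      fix b :: 'a
      have "norm (T i b f) \<le> (\<Sum>b'\<in>Basis. norm (T i b b')) * norm f"
        by (rule linear_norm_le_sum_Basis[of "T i b"]) (use bil[OF i] bilinear_linear in auto)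
      also have "\<dots> \<le> (\<Sum>b'\<in>Basis. C b b' * w i) * norm f"
        by (intro mult_right_mono sum_mono C(2) i) auto
      finally show "norm (T i b f) \<le> (\<Sum>b'\<in>Basis. C b b' * w i) * norm f" .
    qed auto
    also have "\<dots> = C' * w i * norm u * norm f"
      by (simp add: C'_def sum_distrib_right sum_distrib_left ac_simps)
    finally show ?thesis .
  qed
  then show ?thesis using C' by blast
qed

lemma linear_frechet_derivative:
  fixes T :: "'a::euclidean_space \<Rightarrow> 'b::real_vector \<Rightarrow> 'c::real_normed_vector"
  assumes "open S" "x \<in> S" "\<And>x. x \<in> S \<Longrightarrow> linear (T x)" "\<And>u. smooth_on S (\<lambda>x. T x u)"
  shows "linear (\<lambda>u. FD (\<lambda>y. T y u) x h)"
proof (rule linearI)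
  note d = smooth_on_has_derivative[OF assms(4,2)]
  have eq: "FD (\<lambda>y. T y u) x = D"
    if "(k has_derivative D) (at x)" "\<And>y. y \<in> S \<Longrightarrow> k y = T y u" for u k D
    using has_derivative_transform_within_open[OF that(1) assms(1,2) that(2)] by (metis frechet_derivative_at)
  show "FD (\<lambda>y. T y (u + v)) x h =
      FD (\<lambda>y. T y u) x h + FD (\<lambda>y. T y v) x h" for u v
    by (subst eq[OF has_derivative_add[OF d d]]) (simp_all add: linear_add[OF assms(3)])
  show "FD (\<lambda>y. T y (c *\<^sub>R u)) x h = c *\<^sub>R FD (\<lambda>y. T y u) x h" for c u
    by (subst eq[OF has_derivative_scaleR_right[OF d]]) (simp_all add: linear_cmul[OF assms(3)])
qed

lemma bilinear_frechet_derivative: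
  fixes B :: "'a::euclidean_space \<Rightarrow> 'b::euclidean_space \<Rightarrow> 'd::euclidean_space \<Rightarrow> 'c::real_normed_vector"
  assumes "open S" "x \<in> S" "\<And>x. x \<in> S \<Longrightarrow> bilinear (B x)" "\<And>u w. smooth_on S (\<lambda>x. B x u w)"
  shows "bilinear (\<lambda>u w. FD (\<lambda>y. B y u w) x h)"
  unfolding bilinear_def
proof (intro conjI allI)
  show "linear (\<lambda>w. FD (\<lambda>y. B y u w) x h)" for u
    by (rule linear_frechet_derivative[OF assms(1,2) bilinear_linear(1)[OF assms(3)] assms(4)])
  show "linear (\<lambda>u. FD (\<lambda>y. B y u w) x h)" for w
    by (rule linear_frechet_derivative[where T = "\<lambda>y u. B y u w", OF assms(1,2) bilinear_linear(2)[OF assms(3)] assms(4)])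
qed

text \<open>
  Along rays from \<open>x0\<close> a section is parallel iff it solves a linear ODE. Flatness makes the
  deviation \<open>h\<close> of two such solutions from the expected first order term satisfy
  \<open>norm (h') \<le> norm h / 2 + O(norm (y - x)\<^sup>2)\<close>, so the ray-wise solutions fit together to a
  differentiable parallel section, and no dependence of solutions on parameters has to be studied.
\<close>

lemma flat_connection_parallel_section:
  fixes B :: "'e::euclidean_space \<Rightarrow> 'e \<Rightarrow> 'f::euclidean_space \<Rightarrow> 'f"
  assumes S: "open S" "x0 \<in> S" and bil: "\<And>x. x \<in> S \<Longrightarrow> bilinear (B x)"
    and sm: "\<And>u f. smooth_on S (\<lambda>x. B x u f)"
    and flat: "\<And>x u w f. x \<in> S \<Longrightarrow>
      FD (\<lambda>y. B y w f) x u + B x w (B x u f) =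
      FD (\<lambda>y. B y u f) x w + B x u (B x w f)"
  shows "\<exists>r>0. ball x0 r \<subseteq> S \<and> (\<forall>F0. \<exists>F. F x0 = F0 \<and>
    (\<forall>x\<in>ball x0 r. (F has_derivative (\<lambda>u. B x u (F x))) (at x)))"
proof -
  define D where "D x u f = FD (\<lambda>y. B y u f) x" for x u f
  have hd: "((\<lambda>y. B y u f) has_derivative D x u f) (at x)" if "x \<in> S" for x u f
    unfolding D_def using smooth_on_has_derivative[OF sm that] .
  have bilD: "bilinear (\<lambda>u f. D x u f h)" if "x \<in> S" for x h
    unfolding D_def by (rule bilinear_frechet_derivative[OF S(1) that bil sm])
  have linD: "linear (D x u f)" if "x \<in> S" for x u f
    using hd[OF that] has_derivative_linear by blast
  obtain r0 where r0: "r0 > 0" "cball x0 r0 \<subseteq> S" using S open_contains_cball by blast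
  \<comment> \<open>A compact convex neighbourhood of \<open>x0\<close> in \<open>S\<close>:
    compactness gives the constants below, and convexity the mean value estimates.\<close>
  define K where "K = cball x0 r0"
  have K: "compact K" "convex K" "K \<subseteq> S" using r0 by (auto simp: K_def)
  have KS: "x \<in> K \<Longrightarrow> x \<in> S" for x using K by auto
  \<comment> \<open>The four constants bound \<open>B\<close> itself (\<open>C1\<close>), its
    first-order Taylor remainder (\<open>C2\<close>), its Lipschitz quotient (\<open>C3\<close>) and
    its derivative (\<open>C4\<close>), each uniformly on \<open>K\<close>.\<close>
  have "\<exists>C\<ge>0. \<forall>p\<in>K. \<forall>u f. norm (B p u f) \<le> C * 1 * norm u * norm f"
  proof (rule bilinear_uniform_bound)
    show "\<exists>C\<ge>0. \<forall>p\<in>K. norm (B p u f) \<le> C * 1" for u f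
      using smooth_on_bounded[OF sm[of u f] K(1,3)] by simp
  qed (use bil KS in auto)
  then obtain C1 where C1: "C1 \<ge> 0" "\<And>p u f. p \<in> K \<Longrightarrow> norm (B p u f) \<le> C1 * norm u * norm f" by auto
  have "\<exists>C\<ge>0. \<forall>i\<in>K\<times>K. \<forall>u f. norm (B (snd i) u f - B (fst i) u f - D (fst i) u f (snd i - fst i))
      \<le> C * (norm (snd i - fst i))\<^sup>2 * norm u * norm f"
  proof (rule bilinear_uniform_bound)
    show "bilinear (\<lambda>u f. B (snd i) u f - B (fst i) u f - D (fst i) u f (snd i - fst i))" if "i \<in> K \<times> K" for i
    proof -
      have "bilinear (B (snd i))" "bilinear (B (fst i))" "bilinear (\<lambda>u f. D (fst i) u f (snd i - fst i))"
        using that bil bilD KS by auto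
      then show ?thesis unfolding bilinear_def by (auto intro!: linear_compose_sub)
    qed
    show "\<exists>C\<ge>0. \<forall>i\<in>K\<times>K. norm (B (snd i) u f - B (fst i) u f - D (fst i) u f (snd i - fst i))
      \<le> C * (norm (snd i - fst i))\<^sup>2" for u f
      using smooth_on_taylor[OF sm[of u f] K] unfolding D_def by fastforce
  qed auto
  then obtain C2 where C2: "C2 \<ge> 0" "\<And>p q u f. p \<in> K \<Longrightarrow> q \<in> K \<Longrightarrow>
      norm (B q u f - B p u f - D p u f (q - p)) \<le> C2 * (norm (q - p))\<^sup>2 * norm u * norm f" by fastforce
  have "\<exists>C\<ge>0. \<forall>i\<in>K\<times>K. \<forall>u f. norm (B (snd i) u f - B (fst i) u f)
      \<le> C * norm (snd i - fst i) * norm u * norm f"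
  proof (rule bilinear_uniform_bound)
    show "bilinear (\<lambda>u f. B (snd i) u f - B (fst i) u f)" if "i \<in> K \<times> K" for i
    proof -
      have "bilinear (B (snd i))" "bilinear (B (fst i))"
        using that bil KS by auto
      then show ?thesis unfolding bilinear_def by (auto intro!: linear_compose_sub)
    qed
    show "\<exists>C\<ge>0. \<forall>i\<in>K\<times>K. norm (B (snd i) u f - B (fst i) u f) \<le> C * norm (snd i - fst i)" for u f
      using smooth_on_lipschitz[OF sm[of u f] K] by fastforce
  qed auto
  then obtain C3 where C3: "C3 \<ge> 0" "\<And>p q u f. p \<in> K \<Longrightarrow> q \<in> K \<Longrightarrow>
      norm (B q u f - B p u f) \<le> C3 * norm (q - p) * norm u * norm f" by fastforce
  have "\<exists>C\<ge>0. \<forall>i\<in>K\<times>UNIV. \<forall>u f. norm (D (fst i) u f (snd i)) \<le> C * norm (snd i) * norm u * norm f"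
  proof (rule bilinear_uniform_bound)
    show "bilinear (\<lambda>u f. D (fst i) u f (snd i))" if "i \<in> K \<times> UNIV" for i
      using that bilD KS by auto
    show "\<exists>C\<ge>0. \<forall>i\<in>K\<times>UNIV. norm (D (fst i) u f (snd i)) \<le> C * norm (snd i)" for u f
      using smooth_on_derivative_bounded[OF sm[of u f] K(1,3)] unfolding D_def by fastforce
  qed auto
  then obtain C4 where C4: "C4 \<ge> 0" "\<And>p h u f. p \<in> K \<Longrightarrow>
      norm (D p u f h) \<le> C4 * norm h * norm u * norm f" by fastforce
  \<comment> \<open>The bound \<open>r0\<close> keeps the rays inside \<open>K\<close>. With
    \<open>C1 * r \<le> 1 / 2\<close> the coefficients along the rays have norm at most 1/2, as the
    existence result and the Gronwall-type bound require. The bound 1 removes the factors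
    \<open>norm y\<close> from the estimates.\<close>
  define r where "r = min r0 (min 1 (1 / (2 * (C1 + 1))))"
  have r: "r > 0" "r \<le> r0" "r \<le> 1" "C1 * r \<le> 1 / 2"
  proof -
    show "r > 0" using r0 C1(1) by (simp add: r_def)
    show "r \<le> r0" "r \<le> 1" unfolding r_def by linarith+
    have "C1 * r \<le> C1 * (1 / (2 * (C1 + 1)))" using C1(1) by (intro mult_left_mono) (auto simp: r_def)
    also have "\<dots> \<le> 1 / 2" using C1(1) by (simp add: field_simps)
    finally show "C1 * r \<le> 1 / 2" .
  qed
  have inK: "x0 + t *\<^sub>R x \<in> K" if "norm x \<le> r" "t \<in> {0..1}" for x t
  proof -
    have "\<bar>t\<bar> * norm x \<le> 1 * r" using that by (intro mult_mono) auto
    then show ?thesis using r(2) by (simp add: K_def dist_norm)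
  qed
  have half: "norm (B (x0 + t *\<^sub>R x) y f) \<le> norm f / 2" if "norm x \<le> r" "norm y \<le> r" "t \<in> {0..1}" for x y t f
  proof -
    have "norm (B (x0 + t *\<^sub>R x) y f) \<le> C1 * norm y * norm f" by (rule C1(2)[OF inK[OF that(1,3)]])
    also have "\<dots> \<le> C1 * r * norm f" using that C1(1) by (intro mult_right_mono mult_left_mono) auto
    also have "\<dots> \<le> 1 / 2 * norm f" using r(4) by (intro mult_right_mono) auto
    finally show ?thesis by simp
  qed
  have sol: "\<exists>\<phi>. \<phi> 0 = F0 \<and> (\<forall>t\<in>{0..1}. (\<phi> has_vector_derivative B (x0 + t *\<^sub>R x) x (\<phi> t)) (at t within {0..1}))"
    if x: "norm x \<le> r" for x F0
  proof (rule linear_ode_solution)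
    show "linear (B (x0 + t *\<^sub>R x) x)" if "t \<in> {0..1}" for t
      using bil[OF KS[OF inK[OF x that]]] by (rule bilinear_linear)
    show "continuous_on {0..1} (\<lambda>t. B (x0 + t *\<^sub>R x) x f)" for f
      by (rule continuous_on_compose2[OF smooth_on_continuous[OF sm]])
        (use inK[OF x] KS in \<open>auto intro!: continuous_intros\<close>)
    show "norm (B (x0 + t *\<^sub>R x) x f) \<le> norm f / 2" if "t \<in> {0..1}" for t f
      by (rule half[OF x x that])
  qed
  have "\<exists>F. F x0 = F0 \<and> (\<forall>x\<in>ball x0 r. (F has_derivative (\<lambda>u. B x u (F x))) (at x))" for F0
  proof -
    have "\<forall>x\<in>cball 0 r. \<exists>\<phi>. \<phi> 0 = F0 \<and> (\<forall>t\<in>{0..1}.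
        (\<phi> has_vector_derivative B (x0 + t *\<^sub>R x) x (\<phi> t)) (at t within {0..1}))"
      using sol by simp
    from bchoice[OF this] obtain \<phi> where \<phi>_sol: "\<forall>x\<in>cball 0 r. \<phi> x 0 = F0 \<and> (\<forall>t\<in>{0..1}.
        (\<phi> x has_vector_derivative B (x0 + t *\<^sub>R x) x (\<phi> x t)) (at t within {0..1}))" ..
    have \<phi>0: "\<phi> x 0 = F0" if "norm x \<le> r" for x
      using \<phi>_sol that by simp
    have \<phi>: "(\<phi> x has_vector_derivative B (x0 + t *\<^sub>R x) x (\<phi> x t)) (at t within {0..1})"
      if "norm x \<le> r" "t \<in> {0..1}" for x t
      using \<phi>_sol that by simp
    define m where "m = 2 * norm F0"
    have m: "m \<ge> 0" by (simp add: m_def)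
    have \<phi>_bound: "norm (\<phi> x t) \<le> m" if "norm x \<le> r" "t \<in> {0..1}" for x t
      using norm_le_of_half_derivative[of "\<phi> x" "\<lambda>t. B (x0 + t *\<^sub>R x) x (\<phi> x t)" 0 t]
        \<phi>[OF that(1)] half[OF that(1) that(1)] that \<phi>0 by (simp add: m_def)
    \<comment> \<open>\<open>E / 2\<close> collects the coefficients of the quadratic error terms of
      \<open>h'\<close>; the factor 2 is the one in
      \<open>norm_le_of_half_derivative\<close>.\<close>
    define E where "E = 2 * (C2 * m + C4 * m + (C3 + C1) * (C1 * m))"
    have main: "norm (\<phi> y 1 - \<phi> x 1 - B (x0 + x) (y - x) (\<phi> x 1)) \<le> E * (norm (y - x))\<^sup>2"
      if x: "norm x \<le> r" and y: "norm y \<le> r" for x y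
    proof -
      define \<delta> where "\<delta> = y - x"
      define p where "p t = x0 + t *\<^sub>R x" for t
      define q where "q t = x0 + t *\<^sub>R y" for t
      \<comment> \<open>At time \<open>t\<close> the two rays are
        \<open>t *\<^sub>R \<delta>\<close> apart, so a parallel section with value
        \<open>\<phi> x t\<close> at \<open>p t\<close> would change by
        \<open>t *\<^sub>R B (p t) \<delta> (\<phi> x t)\<close> to first order. \<open>h\<close> is
        the deviation from this prediction.\<close>
      define h where "h t = \<phi> y t - \<phi> x t - t *\<^sub>R B (p t) \<delta> (\<phi> x t)" for t
      define h' where "h' t = B (q t) y (\<phi> y t) - B (p t) x (\<phi> x t)
        - (t *\<^sub>R (D (p t) \<delta> (\<phi> x t) x + B (p t) \<delta> (B (p t) x (\<phi> x t))) + B (p t) \<delta> (\<phi> x t))" for t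
      have pK: "p t \<in> K" and qK: "q t \<in> K" if "t \<in> {0..1}" for t
        using inK[OF x that] inK[OF y that] by (auto simp: p_def q_def)
      have h': "(h has_vector_derivative h' t) (at t within {0..1})" if t: "t \<in> {0..1}" for t
      proof -
        have pS: "p t \<in> S" by (rule KS[OF pK[OF t]])
        have dp: "(p has_derivative (\<lambda>s. s *\<^sub>R x)) (at t within {0..1})"
          unfolding p_def by (auto intro!: derivative_eq_intros)
        have d\<phi>: "(\<phi> x has_derivative (\<lambda>s. s *\<^sub>R B (p t) x (\<phi> x t))) (at t within {0..1})"
          using \<phi>[OF x t] by (simp add: has_vector_derivative_def p_def)
        have "((\<lambda>z. B (fst z) \<delta> (snd z)) has_derivative
            (\<lambda>z. D (p t) \<delta> (\<phi> x t) (fst z) + B (p t) \<delta> (snd z))) (at (p t, \<phi> x t))"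
          apply (rule has_derivative_eq_rhs)
           apply (rule has_derivative_linear_apply[where S = "S \<times> UNIV" and \<Phi> = "\<lambda>z. B (fst z) \<delta>" and V = snd
                and D = "\<lambda>f z. D (p t) \<delta> f (fst z)" and V' = snd])
          subgoal using S(1) by (simp add: open_Times)
          subgoal using pS by simp
          subgoal by (simp add: bilinear_linear bil mem_Times_iff)
          subgoal by (rule has_derivative_compose[OF bounded_linear_imp_has_derivative[OF bounded_linear_fst]])
              (simp add: hd[OF pS])
          subgoal by (auto intro!: derivative_eq_intros)
          subgoal by simp
          done
        then have g: "((\<lambda>z. B (fst z) \<delta> (snd z)) has_derivative
            (\<lambda>z. D (p t) \<delta> (\<phi> x t) (fst z) + B (p t) \<delta> (snd z))) (at ((\<lambda>s. (p s, \<phi> x s)) t))"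
          by simp
        have "((\<lambda>s. B (p s) \<delta> (\<phi> x s)) has_derivative
            (\<lambda>s. s *\<^sub>R (D (p t) \<delta> (\<phi> x t) x + B (p t) \<delta> (B (p t) x (\<phi> x t))))) (at t within {0..1})"
          using has_derivative_compose[OF has_derivative_Pair[OF dp d\<phi>] g]
          by (simp add: linear_cmul[OF linD[OF pS]] bilinear_rmul[OF bil[OF pS]] scaleR_add_right)
        then have "((\<lambda>s. B (p s) \<delta> (\<phi> x s)) has_vector_derivative
            (D (p t) \<delta> (\<phi> x t) x + B (p t) \<delta> (B (p t) x (\<phi> x t)))) (at t within {0..1})"
          by (simp add: has_vector_derivative_def)
        then have "((\<lambda>s. s *\<^sub>R B (p s) \<delta> (\<phi> x s)) has_vector_derivative
            t *\<^sub>R (D (p t) \<delta> (\<phi> x t) x + B (p t) \<delta> (B (p t) x (\<phi> x t))) + 1 *\<^sub>R B (p t) \<delta> (\<phi> x t))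
            (at t within {0..1})"
          by (rule has_vector_derivative_scaleR[OF DERIV_ident])
        then show ?thesis
          unfolding h_def h'_def q_def p_def
          using \<phi>[OF x t] \<phi>[OF y t] by (intro has_vector_derivative_diff) (auto simp: p_def)
      qed
      have bound: "norm (h' t) \<le> norm (h t) / 2 + E / 2 * (norm \<delta>)\<^sup>2" if t: "t \<in> {0..1}" for t
      proof -
        note pS = KS[OF pK[OF t]] and qS = KS[OF qK[OF t]]
        note bl = bilinear_ladd[OF bil[OF pS]] bilinear_radd[OF bil[OF pS]] bilinear_lsub[OF bil[OF pS]]
          bilinear_radd[OF bil[OF qS]] bilinear_rmul[OF bil[OF qS]]
        define f where "f = \<phi> x t"
        define k where "k = B (p t) \<delta> f"
        have fy: "\<phi> y t = h t + f + t *\<^sub>R k" by (simp add: h_def f_def k_def)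
        have yx: "y = x + \<delta>" by (simp add: \<delta>_def)
        have qp: "q t - p t = t *\<^sub>R \<delta>" by (simp add: q_def p_def \<delta>_def algebra_simps)
        \<comment> \<open>Here flatness enters: it exchanges the directions \<open>x\<close> and
          \<open>\<delta>\<close> in the second covariant derivative.\<close>
        have fl: "D (p t) \<delta> f x + B (p t) \<delta> (B (p t) x f) = D (p t) x f \<delta> + B (p t) x k"
          unfolding D_def k_def by (rule flat[OF pS])
        have Dadd: "D (p t) y f \<delta> = D (p t) x f \<delta> + D (p t) \<delta> f \<delta>"
          unfolding yx by (rule bilinear_ladd[OF bilD[OF pS]])
        have e1: "B (p t) y f = B (p t) x f + B (p t) \<delta> f" "B (p t) y k = B (p t) x k + B (p t) \<delta> k"
          unfolding yx by (rule bilinear_ladd[OF bil[OF pS]])+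
        have e2: "D (p t) y f (t *\<^sub>R \<delta>) = t *\<^sub>R D (p t) y f \<delta>" by (rule linear_cmul[OF linD[OF pS]])
        \<comment> \<open>After the exchange all terms of first order in \<open>\<delta>\<close>
          cancel. What remains is \<open>B (q t) y\<close> applied to \<open>h t\<close>, a Taylor
          remainder, and terms containing \<open>\<delta>\<close> twice, since \<open>k\<close> is
          itself of order \<open>\<delta>\<close>.\<close>
        have h'_eq: "h' t = B (q t) y (h t) + (B (q t) y f - B (p t) y f - D (p t) y f (q t - p t))
          + t *\<^sub>R D (p t) \<delta> f \<delta> + t *\<^sub>R ((B (q t) y k - B (p t) y k) + B (p t) \<delta> k)"
          unfolding h'_def f_def[symmetric] fy fl qp e2 Dadd e1 bl k_def[symmetric]
          by (simp add: algebra_simps)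
        have b1: "norm (B (q t) y (h t)) \<le> norm (h t) / 2"
          unfolding q_def by (rule half[OF y y t])
        have nf: "norm f \<le> m" unfolding f_def by (rule \<phi>_bound[OF x t])
        have nqp: "norm (q t - p t) \<le> norm \<delta>" using t by (simp add: qp mult_left_le_one_le)
        have ny: "norm y \<le> 1" using y r by simp
        have nk: "norm k \<le> C1 * norm \<delta> * m"
          unfolding k_def by (rule order_trans[OF C1(2)[OF pK[OF t]]]) (use nf C1(1) in \<open>intro mult_left_mono, auto\<close>)
        have b2: "norm (B (q t) y f - B (p t) y f - D (p t) y f (q t - p t)) \<le> C2 * (norm \<delta>)\<^sup>2 * 1 * m"
          by (rule order_trans[OF C2(2)[OF pK[OF t] qK[OF t]]])
            (intro mult_mono power_mono nf ny nqp mult_nonneg_nonneg; simp add: C2(1))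
        have b3: "norm (t *\<^sub>R D (p t) \<delta> f \<delta>) \<le> C4 * norm \<delta> * norm \<delta> * m"
        proof -
          have "norm (t *\<^sub>R D (p t) \<delta> f \<delta>) \<le> norm (D (p t) \<delta> f \<delta>)" using t by (simp add: mult_left_le_one_le)
          also have "\<dots> \<le> C4 * norm \<delta> * norm \<delta> * norm f" by (rule C4(2)[OF pK[OF t]])
          also have "\<dots> \<le> C4 * norm \<delta> * norm \<delta> * m" using nf C4(1) by (intro mult_left_mono) auto
          finally show ?thesis .
        qed
        have b4: "norm (t *\<^sub>R ((B (q t) y k - B (p t) y k) + B (p t) \<delta> k))
            \<le> C3 * norm \<delta> * 1 * (C1 * norm \<delta> * m) + C1 * norm \<delta> * (C1 * norm \<delta> * m)"
        proof -
          have "norm (t *\<^sub>R ((B (q t) y k - B (p t) y k) + B (p t) \<delta> k))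
              \<le> norm ((B (q t) y k - B (p t) y k) + B (p t) \<delta> k)" using t by (simp add: mult_left_le_one_le)
          also have "\<dots> \<le> norm (B (q t) y k - B (p t) y k) + norm (B (p t) \<delta> k)" by (rule norm_triangle_ineq)
          also have "\<dots> \<le> C3 * norm \<delta> * 1 * (C1 * norm \<delta> * m) + C1 * norm \<delta> * (C1 * norm \<delta> * m)"
          proof (rule add_mono)
            show "norm (B (q t) y k - B (p t) y k) \<le> C3 * norm \<delta> * 1 * (C1 * norm \<delta> * m)"
              by (rule order_trans[OF C3(2)[OF pK[OF t] qK[OF t]]])
                (intro mult_mono nk ny nqp mult_nonneg_nonneg; simp add: C3(1))
            show "norm (B (p t) \<delta> k) \<le> C1 * norm \<delta> * (C1 * norm \<delta> * m)"
              by (rule order_trans[OF C1(2)[OF pK[OF t]]])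
                (intro mult_mono nk mult_nonneg_nonneg; simp add: C1(1))
          qed
          finally show ?thesis .
        qed
        have "norm (h' t) \<le> norm (h t) / 2 + C2 * (norm \<delta>)\<^sup>2 * 1 * m + C4 * norm \<delta> * norm \<delta> * m
           + (C3 * norm \<delta> * 1 * (C1 * norm \<delta> * m) + C1 * norm \<delta> * (C1 * norm \<delta> * m))"
          unfolding h'_eq by (intro norm_triangle_mono b1 b2 b3 b4)
        also have "\<dots> = norm (h t) / 2 + E / 2 * (norm \<delta>)\<^sup>2"
          by (simp add: E_def power2_eq_square algebra_simps)
        finally show ?thesis .
      qed
      have "norm (h 1) \<le> 2 * (norm (h 0) + E / 2 * (norm \<delta>)\<^sup>2)"
        by (rule norm_le_of_half_derivative[OF h' bound]) auto
      moreover have "h 0 = 0" using \<phi>0[OF x] \<phi>0[OF y] by (simp add: h_def)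
      ultimately show ?thesis by (simp add: h_def p_def \<delta>_def)
    qed
    \<comment> \<open>The value at time 1 of the solution along the ray to \<open>z\<close>. The
      estimate \<open>main\<close> is then a first-order expansion of \<open>F\<close> with
      quadratic error, at every point of the ball.\<close>
    define F where "F z = \<phi> (z - x0) 1" for z
    have "F x0 = F0"
    proof -
      have "norm (\<phi> 0 1 - F0) \<le> 2 * (norm (\<phi> 0 0 - F0) + 0)"
      proof (rule norm_le_of_half_derivative[where h = "\<lambda>t. \<phi> 0 t - F0" and h' = "\<lambda>t. 0"])
        show "((\<lambda>t. \<phi> 0 t - F0) has_vector_derivative 0) (at t within {0..1})" if "t \<in> {0..1}" for t
        proof -
          have "(\<phi> 0 has_vector_derivative 0) (at t within {0..1})"
            using \<phi>[of 0 t] that r(1) bilinear_lzero[OF bil[OF S(2)]] by simp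
          from has_vector_derivative_diff[OF this has_vector_derivative_const[of F0]] show ?thesis by simp
        qed
      qed auto
      then show ?thesis using \<phi>0[of 0] r(1) by (simp add: F_def)
    qed
    moreover have "(F has_derivative (\<lambda>u. B x u (F x))) (at x)" if "x \<in> ball x0 r" for x
    proof -
      have x: "norm (x - x0) \<le> r" using that by (simp add: dist_norm norm_minus_commute)
      have xS: "x \<in> S" using that r(2) r0 by auto
      have E: "E \<ge> 0" using C1(1) C2(1) C3(1) C4(1) m by (simp add: E_def)
      have bl: "bounded_linear (\<lambda>u. B x u (F x))"
        using bilinear_linear(2)[OF bil[OF xS]] by (simp add: linear_conv_bounded_linear)
      have est: "norm (F z - F x - B x (z - x) (F x)) \<le> E * (norm (z - x))\<^sup>2" if "z \<in> ball x0 r" for z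
        using main[OF x, of "z - x0"] that by (simp add: F_def dist_norm norm_minus_commute)
      have "\<exists>d>0. \<forall>z. norm (z - x) < d \<longrightarrow> norm (F z - F x - B x (z - x) (F x)) \<le> e * norm (z - x)"
        if e: "e > 0" for e
      proof -
        obtain d0 where d0: "d0 > 0" "ball x d0 \<subseteq> ball x0 r"
          using \<open>x \<in> ball x0 r\<close> open_contains_ball open_ball by metis
        define d where "d = min d0 (e / (E + 1))"
        have "norm (F z - F x - B x (z - x) (F x)) \<le> e * norm (z - x)" if z: "norm (z - x) < d" for z
        proof -
          have "z \<in> ball x d0" using z by (simp add: d_def dist_norm norm_minus_commute)
          then have "norm (F z - F x - B x (z - x) (F x)) \<le> E * (norm (z - x))\<^sup>2" using est d0 by blast
          also have "\<dots> = (E * norm (z - x)) * norm (z - x)" by (simp add: power2_eq_square)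
          also have "\<dots> \<le> e * norm (z - x)"
          proof (rule mult_right_mono)
            have "norm (z - x) \<le> e / (E + 1)" using z by (simp add: d_def)
            then have "(E + 1) * norm (z - x) \<le> e" using E by (simp add: field_simps)
            then show "E * norm (z - x) \<le> e" 
              using norm_ge_zero[of "z - x"] unfolding distrib_right mult_1_left by linarith
          qed auto
          finally show ?thesis .
        qed
        moreover have "d > 0" using d0 e E by (simp add: d_def)
        ultimately show ?thesis by blast
      qed
      then show ?thesis
        using bl unfolding has_derivative_at_alt by blast
    qed
    ultimately show ?thesis by blast
  qed
  moreover have "ball x0 r \<subseteq> S" using r(2) r0 by auto
  ultimately show ?thesis using r(1) by blast
qed

text \<open>Bootstrapping: the equation makes the derivative of \<open>F\<close> as regular as
  \<open>F\<close> itself.\<close>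

lemma parallel_section_smooth:
  fixes B :: "'e::euclidean_space \<Rightarrow> 'e \<Rightarrow> 'f::euclidean_space \<Rightarrow> 'f"
  assumes "open S" "\<And>x. x \<in> S \<Longrightarrow> bilinear (B x)" "\<And>u f. smooth_on S (\<lambda>x. B x u f)"
    and F: "\<And>x. x \<in> S \<Longrightarrow> (F has_derivative (\<lambda>u. B x u (F x))) (at x)"
  shows "smooth_on S F"
  unfolding smooth_on_def
proof
  show "Ck_on k S F" for k
  proof (induction k)
    case 0
    then show ?case
      using F by (auto intro!: continuous_at_imp_continuous_on has_derivative_continuous)
  next
    case (Suc k)
    show ?case
      by (rule Ck_on_SucI[OF assms(1) F], assumption, rule Ck_on_linear_apply[where \<Phi> = "\<lambda>x. B x _"])
        (use assms Suc in \<open>auto simp: smooth_on_def bilinear_linear\<close>)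
  qed
qed

text \<open>The same bootstrapping along a curve. It provides the smoothness of integral curves,
  whose definition asks only for differentiability.\<close>

lemma ode_solution_smooth:
  fixes x :: "real \<Rightarrow> 'e::euclidean_space"
  assumes J: "open J" and V: "smooth_on T V" and xT: "x ` J \<subseteq> T"
    and x: "\<And>t. t \<in> J \<Longrightarrow> (x has_vector_derivative V (x t)) (at t)"
  shows "smooth_on J x"
  unfolding smooth_on_def
proof
  show "Ck_on k J x" for k
  proof (induction k)
    case 0
    then show ?case
      using x by (auto intro!: continuous_at_imp_continuous_on has_vector_derivative_continuous)
  next
    case (Suc k)
    show ?case
    proof (rule Ck_on_SucI[OF J])
      show "(x has_derivative (\<lambda>h. h *\<^sub>R V (x t))) (at t)" if "t \<in> J" for t
        using x[OF that] by (simp add: has_vector_derivative_def)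
      have "Ck_on k T V" using V by (simp add: smooth_on_def)
      then show "Ck_on k J (\<lambda>t. h *\<^sub>R V (x t))" for h
        by (intro Ck_on_bounded_linear[OF bounded_linear_scaleR_right J] Ck_on_compose[OF J _ Suc xT])
    qed
  qed
qed

section \<open>Riemannian metrics on open sets\<close>

lemma linear_family_bounded_below:
  fixes T :: "'a::euclidean_space \<Rightarrow> 'b::euclidean_space \<Rightarrow> 'c::euclidean_space"
  assumes S: "open S" "x \<in> S" and lin: "\<And>y. y \<in> S \<Longrightarrow> linear (T y)" and inj: "inj (T x)"
    and cont: "\<And>u. continuous_on S (\<lambda>y. T y u)"
  shows "\<exists>c>0. \<exists>r>0. ball x r \<subseteq> S \<and> (\<forall>y\<in>ball x r. \<forall>u. c * norm u \<le> norm (T y u))"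
proof -
  obtain c where c: "c > 0" "\<And>u. c * norm u \<le> norm (T x u)"
    using linear_inj_bounded_below_pos[OF lin[OF S(2)] inj] by metis
  define s where "s y = (\<Sum>b\<in>Basis. norm (T y b - T x b))" for y
  have "continuous_on S s" unfolding s_def by (intro continuous_intros cont)
  then have "isCont s x" using S by (simp add: continuous_on_eq_continuous_at)
  then obtain d where d: "d > 0" "\<And>y. dist y x < d \<Longrightarrow> dist (s y) (s x) < c / 2"
    unfolding continuous_at_eps_delta using c(1) half_gt_zero by blast
  obtain r where r: "r > 0" "ball x r \<subseteq> S" using S openE by blast
  have "c / 2 * norm u \<le> norm (T y u)" if y: "y \<in> ball x (min d r)" for y u
  proof -
    have yS: "y \<in> S" using y r by auto
    have "s y \<le> c / 2"
      using d(2)[of y] y by (simp add: s_def dist_commute abs_if split: if_splits)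
    have "norm (T y u - T x u) \<le> s y * norm u"
      unfolding s_def by (rule linear_norm_le_sum_Basis[of "\<lambda>u. T y u - T x u"])
        (intro linear_compose_sub lin yS S)
    also have "\<dots> \<le> c / 2 * norm u" using \<open>s y \<le> c / 2\<close> by (intro mult_right_mono) auto
    finally show ?thesis
      using c(2)[of u] norm_triangle_ineq2[of "T x u" "T y u"] by (simp add: norm_minus_commute)
  qed
  then show ?thesis
    using c(1) d(1) r by (intro exI[of _ "c / 2"] conjI exI[of _ "min d r"]) auto
qed

text \<open>No formula for the inverse is used. Differentiating \<open>T x (z x) = k x\<close> shows
  that the derivative of \<open>z\<close> solves a system with the same \<open>T\<close> and a
  right-hand side that is one order less regular than \<open>k\<close>, so induction on the order
  applies. The local lower bound on \<open>T\<close> gives continuity and differentiability.\<close>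

lemma Ck_on_linear_solution:
  fixes T :: "'a::euclidean_space \<Rightarrow> 'b::euclidean_space \<Rightarrow> 'b"
  assumes S: "open S" and lin: "\<And>x. x \<in> S \<Longrightarrow> linear (T x)" and inj: "\<And>x. x \<in> S \<Longrightarrow> inj (T x)"
    and sm: "\<And>u. smooth_on S (\<lambda>x. T x u)"
    and eq: "\<And>x. x \<in> S \<Longrightarrow> T x (z x) = k x" and k: "Ck_on n S k"
  shows "Ck_on n S z"
  using eq k
proof (induction n arbitrary: z k)
  case 0
  have "isCont z x" if x: "x \<in> S" for x
  proof -
    obtain c r where c: "c > 0" "r > 0" "ball x r \<subseteq> S" "\<And>y u. y \<in> ball x r \<Longrightarrow> c * norm u \<le> norm (T y u)"
      using linear_family_bounded_below[of S x T] S x lin inj smooth_on_continuous[OF sm] by metis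
    have "continuous_on S (\<lambda>y. k y - T y (z x))"
      using 0 smooth_on_continuous[OF sm] by (intro continuous_intros) auto
    then have "((\<lambda>y. k y - T y (z x)) \<longlongrightarrow> k x - T x (z x)) (at x)"
      using S x continuous_on_eq_continuous_at isCont_def by blast
    then have l: "((\<lambda>y. norm (k y - T y (z x)) / c) \<longlongrightarrow> 0) (at x)"
      using tendsto_divide[OF tendsto_norm tendsto_const[of c]] c(1) 0(1)[OF x] by fastforce
    have "\<forall>\<^sub>F y in at x. norm (z y - z x) \<le> norm (k y - T y (z x)) / c"
    proof (rule eventually_mono[OF eventually_at_in_open'[of "ball x r" x]])
      fix y assume y: "y \<in> ball x r"
      then have "T y (z y - z x) = k y - T y (z x)" using 0(1) linear_diff[OF lin] c(3) by (metis subsetD)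
      then show "norm (z y - z x) \<le> norm (k y - T y (z x)) / c"
        using c(4)[OF y, of "z y - z x"] c(1) by (simp add: pos_le_divide_eq mult.commute)
    qed (use c in auto)
    then have "((\<lambda>y. z y - z x) \<longlongrightarrow> 0) (at x)" using l by (rule Lim_null_comparison)
    then show ?thesis by (simp add: isCont_def Lim_null[symmetric])
  qed
  then show ?case by (simp add: continuous_at_imp_continuous_on)
next
  case (Suc n)
  define DT where "DT x u = FD (\<lambda>y. T y u) x" for x u
  define Dk where "Dk x = FD k x" for x
  have DT: "((\<lambda>y. T y u) has_derivative DT x u) (at x)" if "x \<in> S" for x u
    unfolding DT_def using smooth_on_has_derivative[OF sm that] .
  have Dk: "(k has_derivative Dk x) (at x)" if "x \<in> S" for x
    unfolding Dk_def using Ck_on_has_derivative[OF Suc.prems(2) that] .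
  \<comment> \<open>The candidate derivative: the solution of the formally differentiated
    equation.\<close>
  define L where "L x h = inv (T x) (Dk x h - DT x (z x) h)" for x h
  have TL: "T x (L x h) = Dk x h - DT x (z x) h" if "x \<in> S" for x h
    unfolding L_def using linear_injective_imp_surjective[OF lin[OF that] inj[OF that]] by (simp add: surj_f_inv_f)
  have linL: "bounded_linear (L x)" if x: "x \<in> S" for x
  proof -
    have l: "linear (\<lambda>h. Dk x h - DT x (z x) h)"
      using Dk[OF x] DT[OF x] by (intro linear_compose_sub) (auto intro: has_derivative_linear)
    have "linear (L x)"
    proof (rule linearI)
      show "L x (a + b) = L x a + L x b" for a b by (rule injD[OF inj[OF x]])
          (simp only: TL[OF x] linear_add[OF lin[OF x]] linear_add[OF l])
      show "L x (c *\<^sub>R a) = c *\<^sub>R L x a" for c a by (rule injD[OF inj[OF x]])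
          (simp only: TL[OF x] linear_cmul[OF lin[OF x]] linear_cmul[OF l])
    qed
    then show ?thesis by (simp add: linear_conv_bounded_linear)
  qed
  have der: "(z has_derivative L x) (at x)" if x: "x \<in> S" for x
  proof -
    obtain c r where c: "c > 0" "r > 0" "ball x r \<subseteq> S" "\<And>y u. y \<in> ball x r \<Longrightarrow> c * norm u \<le> norm (T y u)"
      using linear_family_bounded_below[of S x T] S x lin inj smooth_on_continuous[OF sm] by metis
    \<comment> \<open>\<open>m y\<close> is \<open>T y\<close> applied to the first-order remainder
      of \<open>z\<close>. It vanishes to first order at \<open>x\<close>, and the lower bound on
      \<open>T y\<close> transfers this to the remainder itself.\<close>
    define m where "m y = k y - T y (z x + L x (y - x))" for y
    have L0: "L x 0 = 0" using linL[OF x] by (simp add: linear_simps)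
    have "((\<lambda>y. z x + L x (y - x)) has_derivative L x) (at x)" by (rule has_derivative_eq_rhs,
          rule has_derivative_add[OF has_derivative_const bounded_linear.has_derivative[OF linL[OF x]]])
        (auto intro!: derivative_eq_intros)
    then have "(m has_derivative (\<lambda>h. Dk x h - (DT x (z x + L x (x - x)) h + T x (L x h)))) (at x)"
      unfolding m_def
      by (intro has_derivative_diff Dk[OF x] has_derivative_linear_apply[OF S x lin DT[OF x]])
    then have m: "(m has_derivative (\<lambda>h. 0)) (at x)" by (simp add: L0 TL[OF x])
    have m0: "m x = 0" using Suc.prems(1)[OF x] by (simp add: m_def L0)
    have "\<exists>d>0. \<forall>y. norm (y - x) < d \<longrightarrow> norm (z y - z x - L x (y - x)) \<le> e * norm (y - x)"
      if e: "e > 0" for e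
    proof -
      obtain d where d: "d > 0" "\<And>y. norm (y - x) < d \<Longrightarrow> norm (m y) \<le> (c * e) * norm (y - x)"
        using m m0 e c(1) unfolding has_derivative_at_alt by (auto dest!: spec[of _ "c * e"])
      have "norm (z y - z x - L x (y - x)) \<le> e * norm (y - x)" if y: "norm (y - x) < min d r" for y
      proof -
        have yr: "y \<in> ball x r" using y by (simp add: dist_norm norm_minus_commute)
        then have yS: "y \<in> S" using c(3) by auto
        have "T y (z y - z x - L x (y - x)) = m y"
          using Suc.prems(1)[OF yS] by (simp add: m_def linear_diff[OF lin[OF yS]] linear_add[OF lin[OF yS]])
        then have "c * norm (z y - z x - L x (y - x)) \<le> c * (e * norm (y - x))"
          using c(4)[OF yr, of "z y - z x - L x (y - x)"] d(2)[of y] y by simp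
        then show ?thesis using c(1) by simp
      qed
      then show ?thesis using d(1) c(2) by (intro exI[of _ "min d r"]) auto
    qed
    then show ?thesis unfolding has_derivative_at_alt using linL[OF x] by blast
  qed
  have zn: "Ck_on n S z" by (rule Suc.IH[OF Suc.prems(1) Ck_on_SucD[OF Suc.prems(2)]])
  have linDT: "linear (\<lambda>u. DT x u h)" if x: "x \<in> S" for x h
    unfolding DT_def by (rule linear_frechet_derivative[OF S x lin sm])
  show ?case
  proof (rule Ck_on_SucI[OF S der])
    show "Ck_on n S (\<lambda>x. L x v)" for v
    proof (rule Suc.IH[OF TL])
      have "Ck_on n S (\<lambda>x. Dk x v)" using Suc.prems(2) by (simp add: Dk_def)
      moreover have "Ck_on n S (\<lambda>x. - DT x (z x) v)"
      proof (rule Ck_on_bounded_linear[OF bounded_linear_minus[OF bounded_linear_ident] S])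
        show "Ck_on n S (\<lambda>x. DT x (z x) v)"
        proof (rule Ck_on_linear_apply[where \<Phi> = "\<lambda>x u. DT x u v", OF S linDT _ zn])
          show "Ck_on n S (\<lambda>x. DT x u v)" for u
            using smooth_on_frechet_derivative[OF sm] by (simp add: smooth_on_def DT_def)
        qed
      qed
      ultimately show "Ck_on n S (\<lambda>x. Dk x v - DT x (z x) v)"
        using Ck_on_add[OF S, of n "\<lambda>x. Dk x v" "\<lambda>x. - DT x (z x) v"] by simp
    qed
  qed (use S in auto)
qed

text \<open>Polarization: a tensor with the symmetries of a curvature tensor is determined by its
  sectional values. Applied to the difference of two such tensors, this recovers the full curvature
  from the sectional curvatures.\<close>

lemma curvature_like_eq_0:
  fixes Q :: "'a::ab_group_add \<Rightarrow> 'a \<Rightarrow> 'a \<Rightarrow> 'a \<Rightarrow> real"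
  assumes a: "\<And>u w z v. Q u w z v = - Q w u z v" and b: "\<And>u w z v. Q u w z v = - Q u w v z"
    and c: "\<And>u w z v. Q u w z v + Q w z u v + Q z u w v = 0"
    and add1: "\<And>u u' w z v. Q (u + u') w z v = Q u w z v + Q u' w z v"
    and add3: "\<And>u w z z' v. Q u w (z + z') v = Q u w z v + Q u w z' v"
    and sec: "\<And>u w. Q u w w u = 0"
  shows "Q u w z v = 0"
proof -
  \<comment> \<open>Pair symmetry, from the Bianchi identities for the four cyclic shifts of the
    arguments.\<close>
  have p: "Q u w z v = Q z v u w" for u w z v
    using c[of u w z v] c[of w z v u] c[of z v u w] c[of v u w z]
      a[of z u w v] b[of w z u v] b[of w z v u] a[of v w z u] b[of z v w u] b[of z v u w] a[of u z v w] b[of v u z w]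
      b[of v u w z] a[of w v u z] a[of z v w u] b[of u w v z] a[of u w z v] a[of w z u v] a[of v u w z] a[of v u z w]
      b[of u z w v] b[of w v u z] b[of z u w v] b[of u z v w] b[of w v z u] b[of v w z u] b[of v w u z]
      a[of w v z u] by linarith
  have add4: "Q u w z (v + v') = Q u w z v + Q u w z v'" for u w z v v'
    using b[of u w z "v + v'"] b[of u w z v] b[of u w z v'] add3[of u w v v' z] by linarith
  have add2: "Q u (w + w') z v = Q u w z v + Q u w' z v" for u w w' z v
    using a[of u "w + w'" z v] a[of u w z v] a[of u w' z v] add1[of w w' u z v] by linarith
  have s1: "Q u w w v = 0" for u w v
  proof -
    have "Q u w w v + Q v w w u = 0"
      using sec[of "u + v" w] sec[of u w] sec[of v w] by (simp add: add1 add4)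
    moreover have "Q v w w u = Q u w w v"
      using p[of v w w u] a[of w u v w] b[of u w v w] by linarith
    ultimately show ?thesis by linarith
  qed
  \<comment> \<open>\<open>Q\<close> is now alternating in the second and third arguments as well as
    in the first two. Hence the three terms of the Bianchi identity coincide, and their sum is
    \<open>3 * Q u w z v\<close>.\<close>
  have s2: "Q u w z v = - Q u z w v" for u w z v
    using s1[of u "w + z" v] s1[of u w v] s1[of u z v] by (simp add: add2 add3)
  show ?thesis
    using c[of u w z v] s2[of w z u v] a[of w u z v] s2[of z u w v] a[of z w u v] s2[of w z u v]
    by linarith
qed

lemma one_le_DIM: "1 \<in> {1..DIM('a::euclidean_space)}"
  using DIM_positive[where 'a = 'a] by simp

text \<open>A metric read in one chart. Every chart of the manifold provides an instance, so the
  local geometry takes place on an open subset of the model space, where vector fields are plain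
  functions.\<close>

locale riemannian_domain =
  fixes S :: "'e::euclidean_space set" and G :: "'e \<Rightarrow> 'e \<Rightarrow> 'e \<Rightarrow> real"
  assumes open_S: "open S"
    and bil: "x \<in> S \<Longrightarrow> bilinear (G x)"
    and sym: "x \<in> S \<Longrightarrow> G x u w = G x w u"
    and pos: "x \<in> S \<Longrightarrow> u \<noteq> 0 \<Longrightarrow> G x u u > 0"
    and smooth: "smooth_on S (\<lambda>x. G x u w)"
begin

lemmas G_simps = bilinear_ladd[OF bil] bilinear_radd[OF bil] bilinear_lsub[OF bil] bilinear_rsub[OF bil]
  bilinear_lmul[OF bil] bilinear_rmul[OF bil] bilinear_lneg[OF bil] bilinear_rneg[OF bil]
  bilinear_lzero[OF bil] bilinear_rzero[OF bil]

lemma nondegenerate: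
  assumes "x \<in> S" "\<And>w. G x u w = G x v w" shows "u = v"
proof (rule ccontr)
  assume "u \<noteq> v"
  then have "G x (u - v) (u - v) > 0" using pos[OF assms(1)] by simp
  moreover have "G x (u - v) (u - v) = 0" using assms(2) by (simp add: G_simps assms(1))
  ultimately show False by simp
qed

text \<open>The musical isomorphism \<open>u \<mapsto> G x u\<close>, with the covector stored as
  its vector of coefficients. This makes it an endomorphism of the model space, to which the results
  on linear systems apply.\<close>

definition flat_map :: "'e \<Rightarrow> 'e \<Rightarrow> 'e" where
  "flat_map x u = (\<Sum>b\<in>Basis. G x u b *\<^sub>R b)"

lemma flat_map_linear: "x \<in> S \<Longrightarrow> linear (flat_map x)"
  by (rule linearI) (simp_all add: flat_map_def G_simps scaleR_add_left sum.distrib scaleR_sum_right)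

lemma flat_map_inner: "b \<in> Basis \<Longrightarrow> flat_map x u \<bullet> b = G x u b"
  by (simp add: flat_map_def inner_sum_left inner_Basis sum.If_cases if_distrib[of "\<lambda>a. _ * a"] cong: if_cong)

lemma flat_map_eqI:
  assumes "x \<in> S" "linear f" "flat_map x u = (\<Sum>b\<in>Basis. f b *\<^sub>R b)"
  shows "G x u w = f w"
proof -
  have "G x u b = f b" if "b \<in> Basis" for b
    using flat_map_inner[OF that, of x u] assms(3) that
    by (simp add: inner_sum_left inner_Basis if_distrib[of "\<lambda>a. _ * a"] cong: if_cong)
  then show ?thesis
    using linear_eq_stdbasis[OF bilinear_linear(1)[OF bil[OF assms(1)]] assms(2)] by metis
qed

lemma flat_map_inj: "x \<in> S \<Longrightarrow> inj (flat_map x)"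
proof (rule injI)
  fix u v assume x: "x \<in> S" and "flat_map x u = flat_map x v"
  then have "G x u w = G x v w" for w
    by (intro flat_map_eqI) (auto simp: flat_map_def intro: bilinear_linear bil)
  then show "u = v" by (rule nondegenerate[OF x])
qed

lemma riesz:
  assumes "x \<in> S" "linear f" shows "\<exists>z. \<forall>w. G x z w = f w"
proof -
  obtain z where "flat_map x z = (\<Sum>b\<in>Basis. f b *\<^sub>R b)"
    using linear_injective_imp_surjective[OF flat_map_linear flat_map_inj, OF assms(1) assms(1)]
    by (metis surjD)
  then show ?thesis using flat_map_eqI assms by blast
qed

text \<open>The representing vector solves the linear system
  \<open>flat_map x (z x) = \<dots>\<close>, whose coefficients and right-hand side are
  smooth.\<close>

lemma smooth_riesz:
  assumes z: "\<And>x w. x \<in> S \<Longrightarrow> G x (z x) w = k x w" and k: "\<And>w. smooth_on S (\<lambda>x. k x w)"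
  shows "smooth_on S z"
  unfolding smooth_on_def
proof
  fix n
  show "Ck_on n S z"
  proof (rule Ck_on_linear_solution[OF open_S flat_map_linear flat_map_inj])
    show "smooth_on S (\<lambda>x. flat_map x u)" for u
      unfolding flat_map_def by (intro smooth_on_sum smooth_on_scaleR open_S smooth smooth_on_const)
    show "flat_map x (z x) = (\<Sum>b\<in>Basis. k x b *\<^sub>R b)" if "x \<in> S" for x
      using z[OF that] by (simp add: flat_map_def)
    have "smooth_on S (\<lambda>x. \<Sum>b\<in>Basis. k x b *\<^sub>R b)"
      by (intro smooth_on_sum smooth_on_scaleR open_S k smooth_on_const)
    then show "Ck_on n S (\<lambda>x. \<Sum>b\<in>Basis. k x b *\<^sub>R b)" by (simp add: smooth_on_def)
  qed
qed

section \<open>The Levi-Civita connection of a metric on an open set\<close>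

definition DG :: "'e \<Rightarrow> 'e \<Rightarrow> 'e \<Rightarrow> 'e \<Rightarrow> real" where
  "DG x u w z = FD (\<lambda>y. G y u w) x z"

lemma DG_has_derivative: "x \<in> S \<Longrightarrow> ((\<lambda>y. G y u w) has_derivative DG x u w) (at x)"
  using smooth_on_has_derivative[OF smooth] by (simp add: DG_def[abs_def])

lemma DG_bilinear: "x \<in> S \<Longrightarrow> bilinear (\<lambda>u w. DG x u w z)"
  unfolding DG_def by (rule bilinear_frechet_derivative[OF open_S _ bil smooth])

lemma DG_linear: "x \<in> S \<Longrightarrow> linear (DG x u w)"
  using DG_has_derivative has_derivative_linear by blast

lemma DG_sym: "x \<in> S \<Longrightarrow> DG x u w z = DG x w u z"
  unfolding DG_def using frechet_derivative_cong_open[OF open_S, of x "\<lambda>y. G y u w" "\<lambda>y. G y w u"] sym by simp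

lemmas DG_simps = bilinear_ladd[OF DG_bilinear] bilinear_radd[OF DG_bilinear]
  bilinear_lmul[OF DG_bilinear] bilinear_rmul[OF DG_bilinear]
  linear_add[OF DG_linear] linear_cmul[OF DG_linear]

text \<open>The right-hand side of the Koszul formula for constant coordinate fields, whose brackets
  vanish.\<close>

definition koszul :: "'e \<Rightarrow> 'e \<Rightarrow> 'e \<Rightarrow> 'e \<Rightarrow> real" where
  "koszul x u w v = (DG x w v u + DG x u v w - DG x u w v) / 2"

text \<open>This is literally the predicate inside \<open>christoffel\<close>, so that the two
  descriptions of the connection are later identified by unfolding.\<close>

definition is_levi_civita :: "'e \<Rightarrow> ('e \<Rightarrow> 'e \<Rightarrow> 'e) \<Rightarrow> bool" where
  "is_levi_civita x \<Gamma> \<longleftrightarrow> bilinear \<Gamma> \<and> (\<forall>u w. \<Gamma> u w = \<Gamma> w u) \<and>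
     (\<forall>z u w. FD (\<lambda>y. G y u w) x z = G x (\<Gamma> z u) w + G x u (\<Gamma> z w))"

definition \<Gamma> :: "'e \<Rightarrow> 'e \<Rightarrow> 'e \<Rightarrow> 'e" where
  "\<Gamma> x = (THE \<Gamma>. is_levi_civita x \<Gamma>)"

lemma is_levi_civita_koszul:
  assumes x: "x \<in> S" and "is_levi_civita x \<gamma>"
  shows "G x (\<gamma> u w) v = koszul x u w v"
proof -
  have s: "\<gamma> a b = \<gamma> b a" and d: "DG x a b c = G x (\<gamma> c a) b + G x a (\<gamma> c b)" for a b c
    using assms(2) by (auto simp: is_levi_civita_def DG_def)
  show ?thesis
    unfolding koszul_def d
    using s[of v u] s[of v w] s[of w u] sym[OF x, of u "\<gamma> v w"] sym[OF x, of w "\<gamma> u v"]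
      sym[OF x, of u "\<gamma> w v"] by simp
qed

lemma levi_civita_exists:
  assumes x: "x \<in> S" shows "\<exists>\<gamma>. is_levi_civita x \<gamma>"
proof -
  have "\<exists>z. \<forall>v. G x z v = koszul x u w v" for u w
    by (rule riesz[OF x], rule linearI)
      (simp_all add: koszul_def DG_simps x add_divide_distrib diff_divide_distrib algebra_simps)
  then obtain \<gamma> where \<gamma>: "\<And>u w v. G x (\<gamma> u w) v = koszul x u w v" by metis
  have "bilinear \<gamma>"
    unfolding bilinear_def
  proof (intro conjI allI linearI)
    show "\<gamma> u (w + w') = \<gamma> u w + \<gamma> u w'" "\<gamma> (w + w') u = \<gamma> w u + \<gamma> w' u" for u w w'
      by (rule nondegenerate[OF x],
          simp add: \<gamma> G_simps x koszul_def DG_simps add_divide_distrib diff_divide_distrib)+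
    show "\<gamma> u (c *\<^sub>R w) = c *\<^sub>R \<gamma> u w" "\<gamma> (c *\<^sub>R w) u = c *\<^sub>R \<gamma> w u" for u w c
      by (rule nondegenerate[OF x], simp add: \<gamma> G_simps x koszul_def DG_simps algebra_simps)+
  qed
  moreover have "\<gamma> u w = \<gamma> w u" for u w
    by (rule nondegenerate[OF x]) (use DG_sym[OF x] in \<open>simp add: \<gamma> koszul_def\<close>)
  moreover have "FD (\<lambda>y. G y u w) x z = G x (\<gamma> z u) w + G x u (\<gamma> z w)" for z u w
    using DG_sym[OF x, of u w z] DG_sym[OF x, of z u w] DG_sym[OF x, of z w u]
    unfolding sym[OF x, of u] \<gamma> koszul_def DG_def[symmetric] by (simp add: field_simps)
  ultimately show ?thesis by (auto simp: is_levi_civita_def)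
qed

lemma levi_civita_unique:
  assumes "x \<in> S" "is_levi_civita x \<gamma>" "is_levi_civita x \<gamma>'"
  shows "\<gamma> = \<gamma>'"
  by (intro ext nondegenerate[OF assms(1)]) (simp add: is_levi_civita_koszul assms)

lemma \<Gamma>_eqI:
  assumes "x \<in> S" "is_levi_civita x \<gamma>" shows "\<Gamma> x = \<gamma>"
  unfolding \<Gamma>_def
  by (rule the_equality[where P = "is_levi_civita x", OF assms(2)]) (rule levi_civita_unique[OF assms(1) _ assms(2)])

lemma \<Gamma>_levi_civita:
  assumes "x \<in> S" shows "is_levi_civita x (\<Gamma> x)"
proof -
  obtain \<gamma> where "is_levi_civita x \<gamma>" using levi_civita_exists[OF assms] by blast
  then show ?thesis using \<Gamma>_eqI[OF assms] by simp
qed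

lemma \<Gamma>_bilinear: "x \<in> S \<Longrightarrow> bilinear (\<Gamma> x)"
  and \<Gamma>_sym: "x \<in> S \<Longrightarrow> \<Gamma> x u w = \<Gamma> x w u"
  and DG_eq: "x \<in> S \<Longrightarrow> DG x u w z = G x (\<Gamma> x z u) w + G x u (\<Gamma> x z w)"
  using \<Gamma>_levi_civita[of x] unfolding is_levi_civita_def DG_def by blast+

lemma \<Gamma>_smooth: "smooth_on S (\<lambda>x. \<Gamma> x u w)"
proof (rule smooth_riesz[where k = "\<lambda>x v. koszul x u w v"])
  show "G x (\<Gamma> x u w) v = koszul x u w v" if "x \<in> S" for x v
    using is_levi_civita_koszul[OF that \<Gamma>_levi_civita[OF that]] .
  have s: "smooth_on S (\<lambda>x. DG x a b c)" for a b c
    unfolding DG_def by (rule smooth_on_frechet_derivative[OF smooth])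
  have "smooth_on S (\<lambda>x. (1/2) *\<^sub>R (DG x w v u + DG x u v w - DG x u w v))" for v
    by (intro smooth_on_scaleR smooth_on_const smooth_on_diff smooth_on_add open_S s)
  then show "smooth_on S (\<lambda>x. koszul x u w v)" for v
    by (simp add: koszul_def)
qed

lemmas \<Gamma>_simps = bilinear_ladd[OF \<Gamma>_bilinear] bilinear_radd[OF \<Gamma>_bilinear]
  bilinear_lsub[OF \<Gamma>_bilinear] bilinear_rsub[OF \<Gamma>_bilinear]
  bilinear_lmul[OF \<Gamma>_bilinear] bilinear_rmul[OF \<Gamma>_bilinear]
  bilinear_lneg[OF \<Gamma>_bilinear] bilinear_rneg[OF \<Gamma>_bilinear]

definition D\<Gamma> :: "'e \<Rightarrow> 'e \<Rightarrow> 'e \<Rightarrow> 'e \<Rightarrow> 'e" where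
  "D\<Gamma> x u w z = FD (\<lambda>y. \<Gamma> y u w) x z"

lemma D\<Gamma>_has_derivative: "x \<in> S \<Longrightarrow> ((\<lambda>y. \<Gamma> y u w) has_derivative D\<Gamma> x u w) (at x)"
  using smooth_on_has_derivative[OF \<Gamma>_smooth] by (simp add: D\<Gamma>_def[abs_def])

lemma D\<Gamma>_sym: "x \<in> S \<Longrightarrow> D\<Gamma> x u w z = D\<Gamma> x w u z"
  unfolding D\<Gamma>_def
  using frechet_derivative_cong_open[OF open_S, of x "\<lambda>y. \<Gamma> y u w" "\<lambda>y. \<Gamma> y w u"] \<Gamma>_sym by simp

lemma D\<Gamma>_bilinear: "x \<in> S \<Longrightarrow> bilinear (\<lambda>u w. D\<Gamma> x u w z)"
  unfolding D\<Gamma>_def by (rule bilinear_frechet_derivative[OF open_S _ \<Gamma>_bilinear \<Gamma>_smooth])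

lemma D\<Gamma>_linear: "x \<in> S \<Longrightarrow> linear (D\<Gamma> x u w)"
  using D\<Gamma>_has_derivative has_derivative_linear by blast

text \<open>\<open>DG_eq\<close> splits the derivative of the metric coefficients into two
  Christoffel terms, which complete the derivatives of \<open>V\<close> and \<open>W\<close> to
  covariant ones.\<close>

lemma metric_product_rule:
  assumes x: "x \<in> S" and V: "(V has_derivative V') (at x)" and W: "(W has_derivative W') (at x)"
  shows "((\<lambda>y. G y (V y) (W y)) has_derivative
    (\<lambda>u. G x (V' u + \<Gamma> x u (V x)) (W x) + G x (V x) (W' u + \<Gamma> x u (W x)))) (at x)"
  by (rule has_derivative_eq_rhs,
      rule has_derivative_bilinear_apply[OF open_S x bil DG_has_derivative[OF x] V W], assumption)
    (simp add: DG_eq[OF x] G_simps x fun_eq_iff ac_simps)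

section \<open>The curvature tensor\<close>

definition R :: "'e \<Rightarrow> 'e \<Rightarrow> 'e \<Rightarrow> 'e \<Rightarrow> 'e" where
  "R x u w z = D\<Gamma> x w z u - D\<Gamma> x u z w + \<Gamma> x u (\<Gamma> x w z) - \<Gamma> x w (\<Gamma> x u z)"

lemma R_antisym: "R x u w z = - R x w u z"
  by (simp add: R_def)

lemma R_bianchi: "x \<in> S \<Longrightarrow> R x u w z + R x w z u + R x z u w = 0"
  using D\<Gamma>_sym[of x w z u] D\<Gamma>_sym[of x u z w] D\<Gamma>_sym[of x u w z]
    \<Gamma>_sym[of x w z] \<Gamma>_sym[of x u z] \<Gamma>_sym[of x u w]
  by (simp add: R_def)

lemma R_add1: "x \<in> S \<Longrightarrow> R x (u + u') w z = R x u w z + R x u' w z"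
  by (simp add: R_def \<Gamma>_simps linear_add[OF D\<Gamma>_linear] bilinear_ladd[OF D\<Gamma>_bilinear])

lemma R_linear3: "x \<in> S \<Longrightarrow> linear (R x u w)"
  by (rule linearI)
    (simp_all add: R_def \<Gamma>_simps bilinear_radd[OF D\<Gamma>_bilinear] bilinear_rmul[OF D\<Gamma>_bilinear] algebra_simps)

text \<open>Second derivatives of the coefficient \<open>G y z v\<close> commute. Expanding both
  orders by compatibility with the metric, the mixed products of Christoffel terms agree and only
  the curvature terms are left.\<close>

lemma R_skew:
  assumes x: "x \<in> S" shows "G x (R x u w z) v = - G x (R x u w v) z"
proof -
  have 1: "((\<lambda>y. DG y z v w) has_derivative
     (\<lambda>u. G x (D\<Gamma> x w z u + \<Gamma> x u (\<Gamma> x w z)) v + G x (\<Gamma> x w z) (0 + \<Gamma> x u v) +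
       (G x (0 + \<Gamma> x u z) (\<Gamma> x w v) + G x z (D\<Gamma> x w v u + \<Gamma> x u (\<Gamma> x w v))))) (at x)" for w
  proof (rule has_derivative_transform_within_open[OF _ open_S x])
    show "((\<lambda>y. G y (\<Gamma> y w z) v + G y z (\<Gamma> y w v)) has_derivative
     (\<lambda>u. G x (D\<Gamma> x w z u + \<Gamma> x u (\<Gamma> x w z)) v + G x (\<Gamma> x w z) (0 + \<Gamma> x u v) +
       (G x (0 + \<Gamma> x u z) (\<Gamma> x w v) + G x z (D\<Gamma> x w v u + \<Gamma> x u (\<Gamma> x w v))))) (at x)"
      by (intro has_derivative_add metric_product_rule[OF x] D\<Gamma>_has_derivative[OF x] has_derivative_const)
    show "G y (\<Gamma> y w z) v + G y z (\<Gamma> y w v) = DG y z v w" if "y \<in> S" for y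
      using DG_eq[OF that] by simp
  qed
  have "FD (\<lambda>y. DG y z v w) x u = FD (\<lambda>y. DG y z v u) x w"
    unfolding DG_def using smooth_on_symmetric_second_derivative[OF open_S x smooth] .
  then have "G x (D\<Gamma> x w z u + \<Gamma> x u (\<Gamma> x w z)) v + G x (\<Gamma> x w z) (\<Gamma> x u v) +
       (G x (\<Gamma> x u z) (\<Gamma> x w v) + G x z (D\<Gamma> x w v u + \<Gamma> x u (\<Gamma> x w v))) =
     G x (D\<Gamma> x u z w + \<Gamma> x w (\<Gamma> x u z)) v + G x (\<Gamma> x u z) (\<Gamma> x w v) +
       (G x (\<Gamma> x w z) (\<Gamma> x u v) + G x z (D\<Gamma> x u v w + \<Gamma> x w (\<Gamma> x u v)))"
    unfolding frechet_derivative_at[OF 1, symmetric] by simp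
  then show ?thesis
    unfolding sym[OF x, of _ z] by (simp add: R_def G_simps x)
qed

text \<open>The curvature tensor of constant curvature -1 in the sign convention of
  \<open>R\<close>: inserting \<open>z = w\<close> and pairing with \<open>u\<close> gives minus the
  squared area spanned by \<open>u\<close> and \<open>w\<close>.\<close>

definition hyperbolic_at :: "'e \<Rightarrow> bool" where
  "hyperbolic_at x \<longleftrightarrow> (\<forall>u w z. R x u w z = G x u z *\<^sub>R w - G x w z *\<^sub>R u)"

text \<open>The difference between \<open>R\<close> and the model tensor has all curvature
  symmetries and vanishing sectional values, so polarization makes it zero.\<close>

lemma hyperbolic_atI:
  assumes x: "x \<in> S" and sec: "\<And>u w. G x (R x u w w) u = (G x u w)\<^sup>2 - G x u u * G x w w"
  shows "hyperbolic_at x"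
proof -
  define Q where "Q u w z v = G x (R x u w z) v - (G x u z * G x w v - G x w z * G x u v)" for u w z v
  have "Q u w z v = 0" for u w z v
  proof (rule curvature_like_eq_0[where Q = Q])
    show "Q u w z v = - Q w u z v" for u w z v
      using R_antisym[of x u w z] by (simp add: Q_def G_simps x)
    show "Q u w z v = - Q u w v z" for u w z v
      using R_skew[OF x, of u w z v] by (simp add: Q_def)
    show "Q u w z v + Q w z u v + Q z u w v = 0" for u w z v
    proof -
      have "G x (R x u w z) v + G x (R x w z u) v + G x (R x z u w) v = 0"
        using arg_cong[OF R_bianchi[OF x, of u w z], of "\<lambda>a. G x a v"] by (simp add: G_simps x)
      then show ?thesis by (simp add: Q_def sym[OF x, of w u] sym[OF x, of z u] sym[OF x, of w z] mult.commute)
    qed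
    show "Q (u + u') w z v = Q u w z v + Q u' w z v" for u u' w z v
      by (simp add: Q_def R_add1 G_simps x algebra_simps)
    show "Q u w (z + z') v = Q u w z v + Q u w z' v" for u w z z' v
      by (simp add: Q_def linear_add[OF R_linear3[OF x]] G_simps x algebra_simps)
    show "Q u w w u = 0" for u w by (simp add: Q_def sec sym[OF x, of w u] power2_eq_square)
  qed
  then have "G x (R x u w z) v = G x (G x u z *\<^sub>R w - G x w z *\<^sub>R u) v" for u w z v
    by (simp add: Q_def G_simps x)
  then show ?thesis
    unfolding hyperbolic_at_def using nondegenerate[OF x] by blast
qed

definition orthonormal_at :: "'e \<Rightarrow> (nat \<Rightarrow> 'e) \<Rightarrow> bool" where
  "orthonormal_at x b \<longleftrightarrow>
     (\<forall>i\<in>{1..DIM('e)}. \<forall>j\<in>{1..DIM('e)}. G x (b i) (b j) = (if i = j then 1 else 0))"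

lemma orthogonal_sum:
  assumes x: "x \<in> S" and I: "finite I" "j \<in> I"
    and b: "\<And>i. i \<in> I \<Longrightarrow> G x (b i) (b j) = (if i = j then 1 else 0)"
  shows "G x (\<Sum>i\<in>I. a i *\<^sub>R b i) (b j) = a j"
proof -
  have "G x (\<Sum>i\<in>I. a i *\<^sub>R b i) (b j) = (\<Sum>i\<in>I. a i * G x (b i) (b j))"
    using linear_sum[OF bilinear_linear(2)[OF bil[OF x]], of "\<lambda>i. a i *\<^sub>R b i" I "b j"]
    by (simp add: G_simps x)
  also have "\<dots> = (\<Sum>i\<in>I. if i = j then a i else 0)"
    by (rule sum.cong) (auto simp: b)
  finally show ?thesis using I by simp
qed

text \<open>Orthonormality makes the \<open>DIM('e)\<close> vectors independent, hence spanning; the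
  difference of both sides is orthogonal to all of them.\<close>

lemma orthonormal_at_expand:
  assumes x: "x \<in> S" and b: "orthonormal_at x b"
  shows "z = (\<Sum>i\<in>{1..DIM('e)}. G x z (b i) *\<^sub>R b i)"
proof -
  let ?I = "{1..DIM('e)}"
  have inj: "inj_on b ?I"
    using b unfolding orthonormal_at_def inj_on_def by (metis zero_neq_one)
  have "independent (b ` ?I)"
  proof (rule independent_if_scalars_zero)
    show "finite (b ` ?I)" by simp
    fix f v assume 0: "(\<Sum>v\<in>b ` ?I. f v *\<^sub>R v) = 0" and "v \<in> b ` ?I"
    then obtain j where j: "j \<in> ?I" "v = b j" by blast
    have "(\<Sum>i\<in>?I. f (b i) *\<^sub>R b i) = 0" using 0 unfolding sum.reindex[OF inj] comp_def .
    then have "f (b j) = G x 0 (b j)"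
      using orthogonal_sum[OF x _ j(1), of b "\<lambda>i. f (b i)"] b j by (simp add: orthonormal_at_def)
    then show "f v = 0" by (simp add: j G_simps x)
  qed
  moreover have "card (b ` ?I) = DIM('e)" using card_image[OF inj] by simp
  ultimately have span: "span (b ` ?I) = UNIV"
    by (metis card_ge_dim_independent dim_UNIV order_refl subset_UNIV top.extremum_uniqueI)
  have "G x (z - (\<Sum>i\<in>?I. G x z (b i) *\<^sub>R b i)) v = G x 0 v" for v
  proof (rule linear_eq_on_span[where B = "b ` ?I"])
    show "v \<in> span (b ` ?I)" using span by simp
    show "G x (z - (\<Sum>i\<in>?I. G x z (b i) *\<^sub>R b i)) w = G x 0 w" if w: "w \<in> b ` ?I" for w
    proof -
      obtain j where j: "j \<in> ?I" "w = b j" using w by blast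
      have "G x (\<Sum>i\<in>?I. G x z (b i) *\<^sub>R b i) w = G x z w"
        unfolding j(2) by (rule orthogonal_sum[OF x _ j(1)]) (use b j in \<open>auto simp: orthonormal_at_def\<close>)
      then show ?thesis by (simp add: G_simps x)
    qed
  qed (simp_all add: bilinear_linear(1)[OF bil[OF x]])
  then have "z - (\<Sum>i\<in>?I. G x z (b i) *\<^sub>R b i) = 0" by (rule nondegenerate[OF x])
  then show ?thesis by simp
qed

text \<open>Gram-Schmidt, adding one vector at a time. The condition on frames in the theorem is
  conditional on an orthonormal basis at the point, so deriving the curvature from it requires at
  least one such basis.\<close>

lemma orthonormal_at_exists:
  assumes x: "x \<in> S" shows "\<exists>b. orthonormal_at x b"
proof -
  have "\<exists>b. \<forall>i\<in>{1..k}. \<forall>j\<in>{1..k}. G x (b i) (b j) = (if i = j then 1 else 0)" if "k \<le> DIM('e)" for k :: nat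
    using that
  proof (induction k)
    case (Suc k)
    then obtain b where b: "\<And>i j. i \<in> {1..k} \<Longrightarrow> j \<in> {1..k} \<Longrightarrow> G x (b i) (b j) = (if i = j then 1 else 0)"
      using Suc_leD by blast
    have "dim (b ` {1..k}) \<le> k"
      using dim_le_card'[of "b ` {1..k}"] card_image_le[of "{1..k}" b] by simp
    then have "span (b ` {1..k}) \<noteq> UNIV"
      using Suc.prems by (metis dim_UNIV dim_span not_less_eq_eq order_trans)
    then obtain z where z: "z \<notin> span (b ` {1..k})" by blast
    define p where "p = (\<Sum>i\<in>{1..k}. G x z (b i) *\<^sub>R b i)"
    define d where "d = z - p"
    have "p \<in> span (b ` {1..k})"
      unfolding p_def by (intro span_sum span_scale span_base) auto
    then have "d \<noteq> 0" using z by (auto simp: d_def)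
    then have dd: "G x d d > 0" by (rule pos[OF x])
    have db: "G x d (b j) = 0" if "j \<in> {1..k}" for j
      using orthogonal_sum[OF x _ that, of b "\<lambda>i. G x z (b i)"] b that
      by (simp add: d_def G_simps x p_def)
    define e where "e = (1 / sqrt (G x d d)) *\<^sub>R d"
    have "G x e e = 1" using dd by (simp add: e_def G_simps x field_simps)
    moreover have "G x e (b j) = 0" "G x (b j) e = 0" if "j \<in> {1..k}" for j
      using db[OF that] sym[OF x, of "b j" d] by (simp_all add: e_def G_simps x)
    ultimately have "\<forall>i\<in>{1..Suc k}. \<forall>j\<in>{1..Suc k}.
        G x ((b(Suc k := e)) i) ((b(Suc k := e)) j) = (if i = j then 1 else 0)"
      using b by (auto simp: le_Suc_eq)
    then show ?case by blast
  qed auto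
  then show ?thesis unfolding orthonormal_at_def by blast
qed

text \<open>The covariant derivative of a field along a map \<open>\<tau>\<close>, that is, of the
  pulled back connection. The identity gives the usual covariant derivative, and a transition map of
  charts gives the comparison of two charts.\<close>

definition nabla_along :: "('a::euclidean_space \<Rightarrow> 'e) \<Rightarrow> ('a \<Rightarrow> 'e) \<Rightarrow> 'a \<Rightarrow> 'a \<Rightarrow> 'e" where
  "nabla_along \<tau> W x u =
     FD W x u + \<Gamma> (\<tau> x) (FD \<tau> x u) (W x)"

text \<open>The curvature of the pulled back connection is the pulled back curvature. Second
  derivatives of \<open>W\<close> and of \<open>\<tau>\<close> cancel in the commutator by symmetry,
  leaving derivatives and products of Christoffel symbols.\<close>

lemma R_along:
  fixes \<tau> W :: "'a::euclidean_space \<Rightarrow> 'e"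
  assumes T: "open T" "x \<in> T" and \<tau>: "smooth_on T \<tau>" "\<tau> ` T \<subseteq> S" and W: "smooth_on T W"
  shows "nabla_along \<tau> (\<lambda>y. nabla_along \<tau> W y w) x u - nabla_along \<tau> (\<lambda>y. nabla_along \<tau> W y u) x w
     = R (\<tau> x) (FD \<tau> x u) (FD \<tau> x w) (W x)"
proof -
  define D where "D f y = FD f y" for f :: "'a \<Rightarrow> 'e" and y
  have D: "(f has_derivative D f x) (at x)" if "smooth_on T f" for f
    unfolding D_def by (rule smooth_on_has_derivative[OF that T(2)])
  have DW: "((\<lambda>y. D W y w) has_derivative D (\<lambda>y. D W y w) x) (at x)"
    and D\<tau>: "((\<lambda>y. D \<tau> y w) has_derivative D (\<lambda>y. D \<tau> y w) x) (at x)" for w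
    using D[OF smooth_on_frechet_derivative[OF W]] D[OF smooth_on_frechet_derivative[OF \<tau>(1)]]
    by (simp_all add: D_def)
  have xS: "\<tau> x \<in> S" using T \<tau> by auto
  have 1: "((\<lambda>y. nabla_along \<tau> W y w) has_derivative (\<lambda>h. D (\<lambda>y. D W y w) x h +
     (D\<Gamma> (\<tau> x) (D \<tau> x w) (W x) (D \<tau> x h) + \<Gamma> (\<tau> x) (D (\<lambda>y. D \<tau> y w) x h) (W x) + \<Gamma> (\<tau> x) (D \<tau> x w) (D W x h))))
     (at x)" for w
    unfolding nabla_along_def D_def[symmetric]
    by (intro has_derivative_add DW has_derivative_bilinear_apply[OF T, where \<Phi> = "\<lambda>y. \<Gamma> (\<tau> y)"
          and D = "\<lambda>u w h. D\<Gamma> (\<tau> x) u w (D \<tau> x h)"] D\<tau> D[OF W]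
        \<Gamma>_bilinear has_derivative_compose[OF D[OF \<tau>(1)] D\<Gamma>_has_derivative[OF xS]])
      (use \<tau>(2) in auto)
  have sym2: "D (\<lambda>y. D W y w) x u = D (\<lambda>y. D W y u) x w" "D (\<lambda>y. D \<tau> y w) x u = D (\<lambda>y. D \<tau> y u) x w" for u w
    unfolding D_def by (rule smooth_on_symmetric_second_derivative[OF T W] smooth_on_symmetric_second_derivative[OF T \<tau>(1)])+
  have 2: "nabla_along \<tau> (\<lambda>y. nabla_along \<tau> W y w) x u = (D (\<lambda>y. D W y w) x u +
     (D\<Gamma> (\<tau> x) (D \<tau> x w) (W x) (D \<tau> x u) + \<Gamma> (\<tau> x) (D (\<lambda>y. D \<tau> y w) x u) (W x) + \<Gamma> (\<tau> x) (D \<tau> x w) (D W x u)))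
     + \<Gamma> (\<tau> x) (D \<tau> x u) (D W x w + \<Gamma> (\<tau> x) (D \<tau> x w) (W x))" for u w
    by (simp only: nabla_along_def[of \<tau> "\<lambda>y. nabla_along \<tau> W y w" x u] frechet_derivative_at[OF 1, symmetric]
        nabla_along_def[of \<tau> W x w] D_def)
  show ?thesis
    unfolding 2 D_def[symmetric] R_def sym2[of u w] by (simp add: \<Gamma>_simps xS)
qed

definition nabla :: "('e \<Rightarrow> 'e) \<Rightarrow> 'e \<Rightarrow> 'e \<Rightarrow> 'e" where
  "nabla V x u = FD V x u + \<Gamma> x u (V x)"

lemma nabla_eqI: "(V has_derivative V') (at x) \<Longrightarrow> nabla V x u = V' u + \<Gamma> x u (V x)"
  by (simp add: nabla_def frechet_derivative_at[symmetric])

lemma R_nabla: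
  assumes "open T" "x \<in> T" "T \<subseteq> S" "smooth_on T W"
  shows "nabla (\<lambda>y. nabla W y w) x u - nabla (\<lambda>y. nabla W y u) x w = R x u w (W x)"
proof -
  have i: "nabla_along (\<lambda>y. y) V z v = nabla V z v" for V z v
    by (simp add: nabla_along_def nabla_def)
  have "smooth_on T (\<lambda>y. y)" using Ck_on_ident[OF assms(1)] by (simp add: smooth_on_def)
  from R_along[OF assms(1,2) this _ assms(4), of w u] show ?thesis using assms(3) by (simp add: i)
qed

lemma metric_product_rule_nabla:
  assumes "x \<in> S" "V differentiable at x" "W differentiable at x"
  shows "((\<lambda>y. G y (V y) (W y)) has_derivative
    (\<lambda>u. G x (nabla V x u) (W x) + G x (V x) (nabla W x u))) (at x)"
  using metric_product_rule[OF assms(1)] assms(2,3) unfolding frechet_derivative_works nabla_def by blast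

text \<open>
  The local form of the frame equations: the field \<open>V 1\<close> is normal to a family of horospheres,
  to which the other fields are tangent.
\<close>

definition horospheric_on :: "'e set \<Rightarrow> (nat \<Rightarrow> 'e \<Rightarrow> 'e) \<Rightarrow> bool" where
  "horospheric_on T V \<longleftrightarrow> (\<forall>x\<in>T. \<forall>u.
     nabla (V 1) x u = G x u (V 1 x) *\<^sub>R V 1 x - u \<and>
     (\<forall>i\<in>{2..DIM('e)}. nabla (V i) x u = G x u (V i x) *\<^sub>R V 1 x))"

text \<open>The exterior derivative of the dual of \<open>V 1\<close> is the antisymmetric part of
  its covariant derivative, which here is a symmetric endomorphism. The Christoffel terms of the
  constant fields \<open>u\<close> and \<open>w\<close> cancel because the connection is
  torsion-free.\<close>

lemma horospheric_first_closed:
  assumes x: "x \<in> S" "x \<in> T" and V: "V 1 differentiable at x" "horospheric_on T V"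
  shows "FD (\<lambda>y. G y w (V 1 y)) x u = FD (\<lambda>y. G y u (V 1 y)) x w"
proof -
  have 1: "FD (\<lambda>y. G y w (V 1 y)) x =
     (\<lambda>u. G x (nabla (\<lambda>y. w) x u) (V 1 x) + G x w (nabla (V 1) x u))" for w
    by (rule frechet_derivative_at[symmetric], rule metric_product_rule_nabla[OF x(1) _ V(1)]) simp
  have "nabla (V 1) x u = G x u (V 1 x) *\<^sub>R V 1 x - u" for u
    using V(2) x(2) by (simp add: horospheric_on_def)
  then show ?thesis
    unfolding 1 using sym[OF x(1), of u w] \<Gamma>_sym[OF x(1), of u w]
    by (simp add: G_simps x(1) nabla_def)
qed

text \<open>Differentiating the first-order equations once more yields second covariant derivatives
  of each frame vector, whose commutator is the curvature by \<open>R_nabla\<close>. The result has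
  the model form on each frame vector, hence on every \<open>z\<close> by linearity.\<close>

lemma hyperbolic_of_horospheric:
  assumes T: "open T" "T \<subseteq> S" "x \<in> T"
    and V: "\<And>i. i \<in> {1..DIM('e)} \<Longrightarrow> smooth_on T (V i)" "orthonormal_at x (\<lambda>i. V i x)"
    and h: "horospheric_on T V"
  shows "hyperbolic_at x"
proof -
  have x: "x \<in> S" using T by auto
  note one = one_le_DIM[where 'a = 'e]
  define v where "v i = V i x" for i
  have dV: "V i differentiable at x" if "i \<in> {1..DIM('e)}" for i
    using smooth_on_differentiable[OF V(1)[OF that] T(3)] .
  have n1: "nabla (V 1) y u = G y u (V 1 y) *\<^sub>R V 1 y - u" if "y \<in> T" for y u
    using h that by (simp add: horospheric_on_def)
  have ni: "nabla (V i) y u = G y u (V i y) *\<^sub>R V 1 y" if "y \<in> T" "i \<in> {2..DIM('e)}" for y u i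
    using h that by (simp add: horospheric_on_def)
  have cong: "nabla (\<lambda>y. nabla (V i) y w) x u = nabla Z x u" if "\<And>y. y \<in> T \<Longrightarrow> nabla (V i) y w = Z y" for i w u Z
    using frechet_derivative_cong_open[OF T(1,3) that] that[OF T(3)]
    unfolding nabla_def[of "\<lambda>y. nabla (V i) y w"] nabla_def[of Z] by presburger
  have d: "((\<lambda>y. G y w (V i y) *\<^sub>R V 1 y) has_derivative
      (\<lambda>u. G x w (V i x) *\<^sub>R FD (V 1) x u +
        (G x (nabla (\<lambda>y. w) x u) (V i x) + G x w (nabla (V i) x u)) *\<^sub>R V 1 x)) (at x)"
    if "i \<in> {1..DIM('e)}" for i w
    by (intro has_derivative_scaleR metric_product_rule_nabla[OF x _ dV[OF that]]
        dV[OF one, unfolded frechet_derivative_works]) simp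
  have prod: "nabla (\<lambda>y. G y w (V i y) *\<^sub>R V 1 y) x u =
     G x w (v i) *\<^sub>R nabla (V 1) x u + (G x (\<Gamma> x u w) (v i) + G x w (nabla (V i) x u)) *\<^sub>R v 1"
    if "i \<in> {1..DIM('e)}" for i w u
    unfolding nabla_eqI[OF d[OF that]] by (simp add: nabla_def \<Gamma>_simps[OF x] v_def algebra_simps)
  have Rv: "R x u w (v i) = G x u (v i) *\<^sub>R w - G x w (v i) *\<^sub>R u" if i: "i \<in> {1..DIM('e)}" for u w i
  proof (cases "i = 1")
    case True
    \<comment> \<open>Compared with the other frame vectors there is an additional
      \<open>- w\<close>. Its covariant derivative is a Christoffel term symmetric in
      \<open>u\<close> and \<open>w\<close>, so the commutator does not see it.\<close>
    have P: "nabla (\<lambda>y. nabla (V 1) y w) x u =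
       G x w (v 1) *\<^sub>R nabla (V 1) x u + (G x (\<Gamma> x u w) (v 1) + G x w (nabla (V 1) x u)) *\<^sub>R v 1 - \<Gamma> x u w" for u w
    proof -
      have "nabla (\<lambda>y. nabla (V 1) y w) x u = nabla (\<lambda>y. G y w (V 1 y) *\<^sub>R V 1 y - w) x u"
        by (rule cong[OF n1])
      also have "\<dots> = nabla (\<lambda>y. G y w (V 1 y) *\<^sub>R V 1 y) x u - \<Gamma> x u w"
        unfolding nabla_eqI[OF has_derivative_diff[OF d[OF one] has_derivative_const]]
        unfolding nabla_eqI[OF d[OF one]] by (simp add: \<Gamma>_simps[OF x])
      finally show ?thesis by (simp only: prod[OF one])
    qed
    show ?thesis
      using R_nabla[OF T(1,3,2) V(1)[OF one], of w u] sym[OF x, of u w] \<Gamma>_sym[OF x, of u w]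
      unfolding P True n1[OF T(3)] v_def[symmetric] by (simp add: G_simps x algebra_simps)
  next
    case False
    then have i2: "i \<in> {2..DIM('e)}" using i by auto
    have P: "nabla (\<lambda>y. nabla (V i) y w) x u =
       G x w (v i) *\<^sub>R nabla (V 1) x u + (G x (\<Gamma> x u w) (v i) + G x w (nabla (V i) x u)) *\<^sub>R v 1" for u w
    proof -
      have "nabla (\<lambda>y. nabla (V i) y w) x u = nabla (\<lambda>y. G y w (V i y) *\<^sub>R V 1 y) x u"
        by (rule cong) (rule ni[OF _ i2])
      also have "\<dots> = G x w (v i) *\<^sub>R nabla (V 1) x u + (G x (\<Gamma> x u w) (v i) + G x w (nabla (V i) x u)) *\<^sub>R v 1"
        by (rule prod[OF i])
      finally show ?thesis .
    qed
    show ?thesis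
      using R_nabla[OF T(1,3,2) V(1)[OF i], of w u] \<Gamma>_sym[OF x, of u w]
      unfolding P n1[OF T(3)] ni[OF T(3) i2] v_def[symmetric] by (simp add: G_simps x algebra_simps)
  qed
  show ?thesis
    unfolding hyperbolic_at_def
  proof (intro allI)
    fix u w z
    let ?I = "{1..DIM('e)}"
    have z: "z = (\<Sum>i\<in>?I. G x z (v i) *\<^sub>R v i)"
      using orthonormal_at_expand[OF x V(2)] by (simp add: v_def)
    have G: "G x a z = (\<Sum>i\<in>?I. G x z (v i) * G x a (v i))" for a
      using linear_sum[OF bilinear_linear(1)[OF bil[OF x]], of a "\<lambda>i. G x z (v i) *\<^sub>R v i" ?I] z
      by (simp add: G_simps x)
    have "R x u w z = (\<Sum>i\<in>?I. G x z (v i) *\<^sub>R R x u w (v i))"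
      using linear_sum[OF R_linear3[OF x], of u w "\<lambda>i. G x z (v i) *\<^sub>R v i" ?I] z
      by (simp add: linear_cmul[OF R_linear3[OF x]])
    also have "\<dots> = (\<Sum>i\<in>?I. (G x z (v i) * G x u (v i)) *\<^sub>R w - (G x z (v i) * G x w (v i)) *\<^sub>R u)"
      by (rule sum.cong) (simp_all add: Rv scaleR_diff_right)
    also have "\<dots> = G x u z *\<^sub>R w - G x w z *\<^sub>R u"
      by (simp add: G[of u] G[of w] sum_subtractf scaleR_sum_left)
    finally show "R x u w z = G x u z *\<^sub>R w - G x w z *\<^sub>R u" .
  qed
qed

text \<open>
  In hyperbolic space these are the constant vectors of the ambient Minkowski space, split into their
  components tangent and normal to the hyperboloid.
\<close>

definition parallel_pair :: "'e set \<Rightarrow> ('e \<Rightarrow> 'e) \<Rightarrow> ('e \<Rightarrow> real) \<Rightarrow> bool" where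
  "parallel_pair T W \<phi> \<longleftrightarrow> smooth_on T W \<and> smooth_on T \<phi> \<and>
     (\<forall>x\<in>T. (W has_derivative (\<lambda>u. \<phi> x *\<^sub>R u - \<Gamma> x u (W x))) (at x) \<and> (\<phi> has_derivative G x (W x)) (at x))"

lemma parallel_pairD:
  assumes "parallel_pair T W \<phi>" "x \<in> T"
  shows "(W has_derivative (\<lambda>u. \<phi> x *\<^sub>R u - \<Gamma> x u (W x))) (at x)" "(\<phi> has_derivative G x (W x)) (at x)"
  using assms unfolding parallel_pair_def by blast+

section \<open>Existence of horospheric frames\<close>

lemma minkowski_parallel_sections:
  assumes x0: "x0 \<in> S" and hyp: "\<forall>x\<in>S. hyperbolic_at x"
  shows "\<exists>r>0. ball x0 r \<subseteq> S \<and>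
    (\<forall>W0 \<phi>0. \<exists>W \<phi>. W x0 = W0 \<and> \<phi> x0 = \<phi>0 \<and> parallel_pair (ball x0 r) W \<phi>)"
proof -
  \<comment> \<open>Both equations of \<open>parallel_pair\<close> packed into one linear system for
    a section with values in the product of the model space and the reals.\<close>
  define B :: "'e \<Rightarrow> 'e \<Rightarrow> 'e \<times> real \<Rightarrow> 'e \<times> real"
    where "B x u f = (snd f *\<^sub>R u - \<Gamma> x u (fst f), G x (fst f) u)" for x u f
  have bilB: "bilinear (B x)" if "x \<in> S" for x
    unfolding bilinear_def by (intro conjI allI linearI)
      (simp_all add: B_def \<Gamma>_simps G_simps that scaleR_add_left scaleR_add_right scaleR_diff_right)
  have smB: "smooth_on S (\<lambda>x. B x u f)" for u f
    unfolding B_def by (intro smooth_on_Pair smooth_on_diff smooth_on_const open_S \<Gamma>_smooth smooth)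
  have flat: "FD (\<lambda>y. B y w f) x u + B x w (B x u f) =
      FD (\<lambda>y. B y u f) x w + B x u (B x w f)" if x: "x \<in> S" for x u w f
  proof -
    have 1: "((\<lambda>y. B y w f) has_derivative (\<lambda>u. (0 - D\<Gamma> x w (fst f) u, DG x (fst f) w u))) (at x)" for w
      unfolding B_def
      by (intro has_derivative_Pair has_derivative_diff has_derivative_const D\<Gamma>_has_derivative[OF x] DG_has_derivative[OF x])
    \<comment> \<open>Flatness of the vector component is exactly hyperbolicity: \<open>R\<close>
      cancels against the contribution of the coupling between the vector and the scalar
      component.\<close>
    have "R x u w (fst f) = G x u (fst f) *\<^sub>R w - G x w (fst f) *\<^sub>R u"
      using hyp x by (simp add: hyperbolic_at_def)
    then have "D\<Gamma> x w (fst f) u - D\<Gamma> x u (fst f) w + \<Gamma> x u (\<Gamma> x w (fst f)) - \<Gamma> x w (\<Gamma> x u (fst f))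
        = G x (fst f) u *\<^sub>R w - G x (fst f) w *\<^sub>R u"
      by (simp add: R_def sym[OF x, of _ "fst f"])
    \<comment> \<open>Flatness of the scalar component, which follows from compatibility with the
      metric and symmetry of the Christoffel symbols.\<close>
    moreover have "DG x (fst f) w u - G x (\<Gamma> x u (fst f)) w = DG x (fst f) u w - G x (\<Gamma> x w (fst f)) u"
      using \<Gamma>_sym[OF x, of u w] by (simp add: DG_eq[OF x])
    ultimately show ?thesis
      unfolding frechet_derivative_at[OF 1, symmetric]
      using sym[OF x, of u w] \<Gamma>_sym[OF x, of u w]
      by (simp add: B_def \<Gamma>_simps G_simps x algebra_simps)
  qed
  have "\<exists>r>0. ball x0 r \<subseteq> S \<and> (\<forall>F0. \<exists>F. F x0 = F0 \<and>
    (\<forall>x\<in>ball x0 r. (F has_derivative (\<lambda>u. B x u (F x))) (at x)))"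
    by (rule flat_connection_parallel_section[OF open_S x0 bilB smB flat])
  then obtain r where r: "r > 0" "ball x0 r \<subseteq> S" and ex: "\<forall>F0. \<exists>F. F x0 = F0 \<and>
    (\<forall>x\<in>ball x0 r. (F has_derivative (\<lambda>u. B x u (F x))) (at x))"
    by (elim exE conjE) (rule that)
  have "\<exists>W \<phi>. W x0 = W0 \<and> \<phi> x0 = \<phi>0 \<and> parallel_pair (ball x0 r) W \<phi>" for W0 \<phi>0
  proof -
    obtain F where F0: "F x0 = (W0, \<phi>0)"
      and F: "\<And>x. x \<in> ball x0 r \<Longrightarrow> (F has_derivative (\<lambda>u. B x u (F x))) (at x)"
      using spec[OF ex, of "(W0, \<phi>0)"] by blast
    have sF: "smooth_on (ball x0 r) F"
      by (rule parallel_section_smooth[where B = B, OF open_ball _ _ F])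
        (use r(2) bilB smooth_on_subset[OF smB r(2)] in auto)
    have "((\<lambda>x. fst (F x)) has_derivative (\<lambda>u. snd (F x) *\<^sub>R u - \<Gamma> x u (fst (F x)))) (at x)"
      "((\<lambda>x. snd (F x)) has_derivative G x (fst (F x))) (at x)" if "x \<in> ball x0 r" for x
      using has_derivative_fst[OF F[OF that]] has_derivative_snd[OF F[OF that]] by (simp_all add: B_def)
    then show ?thesis
      unfolding parallel_pair_def using F0 smooth_on_bounded_linear[OF bounded_linear_fst open_ball sF]
        smooth_on_bounded_linear[OF bounded_linear_snd open_ball sF]
      by (intro exI[of _ "\<lambda>x. fst (F x)"] exI[of _ "\<lambda>x. snd (F x)"]) auto
  qed
  then show ?thesis using r by blast
qed

text \<open>Differentiating \<open>G x (W x) (W' x)\<close> produces the covariant derivatives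
  \<open>\<phi> x *\<^sub>R u\<close> and \<open>\<phi>' x *\<^sub>R u\<close>; paired with the
  other field, these are exactly the terms in the derivative of the product of the scalar
  parts.\<close>

lemma minkowski_product_constant:
  assumes r: "ball x0 r \<subseteq> S" and x: "x \<in> ball x0 r"
    and W: "parallel_pair (ball x0 r) W \<phi>" and W': "parallel_pair (ball x0 r) W' \<phi>'"
  shows "G x (W x) (W' x) - \<phi> x * \<phi>' x = G x0 (W x0) (W' x0) - \<phi> x0 * \<phi>' x0"
proof -
  let ?q = "\<lambda>x. G x (W x) (W' x) - \<phi> x * \<phi>' x"
  have "(?q has_derivative (\<lambda>u. 0)) (at y within ball x0 r)" if y: "y \<in> ball x0 r" for y
  proof (rule has_derivative_at_withinI)
    have yS: "y \<in> S" using r y by auto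
    note d = parallel_pairD[OF W y] and d' = parallel_pairD[OF W' y]
    show "(?q has_derivative (\<lambda>u. 0)) (at y)"
      by (rule has_derivative_eq_rhs, rule has_derivative_diff[OF
            metric_product_rule[OF yS d(1) d'(1)] has_derivative_mult[OF d(2) d'(2)]])
        (simp add: fun_eq_iff G_simps yS sym[OF yS, of _ "W' y"] mult.commute)
  qed
  then have "\<exists>c. \<forall>x\<in>ball x0 r. ?q x = c"
    by (rule has_derivative_zero_constant[OF convex_ball])
  then obtain c where c: "\<forall>x\<in>ball x0 r. ?q x = c" ..
  have "x0 \<in> ball x0 r" using x by (auto intro: order_le_less_trans[OF zero_le_dist])
  then show ?thesis using bspec[OF c x] bspec[OF c, of x0] by simp
qed

lemma horospheric_frame_exists:
  assumes x0: "x0 \<in> S" and hyp: "\<forall>x\<in>S. hyperbolic_at x" and b: "orthonormal_at x0 b"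
  shows "\<exists>r>0. \<exists>V. ball x0 r \<subseteq> S \<and> (\<forall>i. V i x0 = b i \<and> smooth_on (ball x0 r) (V i)) \<and>
    (\<forall>x\<in>ball x0 r. orthonormal_at x (\<lambda>i. V i x)) \<and> horospheric_on (ball x0 r) V"
proof -
  note one = one_le_DIM[where 'a = 'e]
  obtain s where s: "s > 0" "ball x0 s \<subseteq> S"
    and ex: "\<forall>W0 \<phi>0. \<exists>W \<phi>. W x0 = W0 \<and> \<phi> x0 = \<phi>0 \<and> parallel_pair (ball x0 s) W \<phi>"
    using minkowski_parallel_sections[OF x0 hyp] by (elim exE conjE) (rule that)
  \<comment> \<open>Only the first section starts with a nonzero scalar part. The Gram matrix of
    these initial values for the Lorentzian form is that of a null vector orthogonal to the
    orthonormal vectors \<open>b i\<close>, \<open>i \<ge> 2\<close>.\<close>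
  define W0 where "W0 i = (if i = 1 then - b 1 else b i)" for i :: nat
  define \<phi>0 :: "nat \<Rightarrow> real" where "\<phi>0 i = (if i = 1 then 1 else 0)" for i
  have "\<forall>i. \<exists>P. fst P x0 = W0 i \<and> snd P x0 = \<phi>0 i \<and> parallel_pair (ball x0 s) (fst P) (snd P)"
    using ex by simp
  from choice[OF this] obtain P where
    P: "\<forall>i. fst (P i) x0 = W0 i \<and> snd (P i) x0 = \<phi>0 i \<and> parallel_pair (ball x0 s) (fst (P i)) (snd (P i))" ..
  define W where "W i = fst (P i)" for i
  define \<phi> where "\<phi> i = snd (P i)" for i
  have init: "W i x0 = W0 i" "\<phi> i x0 = \<phi>0 i" for i using P by (auto simp: W_def \<phi>_def)
  have pp: "parallel_pair (ball x0 s) (W i) (\<phi> i)" for i using P by (simp add: W_def \<phi>_def)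
  have sm: "smooth_on (ball x0 s) (W i)" "smooth_on (ball x0 s) (\<phi> i)" for i
    using pp by (auto simp: parallel_pair_def)
  have dW: "(W i has_derivative (\<lambda>u. \<phi> i x *\<^sub>R u - \<Gamma> x u (W i x))) (at x)"
    and d\<phi>: "(\<phi> i has_derivative G x (W i x)) (at x)" if "x \<in> ball x0 s" for i x
    using parallel_pairD[OF pp that] .
  \<comment> \<open>As \<open>\<phi> 1\<close> equals 1 at the centre, it stays positive on a
    smaller ball, where dividing by it is possible.\<close>
  have "isCont (\<phi> 1) x0"
    using has_derivative_continuous[OF d\<phi>[of x0 1]] s(1) by simp
  then obtain r0 where r0: "r0 > 0" "\<And>x. dist x x0 < r0 \<Longrightarrow> dist (\<phi> 1 x) (\<phi> 1 x0) < 1"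
    unfolding continuous_at_eps_delta using zero_less_one by blast
  define r where "r = min s r0"
  have r: "r > 0" "ball x0 r \<subseteq> ball x0 s" "\<And>x. x \<in> ball x0 r \<Longrightarrow> \<phi> 1 x > 0"
  proof -
    show "r > 0" "ball x0 r \<subseteq> ball x0 s" using s(1) r0(1) by (auto simp: r_def)
    show "\<phi> 1 x > 0" if "x \<in> ball x0 r" for x
      using r0(2)[of x] that by (auto simp: r_def dist_commute[of x] init \<phi>0_def dist_real_def)
  qed
  have rS: "x \<in> S" and rs: "x \<in> ball x0 s" if "x \<in> ball x0 r" for x using that r(2) s(2) by auto
  \<comment> \<open>For \<open>i \<noteq> 1\<close> the multiple of the null section that makes the
    scalar component vanish is subtracted, so that the result is tangent. Being orthogonal to the
    null section, these combinations keep their mutual products.\<close>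
  define V where "V i x = (if i = 1 then - (inverse (\<phi> 1 x) *\<^sub>R W 1 x)
      else W i x - (\<phi> i x * inverse (\<phi> 1 x)) *\<^sub>R W 1 x)" for i x
  have V1: "V 1 x = - (inverse (\<phi> 1 x) *\<^sub>R W 1 x)" for x by (simp add: V_def)
  have Vi: "V i x = W i x + \<phi> i x *\<^sub>R V 1 x" if "i \<noteq> 1" for i x using that by (simp add: V_def)
  have smr: "smooth_on (ball x0 r) (W i)" "smooth_on (ball x0 r) (\<phi> i)" for i
    using sm smooth_on_subset r(2) by blast+
  have sminv: "smooth_on (ball x0 r) (\<lambda>x. inverse (\<phi> 1 x))"
    by (rule smooth_on_inverse[OF open_ball smr(2)]) (use r(3) in force)
  have smV1: "smooth_on (ball x0 r) (V 1)"
    unfolding V1[abs_def] by (intro smooth_on_minus smooth_on_scaleR open_ball smr sminv)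
  have smV: "smooth_on (ball x0 r) (V i)" for i
  proof (cases "i = 1")
    case False
    have "smooth_on (ball x0 r) (\<lambda>x. W i x + \<phi> i x *\<^sub>R V 1 x)"
      by (intro smooth_on_add smooth_on_scaleR open_ball smr smV1)
    then show ?thesis using Vi[OF False] by presburger
  qed (use smV1 in auto)
  have b11: "G x0 (b i) (b j) = (if i = j then 1 else 0)" if "i \<in> {1..DIM('e)}" "j \<in> {1..DIM('e)}" for i j
    using b that by (simp add: orthonormal_at_def)
  \<comment> \<open>The conserved Gram matrix: 0 in the entries that involve the null section, and
    the identity on the others. All inner products of the frame follow from this table.\<close>
  have q: "G x (W i x) (W j x) = \<phi> i x * \<phi> j x + (if i = j \<and> i \<noteq> 1 then 1 else 0)"
    if ij: "i \<in> {1..DIM('e)}" "j \<in> {1..DIM('e)}" and x: "x \<in> ball x0 r" for i j x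
  proof -
    have "G x (W i x) (W j x) - \<phi> i x * \<phi> j x = G x0 (W i x0) (W j x0) - \<phi> i x0 * \<phi> j x0"
      by (rule minkowski_product_constant[OF s(2) rs[OF x] pp pp])
    also have "\<dots> = (if i = j \<and> i \<noteq> 1 then 1 else 0)"
      using b11[OF ij] b11[OF one ij(2)] b11[OF ij(1) one] b11[OF one one]
      by (auto simp: init W0_def \<phi>0_def G_simps x0)
    finally show ?thesis by simp
  qed
  have ortho: "orthonormal_at x (\<lambda>i. V i x)" if x: "x \<in> ball x0 r" for x
    unfolding orthonormal_at_def
  proof (intro ballI)
    note xS = rS[OF x] and p = r(3)[OF x]
    have W1: "G x (V 1 x) (V 1 x) = 1"
      using q[OF one one x] p by (simp add: V1 G_simps xS field_simps del: One_nat_def)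
    have W2: "G x (V 1 x) (W i x) = - \<phi> i x" "G x (W i x) (V 1 x) = - \<phi> i x" if "i \<in> {1..DIM('e)}" "i \<noteq> 1" for i
      using q[OF one that(1) x] q[OF that(1) one x] p that(2) by (simp_all add: V1 G_simps xS field_simps del: One_nat_def)
    fix i j assume ij: "i \<in> {1..DIM('e)}" "j \<in> {1..DIM('e)}"
    show "G x (V i x) (V j x) = (if i = j then 1 else 0)"
      using W1 W2[OF ij(1)] W2[OF ij(2)] q[OF ij x]
      by (cases "i = 1"; cases "j = 1") (simp_all add: Vi[of i] Vi[of j] G_simps xS del: One_nat_def)
  qed
  have horo: "horospheric_on (ball x0 r) V"
    unfolding horospheric_on_def
  proof (intro ballI allI conjI)
    fix x u assume x: "x \<in> ball x0 r"
    note xS = rS[OF x] and p = r(3)[OF x]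
    have p0: "\<phi> 1 x \<noteq> 0" using p by simp
    have dinv: "((\<lambda>x. inverse (\<phi> 1 x)) has_derivative (\<lambda>u. - (inverse (\<phi> 1 x) * G x (W 1 x) u * inverse (\<phi> 1 x)))) (at x)"
      by (rule Deriv.has_derivative_inverse[OF p0 d\<phi>[OF rs[OF x]]])
    have dV1: "(V 1 has_derivative (\<lambda>u. - (inverse (\<phi> 1 x) *\<^sub>R (\<phi> 1 x *\<^sub>R u - \<Gamma> x u (W 1 x))
        + (- (inverse (\<phi> 1 x) * G x (W 1 x) u * inverse (\<phi> 1 x))) *\<^sub>R W 1 x))) (at x)"
      unfolding V1[abs_def] by (intro has_derivative_minus has_derivative_scaleR dinv dW[OF rs[OF x]])
    show n1: "nabla (V 1) x u = G x u (V 1 x) *\<^sub>R V 1 x - u" for u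
      unfolding nabla_eqI[OF dV1] using p0
      by (simp add: V1 G_simps \<Gamma>_simps xS sym[OF xS, of u] algebra_simps del: One_nat_def)
    fix i assume "i \<in> {2..DIM('e)}"
    then have i1: "i \<noteq> 1" by auto
    have dVi: "(V i has_derivative (\<lambda>u. (\<phi> i x *\<^sub>R u - \<Gamma> x u (W i x)) +
       (\<phi> i x *\<^sub>R FD (V 1) x u + G x (W i x) u *\<^sub>R V 1 x))) (at x)"
      unfolding Vi[OF i1, abs_def] by (intro has_derivative_add has_derivative_scaleR dW d\<phi> rs[OF x]
          smooth_on_has_derivative[OF smV1 x])
    have "nabla (V i) x u = \<phi> i x *\<^sub>R u + \<phi> i x *\<^sub>R nabla (V 1) x u + G x (W i x) u *\<^sub>R V 1 x"
      unfolding nabla_eqI[OF dVi] by (simp add: nabla_def Vi[OF i1] \<Gamma>_simps xS algebra_simps del: One_nat_def)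
    also have "\<dots> = G x u (V i x) *\<^sub>R V 1 x"
      unfolding n1 by (simp add: Vi[OF i1] G_simps xS sym[OF xS, of u "W i x"] algebra_simps del: One_nat_def)
    finally show "nabla (V i) x u = G x u (V i x) *\<^sub>R V 1 x" .
  qed
  have V0: "V i x0 = b i" for i
    by (simp add: V_def init W0_def \<phi>0_def)
  show ?thesis
    by (intro exI[of _ r] exI[of _ V] conjI) (use r s ortho horo V0 smV in auto)
qed

lemma nabla_along_cong:
  assumes "open T" "x \<in> T" "\<And>y. y \<in> T \<Longrightarrow> W y = W' y"
  shows "nabla_along \<tau> W x u = nabla_along \<tau> W' x u"
  using frechet_derivative_cong_open[OF assms] assms(3)[OF assms(2)] by (simp add: nabla_along_def)

lemma nabla_cong:
  assumes "open T" "x \<in> T" "\<And>y. y \<in> T \<Longrightarrow> W y = W' y"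
  shows "nabla W x u = nabla W' x u"
  using frechet_derivative_cong_open[OF assms] assms(3)[OF assms(2)] by (simp add: nabla_def)

lemma nabla_along_compose:
  assumes "(\<tau> has_derivative \<tau>') (at x)" "W differentiable at (\<tau> x)"
  shows "nabla_along \<tau> (\<lambda>y. W (\<tau> y)) x u = nabla W (\<tau> x) (\<tau>' u)"
proof -
  have "((\<lambda>y. W (\<tau> y)) has_derivative (\<lambda>u. FD W (\<tau> x) (\<tau>' u))) (at x)"
    using has_derivative_compose[OF assms(1)] assms(2) frechet_derivative_works by blast
  then show ?thesis
    by (simp add: nabla_along_def nabla_def frechet_derivative_at[symmetric] frechet_derivative_at[OF assms(1), symmetric])
qed

lemma R_cmul1: "x \<in> S \<Longrightarrow> R x (c *\<^sub>R u) w z = c *\<^sub>R R x u w z"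
  by (simp add: R_def \<Gamma>_simps linear_cmul[OF D\<Gamma>_linear] bilinear_lmul[OF D\<Gamma>_bilinear] algebra_simps)

section \<open>Sectional curvature in a chart\<close>

definition area2 :: "'e \<Rightarrow> 'e \<Rightarrow> 'e \<Rightarrow> real" where
  "area2 x u w = G x u u * G x w w - (G x u w)\<^sup>2"

text \<open>Strict Cauchy-Schwarz: the vector \<open>z\<close> is \<open>G x w w\<close> times the
  component of \<open>u\<close> orthogonal to \<open>w\<close>, and its squared length is
  \<open>G x w w\<close> times the Gram determinant.\<close>

lemma area2_nonzero:
  assumes x: "x \<in> S" and ind: "\<And>a b. a *\<^sub>R u + b *\<^sub>R w = 0 \<Longrightarrow> a = 0 \<and> b = 0"
  shows "area2 x u w \<noteq> 0"
proof -
  have "w \<noteq> 0" using ind[of 0 1] by auto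
  then have w: "G x w w > 0" by (rule pos[OF x])
  define z where "z = G x w w *\<^sub>R u + (- G x u w) *\<^sub>R w"
  have "z \<noteq> 0" using ind[of "G x w w" "- G x u w"] w by (auto simp: z_def)
  then have "G x z z > 0" by (rule pos[OF x])
  moreover have "G x z z = G x w w * area2 x u w"
    unfolding z_def area2_def using sym[OF x, of w u]
    by (simp add: G_simps x power2_eq_square algebra_simps)
  ultimately show ?thesis by auto
qed

text \<open>The sectional curvature is prescribed only on independent pairs. For dependent pairs
  both sides of the required identity vanish, by antisymmetry and homogeneity of
  \<open>R\<close>.\<close>

lemma hyperbolic_atI_sectional:
  assumes x: "x \<in> S"
    and sec: "\<And>u w. (\<And>a b. a *\<^sub>R u + b *\<^sub>R w = 0 \<Longrightarrow> a = 0 \<and> b = 0) \<Longrightarrow>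
      G x (R x u w w) u / area2 x u w = - 1"
  shows "hyperbolic_at x"
proof (rule hyperbolic_atI[OF x])
  fix u w
  show "G x (R x u w w) u = (G x u w)\<^sup>2 - G x u u * G x w w"
  proof (cases "\<forall>a b. a *\<^sub>R u + b *\<^sub>R w = 0 \<longrightarrow> a = 0 \<and> b = 0")
    case True
    then have "G x (R x u w w) u / area2 x u w = - 1" by (intro sec) auto
    moreover have "area2 x u w \<noteq> 0" by (rule area2_nonzero[OF x]) (use True in auto)
    ultimately show ?thesis by (simp add: field_simps area2_def)
  next
    case False
    then obtain a b where ab: "a *\<^sub>R u + b *\<^sub>R w = 0" "a \<noteq> 0 \<or> b \<noteq> 0" by blast
    have uu: "R x v v z = 0" for v z by (simp add: R_def)
    have "(\<exists>k. u = k *\<^sub>R w) \<or> (\<exists>k. w = k *\<^sub>R u)"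
    proof (cases "a = 0")
      case False
      then have "u = (- b / a) *\<^sub>R w"
        using arg_cong[OF ab(1), of "\<lambda>v. (1 / a) *\<^sub>R v"]
        by (simp add: scaleR_add_right eq_neg_iff_add_eq_0)
      then show ?thesis by blast
    qed (use ab in auto)
    then show ?thesis
    proof (elim disjE exE)
      fix k assume "u = k *\<^sub>R w"
      then show ?thesis using uu by (simp add: R_cmul1 G_simps x power2_eq_square)
    next
      fix k assume w: "w = k *\<^sub>R u"
      have "R x u (k *\<^sub>R u) z = 0" for z
        using R_antisym[of x u "k *\<^sub>R u" z] uu by (simp add: R_cmul1 x)
      then show ?thesis unfolding w by (simp add: G_simps x power2_eq_square)
    qed
  qed
qed

lemma sectional_of_hyperbolic_at:
  assumes x: "x \<in> S" and "hyperbolic_at x" and ind: "\<And>a b. a *\<^sub>R u + b *\<^sub>R w = 0 \<Longrightarrow> a = 0 \<and> b = 0"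
  shows "G x (R x u w w) u / area2 x u w = - 1"
proof -
  have "G x (R x u w w) u = - area2 x u w"
    using assms(2) sym[OF x, of w u] by (simp add: hyperbolic_at_def area2_def G_simps x power2_eq_square)
  then show ?thesis using area2_nonzero[OF x ind] by simp
qed

text \<open>The inner products of the frame are constant, so their derivatives vanish. This is the
  antisymmetry of the connection forms.\<close>

lemma nabla_orthonormal:
  assumes T: "open T" "x \<in> T" "T \<subseteq> S" and ij: "i \<in> {1..DIM('e)}" "j \<in> {1..DIM('e)}"
    and V: "\<And>i. i \<in> {1..DIM('e)} \<Longrightarrow> smooth_on T (V i)"
    and o: "\<And>x. x \<in> T \<Longrightarrow> orthonormal_at x (\<lambda>i. V i x)"
  shows "G x (nabla (V i) x u) (V j x) + G x (V i x) (nabla (V j) x u) = 0"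
proof -
  have x: "x \<in> S" using T by auto
  have a: "((\<lambda>y. G y (V i y) (V j y)) has_derivative
    (\<lambda>u. G x (nabla (V i) x u) (V j x) + G x (V i x) (nabla (V j) x u))) (at x)"
    by (rule metric_product_rule_nabla[OF x smooth_on_differentiable[OF V T(2)] smooth_on_differentiable[OF V T(2)]])
      (use ij in auto)
  have b: "((\<lambda>y. G y (V i y) (V j y)) has_derivative (\<lambda>u. 0)) (at x)"
    by (rule has_derivative_transform_within_open[OF has_derivative_const T(1,2)])
      (use o ij in \<open>simp add: orthonormal_at_def\<close>)
  show ?thesis using fun_cong[OF has_derivative_unique[OF a b], of u] .
qed

text \<open>The covariant derivatives are expanded in the frame. The assumptions give the components
  for distinct indices except those of \<open>V i\<close> along \<open>V 1\<close>; antisymmetry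
  supplies these and makes the diagonal ones vanish.\<close>

lemma horospheric_onI:
  assumes T: "open T" "T \<subseteq> S"
    and V: "\<And>i. i \<in> {1..DIM('e)} \<Longrightarrow> smooth_on T (V i)"
    and o: "\<And>x. x \<in> T \<Longrightarrow> orthonormal_at x (\<lambda>i. V i x)"
    and e1: "\<And>x u i. x \<in> T \<Longrightarrow> i \<in> {2..DIM('e)} \<Longrightarrow> G x (nabla (V 1) x u) (V i x) = - G x u (V i x)"
    and e2: "\<And>x u i j. x \<in> T \<Longrightarrow> i \<in> {2..DIM('e)} \<Longrightarrow> j \<in> {2..DIM('e)} \<Longrightarrow> i \<noteq> j \<Longrightarrow>
      G x (nabla (V i) x u) (V j x) = 0"
  shows "horospheric_on T V"
  unfolding horospheric_on_def
proof (intro ballI allI conjI)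
  fix x u assume xT: "x \<in> T"
  have x: "x \<in> S" using T xT by auto
  note one = one_le_DIM[where 'a = 'e]
  have split: "{1..DIM('e)} = insert 1 {2..DIM('e)}" using DIM_positive[where 'a = 'e] by auto
  have sub: "i \<in> {1..DIM('e)}" if "i \<in> {2..DIM('e)}" for i using that by auto
  have self: "G x (nabla (V i) x u) (V i x) = 0" if "i \<in> {1..DIM('e)}" for i
    using nabla_orthonormal[OF T(1) xT T(2) that that V o, of u] sym[OF x, of "V i x"] by simp
  have expand: "z = G x z (V 1 x) *\<^sub>R V 1 x + (\<Sum>i\<in>{2..DIM('e)}. G x z (V i x) *\<^sub>R V i x)" for z
    by (rule trans[OF orthonormal_at_expand[OF x o[OF xT]]]) (subst split, simp)
  have "nabla (V 1) x u = (\<Sum>i\<in>{2..DIM('e)}. - (G x u (V i x) *\<^sub>R V i x))"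
    using expand[of "nabla (V 1) x u"] self[OF one] e1[OF xT] by simp
  moreover have "(\<Sum>i\<in>{2..DIM('e)}. G x u (V i x) *\<^sub>R V i x) = u - G x u (V 1 x) *\<^sub>R V 1 x"
    using expand[of u] by (metis add_diff_cancel_left')
  ultimately show "nabla (V 1) x u = G x u (V 1 x) *\<^sub>R V 1 x - u"
    by (simp add: sum_negf)
  fix i assume i: "i \<in> {2..DIM('e)}"
  have "G x (nabla (V i) x u) (V j x) = 0" if "j \<in> {2..DIM('e)}" for j
    using e2[OF xT i that] self[OF sub[OF i]] by (cases "i = j") auto
  moreover have "G x (nabla (V i) x u) (V 1 x) = G x u (V i x)"
    using nabla_orthonormal[OF T(1) xT T(2) sub[OF i] one V o, of u] e1[OF xT i, of u] sym[OF x, of "V i x"] by simp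
  ultimately show "nabla (V i) x u = G x u (V i x) *\<^sub>R V 1 x"
    using expand[of "nabla (V i) x u"] by simp
qed

end

section \<open>Charts\<close>

lemma is_chartD:
  assumes "is_chart M c"
  shows "openin M (fst c)" "open (snd c ` fst c)" "inj_on (snd c) (fst c)"
    "\<And>U. openin M U \<Longrightarrow> open (snd c ` (U \<inter> fst c))"
    "\<And>T. open T \<Longrightarrow> openin M (fst c \<inter> snd c -` T)"
proof -
  show o: "openin M (fst c)" "open (snd c ` fst c)" using assms by (auto simp: is_chart_def)
  have ts: "topspace (subtopology M (fst c)) = fst c"
    using o(1) openin_subset by fastforce
  have h: "homeomorphic_map (subtopology M (fst c)) (top_of_set (snd c ` fst c)) (snd c)"
    using assms by (simp add: is_chart_def)
  show "inj_on (snd c) (fst c)"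
    using homeomorphic_imp_injective_map[OF h] ts by simp
  show "open (snd c ` (U \<inter> fst c))" if U: "openin M U" for U
  proof -
    have "openin (subtopology M (fst c)) (U \<inter> fst c)"
      using U by (auto simp: openin_subtopology)
    then have "openin (top_of_set (snd c ` fst c)) (snd c ` (U \<inter> fst c))"
      using homeomorphic_imp_open_map[OF h] by (simp add: open_map_def)
    then show ?thesis using o(2) openin_open_trans by blast
  qed
  show "openin M (fst c \<inter> snd c -` T)" if T: "open T" for T
  proof -
    have "openin (top_of_set (snd c ` fst c)) (snd c ` fst c \<inter> T)"
      using T by auto
    then have "openin (subtopology M (fst c)) {p \<in> fst c. snd c p \<in> snd c ` fst c \<inter> T}"
      using homeomorphic_imp_continuous_map[OF h] ts unfolding continuous_map_def by fastforce
    then have "openin M {p \<in> fst c. snd c p \<in> snd c ` fst c \<inter> T}"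
      using o(1) openin_trans_full by blast
    moreover have "{p \<in> fst c. snd c p \<in> snd c ` fst c \<inter> T} = fst c \<inter> snd c -` T" by auto
    ultimately show ?thesis by simp
  qed
qed

locale riemannian_mfd =
  fixes M :: "'m topology" and A :: "('m, 'e::euclidean_space) chart set" and g :: "('m, 'e) metric"
  assumes riem: "riemannian_manifold M A g"
begin

abbreviation codom :: "('m, 'e) chart \<Rightarrow> 'e set" where
  "codom c \<equiv> snd c ` fst c"

abbreviation G :: "('m, 'e) chart \<Rightarrow> 'e \<Rightarrow> 'e \<Rightarrow> 'e \<Rightarrow> real" where
  "G \<equiv> local_metric A g"

lemma manifold: "smooth_manifold M A"
  using riem by (simp add: riemannian_manifold_def)

lemma chart: "c \<in> A \<Longrightarrow> is_chart M c"
  using manifold by (simp add: smooth_manifold_def)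

lemma covered: "p \<in> topspace M \<Longrightarrow> \<exists>c\<in>A. p \<in> fst c"
  using manifold unfolding smooth_manifold_def by (metis UN_E)

lemma transition_smooth:
  "c \<in> A \<Longrightarrow> d \<in> A \<Longrightarrow> smooth_on (snd c ` (fst c \<inter> fst d)) (snd d \<circ> chart_inv c)"
  using manifold by (simp add: smooth_manifold_def)

lemma chart_inv_coord: "c \<in> A \<Longrightarrow> p \<in> fst c \<Longrightarrow> chart_inv c (snd c p) = p"
  unfolding chart_inv_def using is_chartD(3)[OF chart] by (simp add: inv_into_f_f)

lemma coord_chart_inv: "x \<in> snd c ` B \<Longrightarrow> B \<subseteq> fst c \<Longrightarrow> snd c (chart_inv c x) = x"
  unfolding chart_inv_def by (rule f_inv_into_f) blast

lemma chart_inv_in: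
  assumes "c \<in> A" "x \<in> snd c ` B" "B \<subseteq> fst c" shows "chart_inv c x \<in> B"
proof -
  obtain p where "p \<in> B" "x = snd c p" using assms(2) by blast
  then show ?thesis using chart_inv_coord[OF assms(1), of p] assms(3) by auto
qed

lemma domain:
  assumes "c \<in> A" shows "riemannian_domain (codom c) (G c)"
  using bspec[OF conjunct2[OF riem[unfolded riemannian_manifold_def]] assms] is_chartD(2)[OF chart[OF assms]]
  by (intro riemannian_domain.intro) auto

lemma christoffel_eq: "christoffel A g c = riemannian_domain.\<Gamma> (G c)"
  if "c \<in> A"
  unfolding christoffel_def riemannian_domain.\<Gamma>_def[OF domain[OF that]]
    riemannian_domain.is_levi_civita_def[OF domain[OF that], abs_def] ..

section \<open>Transition maps and their Jacobians\<close>

definition overlap :: "('m, 'e) chart \<Rightarrow> ('m, 'e) chart \<Rightarrow> 'e set" where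
  "overlap c d = snd c ` (fst c \<inter> fst d)"

definition trans_map :: "('m, 'e) chart \<Rightarrow> ('m, 'e) chart \<Rightarrow> 'e \<Rightarrow> 'e" where
  "trans_map c d x = snd d (chart_inv c x)"

definition jac :: "('m, 'e) chart \<Rightarrow> ('m, 'e) chart \<Rightarrow> 'e \<Rightarrow> 'e \<Rightarrow> 'e" where
  "jac c d x = FD (trans_map c d) x"

lemma overlap_open: "c \<in> A \<Longrightarrow> d \<in> A \<Longrightarrow> open (overlap c d)"
  unfolding overlap_def using is_chartD(4)[OF chart is_chartD(1)[OF chart], of c d] by (simp add: Int_commute)

lemma overlapI: "p \<in> fst c \<Longrightarrow> p \<in> fst d \<Longrightarrow> snd c p \<in> overlap c d"
  by (simp add: overlap_def)

lemma overlap_subset: "overlap c d \<subseteq> codom c"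
  by (auto simp: overlap_def)

lemma overlap_chart_inv:
  assumes "c \<in> A" "x \<in> overlap c d"
  shows "chart_inv c x \<in> fst c" "chart_inv c x \<in> fst d" "snd c (chart_inv c x) = x"
  using chart_inv_in[OF assms(1), of x "fst c \<inter> fst d"] coord_chart_inv[of x c "fst c \<inter> fst d"] assms(2)
  by (auto simp: overlap_def)

lemma trans_map_smooth: "c \<in> A \<Longrightarrow> d \<in> A \<Longrightarrow> smooth_on (overlap c d) (trans_map c d)"
  using transition_smooth[of c d] by (simp add: overlap_def trans_map_def[abs_def] comp_def)

lemma trans_map_in: "c \<in> A \<Longrightarrow> x \<in> overlap c d \<Longrightarrow> trans_map c d x \<in> overlap d c"
  using overlap_chart_inv[of c x d] by (auto simp: overlap_def trans_map_def)

lemma trans_map_coord: "c \<in> A \<Longrightarrow> p \<in> fst c \<Longrightarrow> trans_map c d (snd c p) = snd d p"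
  by (simp add: trans_map_def chart_inv_coord)

lemma transition_deriv_jac: "transition_deriv c d p = jac c d (snd c p)"
  by (simp add: transition_deriv_def jac_def trans_map_def[abs_def] comp_def)

lemma jac_has_derivative:
  "c \<in> A \<Longrightarrow> d \<in> A \<Longrightarrow> x \<in> overlap c d \<Longrightarrow> (trans_map c d has_derivative jac c d x) (at x)"
  unfolding jac_def by (rule smooth_on_has_derivative[OF trans_map_smooth])

lemma jac_linear: "c \<in> A \<Longrightarrow> d \<in> A \<Longrightarrow> x \<in> overlap c d \<Longrightarrow> linear (jac c d x)"
  using jac_has_derivative has_derivative_linear by blast

lemma jac_smooth: "c \<in> A \<Longrightarrow> d \<in> A \<Longrightarrow> smooth_on (overlap c d) (\<lambda>x. jac c d x u)"
  unfolding jac_def by (rule smooth_on_frechet_derivative[OF trans_map_smooth])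

text \<open>The chain rule; the transition maps compose correctly only on the triple overlap, whose
  coordinate image is open. This is what makes \<open>coord_vec\<close> a tangent vector.\<close>

lemma jac_cocycle:
  assumes A: "c \<in> A" "d \<in> A" "e \<in> A" and p: "p \<in> fst c" "p \<in> fst d" "p \<in> fst e"
  shows "jac d e (snd d p) (jac c d (snd c p) u) = jac c e (snd c p) u"
proof -
  let ?T = "snd c ` (fst d \<inter> fst e \<inter> fst c)"
  have "openin M (fst d \<inter> fst e)" by (intro openin_Int is_chartD(1)[OF chart] A)
  then have o: "open ?T" by (rule is_chartD(4)[OF chart[OF A(1)]])
  have x: "snd c p \<in> ?T" using p by auto
  have "(trans_map d e has_derivative jac d e (snd d p)) (at (trans_map c d (snd c p)))"
    using jac_has_derivative[OF A(2,3) overlapI[OF p(2,3)]] trans_map_coord[OF A(1) p(1)] by simp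
  from has_derivative_compose[OF jac_has_derivative[OF A(1,2) overlapI[OF p(1,2)]] this]
  have "(trans_map c e has_derivative (\<lambda>u. jac d e (snd d p) (jac c d (snd c p) u))) (at (snd c p))"
    by (rule has_derivative_transform_within_open[OF _ o x])
      (auto simp: trans_map_def chart_inv_coord[OF A(1)] chart_inv_coord[OF A(2)])
  then have "(\<lambda>u. jac d e (snd d p) (jac c d (snd c p) u)) = jac c e (snd c p)"
    by (rule has_derivative_unique[OF _ jac_has_derivative[OF A(1,3) overlapI[OF p(1,3)]]])
  then show ?thesis by metis
qed

lemma jac_self:
  assumes "c \<in> A" "p \<in> fst c" shows "jac c c (snd c p) u = u"
proof -
  have x: "snd c p \<in> overlap c c" using assms by (simp add: overlapI)
  have "(trans_map c c has_derivative (\<lambda>u. u)) (at (snd c p))"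
    by (rule has_derivative_transform_within_open[OF has_derivative_ident overlap_open[OF assms(1,1)] x])
      (use overlap_chart_inv[OF assms(1)] in \<open>simp add: trans_map_def\<close>)
  then show ?thesis using has_derivative_unique jac_has_derivative[OF assms(1,1) x] by metis
qed

lemma jac_inverse:
  assumes "c \<in> A" "d \<in> A" "x \<in> overlap c d"
  shows "jac d c (trans_map c d x) (jac c d x u) = u" "jac c d x (jac d c (trans_map c d x) u) = u"
proof -
  let ?p = "chart_inv c x"
  have p: "?p \<in> fst c" "?p \<in> fst d" "snd c ?p = x" using overlap_chart_inv[OF assms(1,3)] .
  show "jac d c (trans_map c d x) (jac c d x u) = u" "jac c d x (jac d c (trans_map c d x) u) = u"
    using jac_cocycle[OF assms(1,2,1) p(1,2,1), of u] jac_cocycle[OF assms(2,1,2) p(2,1,2), of u]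
      jac_self[OF assms(1) p(1), of u] jac_self[OF assms(2) p(2), of u]
    by (simp_all add: p(3) trans_map_def)
qed

subsection \<open>Tangent vectors in charts\<close>

lemma tangent_jac:
  "X \<in> tangent_space A p \<Longrightarrow> c \<in> A \<Longrightarrow> d \<in> A \<Longrightarrow> p \<in> fst c \<Longrightarrow> p \<in> fst d \<Longrightarrow> X d = jac c d (snd c p) (X c)"
  unfolding tangent_space_def transition_deriv_jac by blast

lemma tangent_outside: "X \<in> tangent_space A p \<Longrightarrow> \<not> (c \<in> A \<and> p \<in> fst c) \<Longrightarrow> X c = 0"
  unfolding tangent_space_def by blast

lemma tangentI:
  assumes "\<And>c d. c \<in> A \<Longrightarrow> d \<in> A \<Longrightarrow> p \<in> fst c \<Longrightarrow> p \<in> fst d \<Longrightarrow> X d = jac c d (snd c p) (X c)"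
    and "\<And>c. \<not> (c \<in> A \<and> p \<in> fst c) \<Longrightarrow> X c = 0"
  shows "X \<in> tangent_space A p"
  unfolding tangent_space_def transition_deriv_jac using assms by blast

lemma coord_vec_tangent: "c \<in> A \<Longrightarrow> p \<in> fst c \<Longrightarrow> coord_vec A c p u \<in> tangent_space A p"
  by (rule tangentI) (auto simp: coord_vec_def transition_deriv_jac jac_cocycle)

lemma coord_vec_jac: "d \<in> A \<Longrightarrow> p \<in> fst d \<Longrightarrow> coord_vec A c p u d = jac c d (snd c p) u"
  by (simp add: coord_vec_def transition_deriv_jac)

lemma coord_vec_self: "c \<in> A \<Longrightarrow> p \<in> fst c \<Longrightarrow> coord_vec A c p u c = u"
  by (simp add: coord_vec_jac jac_self)

lemma tangent_eq_coord_vec: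
  assumes "X \<in> tangent_space A p" "c \<in> A" "p \<in> fst c"
  shows "coord_vec A c p (X c) = X"
proof
  fix d
  show "coord_vec A c p (X c) d = X d"
    using tangent_jac[OF assms(1,2) _ assms(3), of d] tangent_outside[OF assms(1), of d]
    by (cases "d \<in> A \<and> p \<in> fst d") (auto simp: coord_vec_def transition_deriv_jac)
qed

text \<open>The axioms on \<open>g\<close> speak of coordinate vectors only. A tangent vector equals
  the coordinate vector of its component as a function on all charts, so \<open>g\<close> can be
  computed in any chart around the point.\<close>

lemma metric_eq_local:
  "X \<in> tangent_space A p \<Longrightarrow> Y \<in> tangent_space A p \<Longrightarrow> c \<in> A \<Longrightarrow> p \<in> fst c \<Longrightarrow>
    g p X Y = G c (snd c p) (X c) (Y c)"
  by (simp add: local_metric_def chart_inv_coord tangent_eq_coord_vec)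

lemma local_metric_jac:
  assumes "c \<in> A" "d \<in> A" "x \<in> overlap c d"
  shows "G d (trans_map c d x) (jac c d x u) (jac c d x w) = G c x u w"
proof -
  let ?p = "chart_inv c x"
  have p: "?p \<in> fst c" "?p \<in> fst d" "snd c ?p = x" using overlap_chart_inv[OF assms(1,3)] .
  have "coord_vec A d ?p (jac c d x v) = coord_vec A c ?p v" for v
    using tangent_eq_coord_vec[OF coord_vec_tangent[OF assms(1) p(1), of v] assms(2) p(2)]
    by (simp add: coord_vec_jac[OF assms(2) p(2)] p(3))
  then show ?thesis by (simp add: local_metric_def trans_map_def chart_inv_coord[OF assms(2) p(2)])
qed

subsection \<open>Tensoriality\<close>

text \<open>By uniqueness: the connection of chart \<open>d\<close>, pulled back by the transition
  map, is symmetric and compatible with the metric of chart \<open>c\<close>, hence it is the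
  Levi-Civita connection there.\<close>

lemma christoffel_jac:
  assumes A: "c \<in> A" "d \<in> A" and x: "x \<in> overlap c d"
  shows "FD (\<lambda>y. jac c d y w) x u
     + riemannian_domain.\<Gamma> (G d) (trans_map c d x) (jac c d x u) (jac c d x w)
    = jac c d x (riemannian_domain.\<Gamma> (G c) x u w)"
proof -
  interpret C: riemannian_domain "codom c" "G c" by (rule domain[OF A(1)])
  interpret D: riemannian_domain "codom d" "G d" by (rule domain[OF A(2)])
  let ?\<tau> = "trans_map c d" and ?T = "jac c d x" and ?T' = "jac d c (trans_map c d x)"
  define J where "J w = FD (\<lambda>y. jac c d y w) x" for w
  \<comment> \<open>\<open>H\<close> is the pulled back connection before the inverse Jacobian is
    applied. Its symmetry combines that of the Christoffel symbols with that of the second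
    derivative of the transition map.\<close>
  define H where "H u w = J w u + D.\<Gamma> (?\<tau> x) (?T u) (?T w)" for u w
  have xc: "x \<in> codom c" and \<tau>x: "?\<tau> x \<in> codom d"
    using x overlap_subset trans_map_in[OF A(1) x] by blast+
  have J: "((\<lambda>y. jac c d y w) has_derivative J w) (at x)" for w
    unfolding J_def by (rule smooth_on_has_derivative[OF jac_smooth[OF A] x])
  have J_sym: "J w u = J u w" for u w
    unfolding J_def jac_def by (rule smooth_on_symmetric_second_derivative[OF overlap_open[OF A] x trans_map_smooth[OF A]])
  have J_lin: "linear (J w)" for w using J has_derivative_linear by blast
  have lT: "linear ?T" and lT': "linear ?T'"
    using jac_linear[OF A x] jac_linear[OF A(2,1) trans_map_in[OF A(1) x]] .
  note T_simps = linear_add[OF lT] linear_cmul[OF lT] linear_add[OF lT'] linear_cmul[OF lT']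
    linear_add[OF J_lin] linear_cmul[OF J_lin] D.\<Gamma>_simps \<tau>x
  have H_sym: "H u w = H w u" for u w
    using J_sym[of w u] D.\<Gamma>_sym[OF \<tau>x, of "?T u" "?T w"] by (simp add: H_def)
  have H_eq: "H u w = J u w + D.\<Gamma> (?\<tau> x) (?T u) (?T w)" for u w
    by (simp add: H_def J_sym[of w u])
  have H1: "linear (H u)" for u
    by (rule linearI) (simp_all add: H_eq T_simps algebra_simps)
  have "C.is_levi_civita x (\<lambda>u w. ?T' (H u w))"
    unfolding C.is_levi_civita_def
  proof (intro conjI allI)
    have "linear (\<lambda>w. ?T' (H u w))" for u
      using linear_compose[OF H1 lT'] by (simp add: comp_def)
    then show "bilinear (\<lambda>u w. ?T' (H u w))"
      unfolding bilinear_def using H_sym by simp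
    show "?T' (H u w) = ?T' (H w u)" for u w using H_sym by simp
    fix z u w
    \<comment> \<open>Compatibility with the metric comes from differentiating
      \<open>local_metric_jac\<close>, which says that the transition map is an isometry.\<close>
    have 1: "((\<lambda>y. G d (?\<tau> y) (jac c d y u) (jac c d y w)) has_derivative
       (\<lambda>h. D.DG (?\<tau> x) (?T u) (?T w) (?T h) + G d (?\<tau> x) (J u h) (?T w)
          + G d (?\<tau> x) (?T u) (J w h))) (at x)"
      by (rule has_derivative_bilinear_apply[OF overlap_open[OF A] x, where \<Phi> = "\<lambda>y. G d (?\<tau> y)"
            and D = "\<lambda>u w h. D.DG (?\<tau> x) u w (?T h)", OF D.bil
            has_derivative_compose[OF jac_has_derivative[OF A x] D.DG_has_derivative[OF \<tau>x]] J J])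
        (use trans_map_in[OF A(1)] overlap_subset in blast)
    have "((\<lambda>y. G c y u w) has_derivative
       (\<lambda>h. D.DG (?\<tau> x) (?T u) (?T w) (?T h) + G d (?\<tau> x) (J u h) (?T w)
          + G d (?\<tau> x) (?T u) (J w h))) (at x)"
      by (rule has_derivative_transform_within_open[OF 1 overlap_open[OF A] x local_metric_jac[OF A]])
    then have "FD (\<lambda>y. G c y u w) x z =
        G d (?\<tau> x) (H z u) (?T w) + G d (?\<tau> x) (?T u) (H z w)"
      by (simp add: frechet_derivative_at[symmetric] D.DG_eq \<tau>x H_def D.G_simps)
    also have "\<dots> = G d (?\<tau> x) (?T (?T' (H z u))) (?T w)
        + G d (?\<tau> x) (?T u) (?T (?T' (H z w)))"
      by (simp add: jac_inverse(2)[OF A x])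
    finally show "FD (\<lambda>y. G c y u w) x z =
        G c x (?T' (H z u)) w + G c x u (?T' (H z w))"
      unfolding local_metric_jac[OF A x] .
  qed
  then have "C.\<Gamma> x u w = ?T' (H u w)" by (simp add: C.\<Gamma>_eqI[OF xc])
  then have "?T (C.\<Gamma> x u w) = H u w" by (simp add: jac_inverse(2)[OF A x])
  then show ?thesis by (simp add: H_def J_def)
qed

text \<open>The covariant derivative is natural: differentiating the Jacobian produces just the
  inhomogeneous term in the transformation law of the Christoffel symbols.\<close>

lemma nabla_along_jac:
  assumes A: "c \<in> A" "d \<in> A" and x: "x \<in> overlap c d" and V: "V differentiable at x"
  shows "riemannian_domain.nabla_along (G d) (trans_map c d) (\<lambda>y. jac c d y (V y)) x u
    = jac c d x (riemannian_domain.nabla (G c) V x u)"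
proof -
  interpret C: riemannian_domain "codom c" "G c" by (rule domain[OF A(1)])
  interpret D: riemannian_domain "codom d" "G d" by (rule domain[OF A(2)])
  have 1: "((\<lambda>y. jac c d y (V y)) has_derivative
     (\<lambda>u. FD (\<lambda>y. jac c d y (V x)) x u + jac c d x (FD V x u))) (at x)"
    using V unfolding frechet_derivative_works
    by (intro has_derivative_linear_apply[OF overlap_open[OF A] x] jac_linear[OF A]
        smooth_on_has_derivative[OF jac_smooth[OF A] x])
  show ?thesis
    unfolding D.nabla_along_def C.nabla_def frechet_derivative_at[OF 1, symmetric] jac_def[symmetric]
    using christoffel_jac[OF A x, of "V x" u] by (simp add: linear_add[OF jac_linear[OF A x]])
qed

text \<open>The commutator formula is applied to the image of the constant field \<open>z\<close>
  under the Jacobian, a field along the transition map. Two uses of naturality evaluate its second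
  covariant derivatives in chart \<open>c\<close>.\<close>

lemma R_jac:
  assumes A: "c \<in> A" "d \<in> A" and x: "x \<in> overlap c d"
  shows "riemannian_domain.R (G d) (trans_map c d x) (jac c d x u) (jac c d x w) (jac c d x z)
    = jac c d x (riemannian_domain.R (G c) x u w z)"
proof -
  interpret C: riemannian_domain "codom c" "G c" by (rule domain[OF A(1)])
  interpret D: riemannian_domain "codom d" "G d" by (rule domain[OF A(2)])
  let ?\<tau> = "trans_map c d"
  have xc: "x \<in> codom c" using x overlap_subset by blast
  have img: "?\<tau> ` overlap c d \<subseteq> codom d"
    using trans_map_in[OF A(1)] overlap_subset by blast
  have 1: "D.nabla_along ?\<tau> (\<lambda>y. jac c d y z) y w = jac c d y (C.\<Gamma> y w z)" if "y \<in> overlap c d" for y w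
    using nabla_along_jac[OF A that, of "\<lambda>y. z"] by (simp add: C.nabla_def)
  have 2: "D.nabla_along ?\<tau> (\<lambda>y. D.nabla_along ?\<tau> (\<lambda>y. jac c d y z) y w) x u
     = jac c d x (C.D\<Gamma> x w z u + C.\<Gamma> x u (C.\<Gamma> x w z))" for u w
  proof -
    have "D.nabla_along ?\<tau> (\<lambda>y. D.nabla_along ?\<tau> (\<lambda>y. jac c d y z) y w) x u
        = D.nabla_along ?\<tau> (\<lambda>y. jac c d y (C.\<Gamma> y w z)) x u"
      by (rule D.nabla_along_cong[OF overlap_open[OF A] x 1])
    also have "\<dots> = jac c d x (C.nabla (\<lambda>y. C.\<Gamma> y w z) x u)"
      by (rule nabla_along_jac[OF A x smooth_on_differentiable[OF C.\<Gamma>_smooth xc]])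
    finally show ?thesis by (simp add: C.nabla_eqI[OF C.D\<Gamma>_has_derivative[OF xc]])
  qed
  have "D.R (?\<tau> x) (jac c d x u) (jac c d x w) (jac c d x z) =
      jac c d x (C.D\<Gamma> x w z u + C.\<Gamma> x u (C.\<Gamma> x w z)) - jac c d x (C.D\<Gamma> x u z w + C.\<Gamma> x w (C.\<Gamma> x u z))"
    using D.R_along[OF overlap_open[OF A] x trans_map_smooth[OF A] img jac_smooth[OF A], of z w u]
    unfolding 2 jac_def[symmetric] by simp
  then show ?thesis
    by (simp add: C.R_def linear_diff[OF jac_linear[OF A x], symmetric] algebra_simps)
qed

lemma curvature_chart:
  assumes "c \<in> A" "p \<in> fst c"
  shows "curvature A g p X Y Z c = riemannian_domain.R (G c) (snd c p) (X c) (Y c) (Z c)"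
  using assms unfolding curvature_def Let_def riemannian_domain.R_def[OF domain[OF assms(1)]]
    riemannian_domain.D\<Gamma>_def[OF domain[OF assms(1)]] christoffel_eq[OF assms(1)] by simp

text \<open>\<open>sectional_curvature\<close> applies \<open>g\<close> to a curvature vector, and
  \<open>g\<close> is controlled only on tangent vectors. This is where tensoriality of
  \<open>R\<close> is needed.\<close>

lemma curvature_tangent:
  assumes "X \<in> tangent_space A p" "Y \<in> tangent_space A p" "Z \<in> tangent_space A p"
  shows "curvature A g p X Y Z \<in> tangent_space A p"
proof (rule tangentI)
  fix c d assume cd: "c \<in> A" "d \<in> A" "p \<in> fst c" "p \<in> fst d"
  show "curvature A g p X Y Z d = jac c d (snd c p) (curvature A g p X Y Z c)"
    using R_jac[OF cd(1,2) overlapI[OF cd(3,4)], of "X c" "Y c" "Z c"]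
      tangent_jac[OF assms(1) cd] tangent_jac[OF assms(2) cd] tangent_jac[OF assms(3) cd]
    by (simp add: curvature_chart cd trans_map_coord)
qed (auto simp: curvature_def)

lemma sectional_curvature_chart:
  assumes "X \<in> tangent_space A p" "Y \<in> tangent_space A p" "c \<in> A" "p \<in> fst c"
  shows "sectional_curvature A g p X Y =
    G c (snd c p) (riemannian_domain.R (G c) (snd c p) (X c) (Y c) (Y c)) (X c)
    / riemannian_domain.area2 (G c) (snd c p) (X c) (Y c)"
  using assms curvature_tangent[OF assms(1,2,2)]
  by (simp add: sectional_curvature_def metric_eq_local[OF _ _ assms(3,4)] curvature_chart
      riemannian_domain.area2_def[OF domain[OF assms(3)]])

text \<open>A linear relation between components in one chart is carried to all other charts around
  the point by linear Jacobians; at all other arguments both vectors are zero.\<close>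

lemma lin_indep2_chart:
  assumes "X \<in> tangent_space A p" "Y \<in> tangent_space A p" "c \<in> A" "p \<in> fst c"
  shows "lin_indep2 X Y \<longleftrightarrow> (\<forall>a b. a *\<^sub>R X c + b *\<^sub>R Y c = 0 \<longrightarrow> a = 0 \<and> b = 0)"
proof -
  have "(\<forall>d. a *\<^sub>R X d + b *\<^sub>R Y d = 0) \<longleftrightarrow> a *\<^sub>R X c + b *\<^sub>R Y c = 0" for a b
  proof
    assume 0: "a *\<^sub>R X c + b *\<^sub>R Y c = 0"
    show "\<forall>d. a *\<^sub>R X d + b *\<^sub>R Y d = 0"
    proof
      fix d
      show "a *\<^sub>R X d + b *\<^sub>R Y d = 0"
      proof (cases "d \<in> A \<and> p \<in> fst d")
        case True
        then have l: "linear (jac c d (snd c p))" using jac_linear assms(3,4) overlapI by blast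
        have "a *\<^sub>R X d + b *\<^sub>R Y d = jac c d (snd c p) (a *\<^sub>R X c + b *\<^sub>R Y c)"
          using tangent_jac[OF assms(1,3) _ assms(4)] tangent_jac[OF assms(2,3) _ assms(4)] True
          by (simp add: linear_add[OF l] linear_cmul[OF l])
        then show ?thesis using 0 linear_0[OF l] by simp
      qed (simp add: tangent_outside[OF assms(1)] tangent_outside[OF assms(2)])
    qed
  qed blast
  then show ?thesis by (simp add: lin_indep2_def)
qed

lemma hyperbolic_at_of_constant_curvature:
  assumes "constant_sectional_curvature M A g (-1)" and c: "c \<in> A" and x: "x \<in> codom c"
  shows "riemannian_domain.hyperbolic_at (G c) x"
proof -
  interpret C: riemannian_domain "codom c" "G c" by (rule domain[OF c])
  obtain p where p: "p \<in> fst c" "x = snd c p" using x by blast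
  have pM: "p \<in> topspace M" using is_chartD(1)[OF chart[OF c]] p(1) openin_subset by blast
  show ?thesis
  proof (rule C.hyperbolic_atI_sectional[OF x])
    fix u w :: 'e assume ind: "\<And>a b. a *\<^sub>R u + b *\<^sub>R w = 0 \<Longrightarrow> a = 0 \<and> b = 0"
    let ?X = "coord_vec A c p u" and ?Y = "coord_vec A c p w"
    have t: "?X \<in> tangent_space A p" "?Y \<in> tangent_space A p"
      by (rule coord_vec_tangent[OF c p(1)])+
    have "lin_indep2 ?X ?Y"
      unfolding lin_indep2_chart[OF t c p(1)] coord_vec_self[OF c p(1)] using ind by blast
    then have "sectional_curvature A g p ?X ?Y = - 1"
      using assms(1) pM t unfolding constant_sectional_curvature_def by blast
    then show "G c x (C.R x u w w) u / C.area2 x u w = - 1"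
      by (simp add: sectional_curvature_chart[OF t c p(1)] coord_vec_self[OF c p(1)] p(2))
  qed
qed

text \<open>One chart per point suffices, because the sectional curvature can be computed in any
  chart around the point.\<close>

lemma constant_curvatureI:
  assumes "\<And>p. p \<in> topspace M \<Longrightarrow>
    \<exists>c\<in>A. p \<in> fst c \<and> riemannian_domain.hyperbolic_at (G c) (snd c p)"
  shows "constant_sectional_curvature M A g (-1)"
  unfolding constant_sectional_curvature_def
proof (intro ballI impI)
  fix p X Y assume "p \<in> topspace M" and t: "X \<in> tangent_space A p" "Y \<in> tangent_space A p" and l: "lin_indep2 X Y"
  then obtain c where c: "c \<in> A" "p \<in> fst c"
    and h: "riemannian_domain.hyperbolic_at (G c) (snd c p)" using assms by blast
  interpret C: riemannian_domain "codom c" "G c" by (rule domain[OF c(1)])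
  have "snd c p \<in> codom c" using c by blast
  then show "sectional_curvature A g p X Y = - 1"
    unfolding sectional_curvature_chart[OF t c]
    by (rule C.sectional_of_hyperbolic_at[OF _ h]) (use l[unfolded lin_indep2_chart[OF t c]] in blast)
qed

subsection \<open>Vector fields in charts\<close>

definition field_rep :: "('m \<Rightarrow> ('m, 'e) tvec) \<Rightarrow> ('m, 'e) chart \<Rightarrow> 'e \<Rightarrow> 'e" where
  "field_rep V c x = V (chart_inv c x) c"

lemma field_rep_coord: "c \<in> A \<Longrightarrow> p \<in> fst c \<Longrightarrow> field_rep V c (snd c p) = V p c"
  by (simp add: field_rep_def chart_inv_coord)

lemma field_rep_smooth:
  "vector_field_on A U V \<Longrightarrow> c \<in> A \<Longrightarrow> smooth_on (snd c ` (U \<inter> fst c)) (field_rep V c)"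
  by (simp add: vector_field_on_def field_rep_def[abs_def])

lemma cov_deriv_chart:
  "c \<in> A \<Longrightarrow> p \<in> fst c \<Longrightarrow>
    cov_deriv A g V p X c = riemannian_domain.nabla (G c) (field_rep V c) (snd c p) (X c)"
  unfolding riemannian_domain.nabla_def[OF domain] cov_deriv_def
  by (simp add: chart_inv_coord christoffel_eq field_rep_def[abs_def])

text \<open>Near the point, the representative in \<open>d\<close> along the transition map is the
  Jacobian applied to the representative in \<open>c\<close>. Naturality of the covariant derivative
  then compares the two; openness of \<open>U\<close> makes the derivatives depend only on values in
  \<open>U\<close>.\<close>

lemma cov_deriv_tangent:
  assumes U: "openin M U" "vector_field_on A U V" "p \<in> U" and X: "X \<in> tangent_space A p"
  shows "cov_deriv A g V p X \<in> tangent_space A p"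
proof (rule tangentI)
  fix c d assume cd: "c \<in> A" "d \<in> A" "p \<in> fst c" "p \<in> fst d"
  interpret D: riemannian_domain "codom d" "G d" by (rule domain[OF cd(2)])
  let ?x = "snd c p" and ?\<tau> = "trans_map c d"
  have x: "?x \<in> overlap c d" by (rule overlapI[OF cd(3,4)])
  have dc: "field_rep V c differentiable at ?x" "field_rep V d differentiable at (?\<tau> ?x)"
    unfolding trans_map_coord[OF cd(1,3)]
    by (rule smooth_on_differentiable[OF field_rep_smooth[OF U(2)]]; use cd U(3) in blast)+
  have "openin M (U \<inter> fst d)" by (intro openin_Int U(1) is_chartD(1)[OF chart] cd)
  then have o: "open (snd c ` (U \<inter> fst d \<inter> fst c))" by (rule is_chartD(4)[OF chart[OF cd(1)]])
  have "D.nabla (field_rep V d) (?\<tau> ?x) (jac c d ?x (X c))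
      = D.nabla_along ?\<tau> (\<lambda>y. field_rep V d (?\<tau> y)) ?x (X c)"
    by (rule D.nabla_along_compose[OF jac_has_derivative[OF cd(1,2) x] dc(2), symmetric])
  also have "\<dots> = D.nabla_along ?\<tau> (\<lambda>y. jac c d y (field_rep V c y)) ?x (X c)"
  proof (rule D.nabla_along_cong[OF o])
    show "?x \<in> snd c ` (U \<inter> fst d \<inter> fst c)" using U(3) cd by blast
    fix y assume "y \<in> snd c ` (U \<inter> fst d \<inter> fst c)"
    then obtain q where q: "q \<in> U" "q \<in> fst d" "q \<in> fst c" "y = snd c q" by blast
    have "V q \<in> tangent_space A q" using U(2) q(1) by (simp add: vector_field_on_def)
    then show "field_rep V d (?\<tau> y) = jac c d y (field_rep V c y)"
      using tangent_jac[OF _ cd(1,2) q(3,2)] by (simp add: q trans_map_coord field_rep_coord cd)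
  qed
  also have "\<dots> = jac c d ?x (riemannian_domain.nabla (G c) (field_rep V c) ?x (X c))"
    by (rule nabla_along_jac[OF cd(1,2) x dc(1)])
  finally show "cov_deriv A g V p X d = jac c d ?x (cov_deriv A g V p X c)"
    using tangent_jac[OF X cd] by (simp add: cov_deriv_chart cd trans_map_coord)
qed (auto simp: cov_deriv_def)

lemma connection_form_chart:
  assumes "openin M U" "vector_field_on A U (v i)" "vector_field_on A U (v j)" "p \<in> U"
    and "X \<in> tangent_space A p" "c \<in> A" "p \<in> fst c"
  shows "connection_form A g v i j p X = G c (snd c p)
     (riemannian_domain.nabla (G c) (field_rep (v i) c) (snd c p) (X c))
     (field_rep (v j) c (snd c p))"
proof -
  have "v j p \<in> tangent_space A p" using assms(3,4) by (simp add: vector_field_on_def)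
  then show ?thesis
    unfolding connection_form_def
    using metric_eq_local[OF cov_deriv_tangent[OF assms(1,2,4,5)] _ assms(6,7)]
    by (simp add: cov_deriv_chart field_rep_coord assms)
qed

lemma orthonormal_basis_chart:
  assumes "orthonormal_basis_at A g p b" "c \<in> A" "p \<in> fst c"
  shows "riemannian_domain.orthonormal_at (G c) (snd c p) (\<lambda>i. b i c)"
  unfolding riemannian_domain.orthonormal_at_def[OF domain[OF assms(2)]]
proof (intro ballI)
  fix i j assume ij: "i \<in> {1..DIM('e)}" "j \<in> {1..DIM('e)}"
  then have "b i \<in> tangent_space A p" "b j \<in> tangent_space A p" "g p (b i) (b j) = (if i = j then 1 else 0)"
    using assms(1) unfolding orthonormal_basis_at_def by blast+
  then show "G c (snd c p) (b i c) (b j c) = (if i = j then 1 else 0)"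
    using metric_eq_local[OF _ _ assms(2,3)] by simp
qed

subsection \<open>The frame equations\<close>

context
  fixes U :: "'m set" and v :: "nat \<Rightarrow> 'm \<Rightarrow> ('m, 'e) tvec" and \<theta> :: "nat \<Rightarrow> ('m, 'e) form1"
  assumes U: "openin M U" and fr: "orthonormal_frame_on A g U v"
    and du: "dual_forms_on A U v \<theta>" and eq: "frame_equations_on A g U v \<theta>"
begin

lemma frame_field: "i \<in> {1..DIM('e)} \<Longrightarrow> vector_field_on A U (v i)"
  using fr by (simp add: orthonormal_frame_on_def)

lemma frame_basis: "p \<in> U \<Longrightarrow> orthonormal_basis_at A g p (\<lambda>i. v i p)"
  using fr by (simp add: orthonormal_frame_on_def)

text \<open>Duality prescribes the form on the frame, and linearity extends this to all tangent
  vectors, so the form must be the inner product with the frame vector.\<close>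

lemma dual_form_chart:
  assumes i: "i \<in> {1..DIM('e)}"
    and p: "p \<in> U" "c \<in> A" "p \<in> fst c" and X: "X \<in> tangent_space A p"
  shows "\<theta> i p X = G c (snd c p) (X c) (v i p c)"
proof -
  interpret C: riemannian_domain "codom c" "G c" by (rule domain[OF p(2)])
  let ?I = "{1..DIM('e)}" and ?x = "snd c p"
  let ?a = "\<lambda>j. G c ?x (X c) (v j p c)"
  have x: "?x \<in> codom c" using p by blast
  note b = frame_basis[OF p(1)]
  have lin: "linear (\<lambda>u. \<theta> i p (coord_vec A c p u))"
    using du i p unfolding dual_forms_on_def one_form_on_def by blast
  have v: "coord_vec A c p (v j p c) = v j p" "\<theta> i p (v j p) = (if i = j then 1 else 0)" if "j \<in> ?I" for j
  proof -
    have "v j p \<in> tangent_space A p" using b that unfolding orthonormal_basis_at_def by blast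
    then show "coord_vec A c p (v j p c) = v j p" by (rule tangent_eq_coord_vec[OF _ p(2,3)])
    show "\<theta> i p (v j p) = (if i = j then 1 else 0)"
      using du i that p(1) unfolding dual_forms_on_def by blast
  qed
  have "\<theta> i p X = \<theta> i p (coord_vec A c p (\<Sum>j\<in>?I. ?a j *\<^sub>R v j p c))"
    using C.orthonormal_at_expand[OF x orthonormal_basis_chart[OF b p(2,3)], of "X c"]
      tangent_eq_coord_vec[OF X p(2,3)] by metis
  also have "\<dots> = (\<Sum>j\<in>?I. ?a j * \<theta> i p (coord_vec A c p (v j p c)))"
    by (simp add: linear_sum[OF lin] linear_cmul[OF lin])
  also have "\<dots> = (\<Sum>j\<in>?I. if j = i then ?a j else 0)"
    by (rule sum.cong) (auto simp: v)
  also have "\<dots> = ?a i" using i by simp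
  finally show ?thesis .
qed

lemma frame_chart:
  assumes c: "c \<in> A"
  shows "open (snd c ` (U \<inter> fst c))" "snd c ` (U \<inter> fst c) \<subseteq> codom c"
    "\<And>i. i \<in> {1..DIM('e)} \<Longrightarrow> smooth_on (snd c ` (U \<inter> fst c)) (field_rep (v i) c)"
    "\<And>x. x \<in> snd c ` (U \<inter> fst c) \<Longrightarrow>
      riemannian_domain.orthonormal_at (G c) x (\<lambda>i. field_rep (v i) c x)"
proof -
  show "open (snd c ` (U \<inter> fst c))" by (rule is_chartD(4)[OF chart[OF c] U])
  show "smooth_on (snd c ` (U \<inter> fst c)) (field_rep (v i) c)" if "i \<in> {1..DIM('e)}" for i
    by (rule field_rep_smooth[OF frame_field[OF that] c])
  show "riemannian_domain.orthonormal_at (G c) x (\<lambda>i. field_rep (v i) c x)"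
    if x: "x \<in> snd c ` (U \<inter> fst c)" for x
  proof -
    obtain p where p: "p \<in> U" "p \<in> fst c" "x = snd c p" using x by blast
    from orthonormal_basis_chart[OF frame_basis[OF p(1)] c p(2)] show ?thesis by (simp add: p field_rep_coord c)
  qed
qed blast

lemma horospheric_of_frame_equations:
  assumes c: "c \<in> A"
  shows "riemannian_domain.horospheric_on (G c) (snd c ` (U \<inter> fst c)) (\<lambda>i. field_rep (v i) c)"
proof -
  interpret C: riemannian_domain "codom c" "G c" by (rule domain[OF c])
  note one = one_le_DIM[where 'a = 'e]
  show ?thesis
  proof (rule C.horospheric_onI[OF frame_chart[OF c]])
    fix x u i assume x: "x \<in> snd c ` (U \<inter> fst c)" and i: "i \<in> {2..DIM('e)}"
    then have i1: "i \<in> {1..DIM('e)}" by auto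
    obtain p where p: "p \<in> U" "p \<in> fst c" "x = snd c p" using x by blast
    let ?X = "coord_vec A c p u"
    have X: "?X \<in> tangent_space A p" by (rule coord_vec_tangent[OF c p(2)])
    have "connection_form A g v 1 i p ?X + \<theta> i p ?X = 0"
      using eq p(1) X i unfolding frame_equations_on_def by blast
    then show "G c x (C.nabla (field_rep (v 1) c) x u) (field_rep (v i) c x)
        = - G c x u (field_rep (v i) c x)"
      unfolding connection_form_chart[OF U frame_field[OF one] frame_field[OF i1] p(1) X c p(2)]
        dual_form_chart[OF i1 p(1) c p(2) X] coord_vec_self[OF c p(2)] p(3)
      by (simp add: field_rep_coord[OF c p(2)])
    fix j assume j: "j \<in> {2..DIM('e)}" and "i \<noteq> j"
    then have j1: "j \<in> {1..DIM('e)}" by auto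
    have "connection_form A g v i j p ?X = 0"
      using eq p(1) X i j \<open>i \<noteq> j\<close> unfolding frame_equations_on_def by blast
    then show "G c x (C.nabla (field_rep (v i) c) x u) (field_rep (v j) c x) = 0"
      unfolding connection_form_chart[OF U frame_field[OF i1] frame_field[OF j1] p(1) X c p(2)] coord_vec_self[OF c p(2)] p(3) .
  qed
qed

text \<open>\<open>ext_deriv\<close> differentiates the values of the form on constant coordinate
  fields, and in a chart these are inner products with the representative of
  \<open>v 1\<close>.\<close>

lemma first_form_closed: "closed_form_on A U (\<theta> 1)"
  unfolding closed_form_on_def
proof (intro ballI allI)
  fix c x u w assume c: "c \<in> A" and x: "x \<in> snd c ` (U \<inter> fst c)"
  interpret C: riemannian_domain "codom c" "G c" by (rule domain[OF c])
  let ?T = "snd c ` (U \<inter> fst c)" and ?V = "\<lambda>i. field_rep (v i) c"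
  note one = one_le_DIM[where 'a = 'e]
  note T = frame_chart[OF c]
  have rep: "\<theta> 1 (chart_inv c y) (coord_vec A c (chart_inv c y) z) = G c y z (?V 1 y)"
    if y: "y \<in> ?T" for y z
  proof -
    obtain p where p: "p \<in> U" "p \<in> fst c" "y = snd c p" using y by blast
    show ?thesis
      using dual_form_chart[OF one p(1) c p(2) coord_vec_tangent[OF c p(2)], of z]
      by (simp add: p(3) chart_inv_coord[OF c p(2)] coord_vec_self[OF c p(2)] field_rep_coord[OF c p(2)])
  qed
  have d: "FD (\<lambda>y. \<theta> 1 (chart_inv c y) (coord_vec A c (chart_inv c y) z)) x
      = FD (\<lambda>y. G c y z (?V 1 y)) x" for z
    by (rule frechet_derivative_cong_open[OF T(1) x rep])
  have "FD (\<lambda>y. G c y w (?V 1 y)) x u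
      = FD (\<lambda>y. G c y u (?V 1 y)) x w"
    by (rule C.horospheric_first_closed[OF _ x smooth_on_differentiable[OF T(3)[OF one] x]
          horospheric_of_frame_equations[OF c]]) (use x T(2) in blast)
  then show "ext_deriv A (\<theta> 1) c x u w = 0"
    by (simp add: ext_deriv_def d del: One_nat_def)
qed

text \<open>The horospheric equations in the directions of the frame vectors themselves. Equality as
  tangent vectors includes charts away from the point, where both sides are zero.\<close>

lemma cov_deriv_frame:
  assumes p: "p \<in> U"
  shows "cov_deriv A g (v 1) p (v 1 p) = (\<lambda>_. 0)"
    "\<And>i. i \<in> {2..DIM('e)} \<Longrightarrow> cov_deriv A g (v i) p (v i p) = v 1 p"
    "\<And>i. i \<in> {2..DIM('e)} \<Longrightarrow> cov_deriv A g (v 1) p (v i p) = (\<lambda>c. - v i p c)"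
proof -
  note one = one_le_DIM[where 'a = 'e]
  note b = frame_basis[OF p]
  have t: "v i p \<in> tangent_space A p" if "i \<in> {1..DIM('e)}" for i
    using b that unfolding orthonormal_basis_at_def by blast
  have on: "G c (snd c p) (v i p c) (v j p c) = (if i = j then 1 else 0)"
    if "c \<in> A" "p \<in> fst c" "i \<in> {1..DIM('e)}" "j \<in> {1..DIM('e)}" for c i j
    using b that metric_eq_local[OF t[OF that(3)] t[OF that(4)] that(1,2)] unfolding orthonormal_basis_at_def by force
  have n1: "cov_deriv A g (v 1) p X c = G c (snd c p) (X c) (v 1 p c) *\<^sub>R v 1 p c - X c"
    and ni: "i \<in> {2..DIM('e)} \<Longrightarrow> cov_deriv A g (v i) p X c = G c (snd c p) (X c) (v i p c) *\<^sub>R v 1 p c"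
    if c: "c \<in> A" "p \<in> fst c" for c X i
  proof -
    have x: "snd c p \<in> snd c ` (U \<inter> fst c)" using p c by blast
    note h = bspec[OF horospheric_of_frame_equations[OF c(1),
          unfolded riemannian_domain.horospheric_on_def[OF domain[OF c(1)]]] x, rule_format]
    show "cov_deriv A g (v 1) p X c = G c (snd c p) (X c) (v 1 p c) *\<^sub>R v 1 p c - X c"
      using conjunct1[OF h] by (simp add: cov_deriv_chart[OF c] field_rep_coord[OF c] del: One_nat_def)
    show "cov_deriv A g (v i) p X c = G c (snd c p) (X c) (v i p c) *\<^sub>R v 1 p c"
      if "i \<in> {2..DIM('e)}"
      using bspec[OF conjunct2[OF h] that] by (simp add: cov_deriv_chart[OF c] field_rep_coord[OF c] del: One_nat_def)
  qed
  have out: "cov_deriv A g W p X c = 0" if "\<not> (c \<in> A \<and> p \<in> fst c)" for W X c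
    using that by (auto simp: cov_deriv_def)
  show "cov_deriv A g (v 1) p (v 1 p) = (\<lambda>_. 0)"
  proof
    show "cov_deriv A g (v 1) p (v 1 p) c = 0" for c
      by (cases "c \<in> A \<and> p \<in> fst c") (simp_all add: n1 on[OF _ _ one one] out del: One_nat_def)
  qed
  fix i assume i: "i \<in> {2..DIM('e)}"
  then have i1: "i \<in> {1..DIM('e)}" "i \<noteq> 1" by auto
  show "cov_deriv A g (v i) p (v i p) = v 1 p"
  proof
    show "cov_deriv A g (v i) p (v i p) c = v 1 p c" for c by (cases "c \<in> A \<and> p \<in> fst c")
        (simp_all add: ni[OF _ _ i] on[OF _ _ i1(1) i1(1)] out tangent_outside[OF t[OF one]] del: One_nat_def)
  qed
  show "cov_deriv A g (v 1) p (v i p) = (\<lambda>c. - v i p c)"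
  proof
    show "cov_deriv A g (v 1) p (v i p) c = - v i p c" for c by (cases "c \<in> A \<and> p \<in> fst c")
        (use i1(2) in \<open>simp_all add: n1 on[OF _ _ i1(1) one] out tangent_outside[OF t[OF i1(1)]] del: One_nat_def\<close>)
  qed
qed

end

text \<open>Hyperbolicity is a condition at each point, so one orthonormal basis at the point, and
  the frame that it yields, is enough.\<close>

lemma constant_curvature_of_frames:
  assumes fr: "\<And>p b. p \<in> topspace M \<Longrightarrow> orthonormal_basis_at A g p b \<Longrightarrow>
    \<exists>U v \<theta>. openin M U \<and> p \<in> U \<and> orthonormal_frame_on A g U v \<and>
      dual_forms_on A U v \<theta> \<and> frame_equations_on A g U v \<theta>"
  shows "constant_sectional_curvature M A g (-1)"
proof (rule constant_curvatureI)
  fix p assume p: "p \<in> topspace M"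
  obtain c where c: "c \<in> A" "p \<in> fst c" using covered[OF p] by blast
  interpret C: riemannian_domain "codom c" "G c" by (rule domain[OF c(1)])
  have x: "snd c p \<in> codom c" using c by blast
  obtain b where b: "C.orthonormal_at (snd c p) b" using C.orthonormal_at_exists[OF x] by blast
  have t: "coord_vec A c p u \<in> tangent_space A p" for u by (rule coord_vec_tangent[OF c])
  have "orthonormal_basis_at A g p (\<lambda>i. coord_vec A c p (b i))"
    using b unfolding orthonormal_basis_at_def C.orthonormal_at_def
    by (simp add: t metric_eq_local[OF t t c] coord_vec_self[OF c])
  then obtain U v \<theta> where U: "openin M U" "p \<in> U" and v: "orthonormal_frame_on A g U v"
    "dual_forms_on A U v \<theta>" "frame_equations_on A g U v \<theta>"
    using fr[OF p] by blast
  have xT: "snd c p \<in> snd c ` (U \<inter> fst c)" using U(2) c(2) by blast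
  have "C.hyperbolic_at (snd c p)"
    by (rule C.hyperbolic_of_horospheric[OF frame_chart(1,2)[OF U(1) v c(1)] xT frame_chart(3)[OF U(1) v c(1)]
          frame_chart(4)[OF U(1) v c(1) xT] horospheric_of_frame_equations[OF U(1) v c(1)]])
  then show "\<exists>c\<in>A. p \<in> fst c \<and> riemannian_domain.hyperbolic_at (G c) (snd c p)"
    using c by blast
qed

text \<open>A field given in one chart is smooth in every other chart \<open>d\<close>: its
  component there is the Jacobian at the transition map applied to \<open>V\<close> composed with
  that map, and all these ingredients are smooth.\<close>

lemma vector_field_of_rep:
  assumes c: "c \<in> A" and B: "open B" "B \<subseteq> codom c" and V: "smooth_on B V"
  shows "vector_field_on A (fst c \<inter> snd c -` B) (\<lambda>p. coord_vec A c p (V (snd c p)))"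
  unfolding vector_field_on_def
proof (intro conjI ballI)
  let ?U = "fst c \<inter> snd c -` B"
  show "coord_vec A c p (V (snd c p)) \<in> tangent_space A p" if "p \<in> ?U" for p
    using that by (intro coord_vec_tangent c) auto
  fix d assume d: "d \<in> A"
  let ?S = "snd d ` (?U \<inter> fst d)"
  have o: "open ?S" by (rule is_chartD(4)[OF chart[OF d] is_chartD(5)[OF chart[OF c] B(1)]])
  have sub: "?S \<subseteq> overlap d c" by (auto simp: overlap_def)
  have sm: "smooth_on ?S (trans_map d c)" by (rule smooth_on_subset[OF trans_map_smooth[OF d c] sub])
  have img: "trans_map d c ` ?S \<subseteq> B"
    using trans_map_coord[OF d, of _ c] by auto
  have ov: "trans_map d c x \<in> overlap c d" if "x \<in> ?S" for x using trans_map_in[OF d] that sub by blast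
  have "smooth_on ?S (\<lambda>x. jac c d (trans_map d c x) (V (trans_map d c x)))"
    by (rule smooth_on_linear_apply[where \<Phi> = "\<lambda>x. jac c d (trans_map d c x)", OF o jac_linear[OF c d ov]
          smooth_on_compose[OF o jac_smooth[OF c d] sm] smooth_on_compose[OF o V sm img]])
      (use ov in auto)
  then show "smooth_on ?S (\<lambda>x. coord_vec A c (chart_inv d x) (V (snd c (chart_inv d x))) d)"
  proof (rule smooth_on_cong[OF o])
    fix x assume "x \<in> ?S"
    then have "chart_inv d x \<in> fst d" using chart_inv_in[OF d, of x "?U \<inter> fst d"] by auto
    then show "jac c d (trans_map d c x) (V (trans_map d c x)) = coord_vec A c (chart_inv d x) (V (snd c (chart_inv d x))) d"
      by (simp add: coord_vec_jac d trans_map_def)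
  qed
qed

text \<open>Supplies the dual forms of the constructed frame: for an orthonormal frame they are the
  inner products with its vectors.\<close>

lemma one_form_metric_dual:
  assumes U: "openin M U" and V: "vector_field_on A U V"
  shows "one_form_on A U (\<lambda>p X. g p (V p) X)"
  unfolding one_form_on_def
proof (intro ballI conjI allI)
  fix d assume d: "d \<in> A"
  interpret D: riemannian_domain "codom d" "G d" by (rule domain[OF d])
  have eq: "g p (V p) (coord_vec A d p u) = G d (snd d p) (V p d) u"
    if "p \<in> U" "p \<in> fst d" for p u
  proof -
    have "V p \<in> tangent_space A p" using V that(1) by (simp add: vector_field_on_def)
    then show ?thesis using metric_eq_local[OF _ coord_vec_tangent[OF d that(2)] d that(2)]
      by (simp add: coord_vec_self[OF d that(2)])
  qed
  show "linear (\<lambda>u. g p (V p) (coord_vec A d p u))" if p: "p \<in> U \<inter> fst d" for p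
  proof -
    have "snd d p \<in> codom d" using p by blast
    then show ?thesis using eq[of p] p bilinear_linear(1)[OF D.bil] by simp
  qed
  let ?S = "snd d ` (U \<inter> fst d)"
  have o: "open ?S" by (rule is_chartD(4)[OF chart[OF d] U])
  show "smooth_on ?S (\<lambda>x. g (chart_inv d x) (V (chart_inv d x)) (coord_vec A d (chart_inv d x) u))" for u
  proof (rule smooth_on_cong[OF o])
    show "smooth_on ?S (\<lambda>x. G d x (field_rep V d x) u)"
    proof (rule smooth_on_bilinear_apply[where \<Phi> = "G d", OF o _ _ field_rep_smooth[OF V d] smooth_on_const])
      show "bilinear (G d x)" if "x \<in> ?S" for x using that D.bil by blast
      show "smooth_on ?S (\<lambda>x. G d x u w)" for u w by (rule smooth_on_subset[OF D.smooth]) blast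
    qed
    fix x assume "x \<in> ?S"
    then have "chart_inv d x \<in> U \<inter> fst d" "snd d (chart_inv d x) = x"
      using chart_inv_in[OF d, of x "U \<inter> fst d"] coord_chart_inv[of x d "U \<inter> fst d"] by auto
    then show "G d x (field_rep V d x) u
        = g (chart_inv d x) (V (chart_inv d x)) (coord_vec A d (chart_inv d x) u)"
      using eq[of "chart_inv d x" u] by (simp add: field_rep_def)
  qed
qed

lemma horospheric_frame_manifold:
  assumes K: "constant_sectional_curvature M A g (-1)" and p0: "p0 \<in> topspace M"
    and v0: "orthonormal_basis_at A g p0 v0"
  shows "\<exists>U v \<theta>. openin M U \<and> p0 \<in> U \<and>
    orthonormal_frame_on A g U v \<and> (\<forall>i\<in>{1..DIM('e)}. v i p0 = v0 i) \<and>
    dual_forms_on A U v \<theta> \<and> frame_equations_on A g U v \<theta>"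
proof -
  obtain c where c: "c \<in> A" "p0 \<in> fst c" using covered[OF p0] by blast
  interpret C: riemannian_domain "codom c" "G c" by (rule domain[OF c(1)])
  have x0: "snd c p0 \<in> codom c" using c by blast
  have "\<forall>x\<in>codom c. C.hyperbolic_at x"
    using hyperbolic_at_of_constant_curvature[OF K c(1)] by blast
  from C.horospheric_frame_exists[OF x0 this orthonormal_basis_chart[OF v0 c]]
  obtain r V where r: "r > 0" "ball (snd c p0) r \<subseteq> codom c"
    and V: "\<forall>i. V i (snd c p0) = v0 i c \<and> smooth_on (ball (snd c p0) r) (V i)"
    and o: "\<forall>x\<in>ball (snd c p0) r. C.orthonormal_at x (\<lambda>i. V i x)"
    and h: "C.horospheric_on (ball (snd c p0) r) V" by (elim exE conjE) (rule that)
  define B where "B = ball (snd c p0) r"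
  define U where "U = fst c \<inter> snd c -` B"
  define v where "v i p = coord_vec A c p (V i (snd c p))" for i p
  define \<theta> where "\<theta> i p X = g p (v i p) X" for i p X
  have U: "openin M U" unfolding U_def B_def by (rule is_chartD(5)[OF chart[OF c(1)] open_ball])
  have pU: "p0 \<in> U" using c(2) r(1) by (simp add: U_def B_def)
  have vf: "vector_field_on A U (v i)" for i
    unfolding U_def v_def[abs_def] using r V by (intro vector_field_of_rep c(1)) (auto simp: B_def)
  have vt: "v i p \<in> tangent_space A p" if "p \<in> U" for i p
    using vf that by (simp add: vector_field_on_def)
  have Uc: "p \<in> fst c" "snd c p \<in> B" if "p \<in> U" for p using that by (auto simp: U_def)
  have vc: "v i p c = V i (snd c p)" if "p \<in> U" for i p
    by (simp add: v_def coord_vec_self[OF c(1) Uc(1)[OF that]])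
  have basis: "orthonormal_basis_at A g p (\<lambda>i. v i p)" if p: "p \<in> U" for p
  proof -
    have "C.orthonormal_at (snd c p) (\<lambda>i. V i (snd c p))" using o Uc(2)[OF p] by (simp add: B_def)
    then show ?thesis
      unfolding orthonormal_basis_at_def C.orthonormal_at_def
      by (simp add: vt[OF p] metric_eq_local[OF vt[OF p] vt[OF p] c(1) Uc(1)[OF p]] vc[OF p])
  qed
  have fr: "orthonormal_frame_on A g U v"
    using vf basis by (simp add: orthonormal_frame_on_def)
  moreover have "v i p0 = v0 i" if "i \<in> {1..DIM('e)}" for i
  proof -
    have "v0 i \<in> tangent_space A p0" using v0 that unfolding orthonormal_basis_at_def by blast
    from tangent_eq_coord_vec[OF this c] show ?thesis using V by (simp add: v_def)
  qed
  moreover have "dual_forms_on A U v \<theta>"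
    unfolding dual_forms_on_def
  proof (intro conjI ballI)
    show "one_form_on A U (\<theta> i)" for i
      unfolding \<theta>_def[abs_def] by (rule one_form_metric_dual[OF U vf])
    show "\<theta> i p (v j p) = (if i = j then 1 else 0)" if "i \<in> {1..DIM('e)}" "j \<in> {1..DIM('e)}" "p \<in> U" for i j p
      using basis[OF that(3)] that(1,2) unfolding orthonormal_basis_at_def \<theta>_def by blast
  qed
  moreover have "frame_equations_on A g U v \<theta>"
    unfolding frame_equations_on_def
  proof (intro ballI conjI impI)
    fix p X i assume p: "p \<in> U" and X: "X \<in> tangent_space A p" and i: "i \<in> {2..DIM('e)}"
    let ?x = "snd c p"
    have x: "?x \<in> codom c" using Uc(1)[OF p] by blast
    have one: "1 \<in> {1..DIM('e)}" and i1: "i \<in> {1..DIM('e)}" using i by auto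
    have xB: "?x \<in> B" by (rule Uc(2)[OF p])
    \<comment> \<open>The field \<open>v\<close> is built from \<open>V\<close> through coordinate
      vectors, so its representative in \<open>c\<close> is identified with \<open>V\<close> on
      \<open>B\<close>. As \<open>B\<close> is open, the agreement extends to covariant derivatives
      at points of \<open>B\<close>.\<close>
    have rep: "field_rep (v j) c y = V j y" if "y \<in> B" for j y
    proof -
      have "y \<in> codom c" using r(2) that unfolding B_def by (rule subsetD)
      then obtain q where q: "q \<in> fst c" "y = snd c q" by blast
      then have "q \<in> U" using that by (simp add: U_def)
      then show ?thesis using q by (simp add: field_rep_coord[OF c(1)] vc)
    qed
    have nab: "C.nabla (field_rep (v j) c) ?x u = C.nabla (V j) ?x u" for j u
      by (rule C.nabla_cong[of B]) (use xB rep in \<open>auto simp: B_def\<close>)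
    have on: "G c ?x (V j ?x) (V k ?x) = (if j = k then 1 else 0)"
      if "j \<in> {1..DIM('e)}" "k \<in> {1..DIM('e)}" for j k
      using o xB that by (simp add: B_def C.orthonormal_at_def)
    have n1: "C.nabla (V 1) ?x u = G c ?x u (V 1 ?x) *\<^sub>R V 1 ?x - u"
      and ni: "C.nabla (V i) ?x u = G c ?x u (V i ?x) *\<^sub>R V 1 ?x" for u
      using h xB i unfolding C.horospheric_on_def B_def by blast+
    have "connection_form A g v 1 i p X = - G c ?x (X c) (V i ?x)"
      unfolding connection_form_chart[OF U vf vf p X c(1) Uc(1)[OF p]] nab n1 rep[OF xB]
      using on[OF one i1] i by (simp add: C.G_simps x)
    moreover have "\<theta> i p X = G c ?x (X c) (V i ?x)"
      using metric_eq_local[OF vt[OF p] X c(1) Uc(1)[OF p]] C.sym[OF x] by (simp add: \<theta>_def vc[OF p])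
    ultimately show "connection_form A g v 1 i p X + \<theta> i p X = 0" by simp
    fix j assume j: "j \<in> {2..DIM('e)}" "i \<noteq> j"
    then have j1: "j \<in> {1..DIM('e)}" by auto
    show "connection_form A g v i j p X = 0"
      unfolding connection_form_chart[OF U vf vf p X c(1) Uc(1)[OF p]] nab ni rep[OF xB]
      using on[OF one j1] j by (simp add: C.G_simps x)
  qed
  ultimately show ?thesis using U pU by blast
qed

subsection \<open>Integral curves\<close>

lemma curve_domain_open:
  assumes "open_interval I" "continuous_map (top_of_set I) M \<gamma>" "c \<in> A"
  shows "open (I \<inter> \<gamma> -` fst c)"
proof -
  have "openin (top_of_set I) {t \<in> topspace (top_of_set I). \<gamma> t \<in> fst c}"
    by (rule openin_continuous_map_preimage[OF assms(2) is_chartD(1)[OF chart[OF assms(3)]]])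
  moreover have "{t \<in> topspace (top_of_set I). \<gamma> t \<in> fst c} = I \<inter> \<gamma> -` fst c" by auto
  ultimately show ?thesis
    using assms(1) openin_open_trans unfolding open_interval_def by metis
qed

context
  fixes U :: "'m set" and V :: "'m \<Rightarrow> ('m, 'e) tvec" and I :: "real set" and \<gamma> :: "real \<Rightarrow> 'm"
  assumes U: "openin M U" and V: "vector_field_on A U V" and ic: "integral_curve M A U V I \<gamma>"
begin

lemma ic_interval: "open_interval I" "continuous_map (top_of_set I) M \<gamma>" "t \<in> I \<Longrightarrow> \<gamma> t \<in> U"
  using ic unfolding integral_curve_def by blast+

lemma ic_derivative:
  "t \<in> I \<Longrightarrow> c \<in> A \<Longrightarrow> \<gamma> t \<in> fst c \<Longrightarrow> ((\<lambda>t. snd c (\<gamma> t)) has_vector_derivative V (\<gamma> t) c) (at t)"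
  using ic unfolding integral_curve_def comp_def by blast

text \<open>In a chart the curve solves an autonomous equation with smooth right-hand side, so it
  inherits smoothness by bootstrapping.\<close>

lemma ic_smooth:
  assumes c: "c \<in> A" shows "smooth_on (I \<inter> \<gamma> -` fst c) (\<lambda>t. snd c (\<gamma> t))"
proof (rule ode_solution_smooth[OF curve_domain_open[OF ic_interval(1,2) c] field_rep_smooth[OF V c]])
  show "(\<lambda>t. snd c (\<gamma> t)) ` (I \<inter> \<gamma> -` fst c) \<subseteq> snd c ` (U \<inter> fst c)" using ic_interval(3) by blast
  show "((\<lambda>t. snd c (\<gamma> t)) has_vector_derivative field_rep V c (snd c (\<gamma> t))) (at t)"
    if "t \<in> I \<inter> \<gamma> -` fst c" for t
    using ic_derivative[of t c] that c by (simp add: field_rep_coord)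
qed

lemma ic_smooth_curve: "smooth_curve M A I \<gamma>"
  unfolding smooth_curve_def comp_def by (intro conjI ballI ic_interval ic_smooth)

lemma ic_velocity:
  assumes t: "t \<in> I" shows "velocity A \<gamma> t = V (\<gamma> t)"
proof
  fix c
  have "V (\<gamma> t) \<in> tangent_space A (\<gamma> t)" using V ic_interval(3)[OF t] by (simp add: vector_field_on_def)
  then show "velocity A \<gamma> t c = V (\<gamma> t) c"
    using ic_derivative[OF t, of c] tangent_outside[of "V (\<gamma> t)" "\<gamma> t" c]
    unfolding velocity_def comp_def by (auto intro: vector_derivative_at)
qed

lemma ic_field_along:
  assumes F: "vector_field_on A U F" shows "field_along A I \<gamma> (\<lambda>t. F (\<gamma> t))"
  unfolding field_along_def
proof (intro conjI ballI)
  show "F (\<gamma> t) \<in> tangent_space A (\<gamma> t)" if "t \<in> I" for t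
    using F ic_interval(3)[OF that] by (simp add: vector_field_on_def)
  fix c assume c: "c \<in> A"
  note o = curve_domain_open[OF ic_interval(1,2) c]
  show "smooth_on (I \<inter> \<gamma> -` fst c) (\<lambda>t. F (\<gamma> t) c)"
  proof (rule smooth_on_cong[OF o])
    show "smooth_on (I \<inter> \<gamma> -` fst c) (\<lambda>t. field_rep F c (snd c (\<gamma> t)))"
      by (rule smooth_on_compose[OF o field_rep_smooth[OF F c] ic_smooth[OF c]]) (use ic_interval(3) in blast)
    show "field_rep F c (snd c (\<gamma> t)) = F (\<gamma> t) c" if "t \<in> I \<inter> \<gamma> -` fst c" for t
      using that c by (simp add: field_rep_coord)
  qed
qed

text \<open>The chain rule relates the derivative along the curve to the covariant derivative in the
  direction of its velocity. \<open>W\<close> has to agree with the field only on \<open>I\<close>,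
  which allows the velocity itself to be inserted.\<close>

lemma ic_cov_deriv_along:
  assumes F: "vector_field_on A U F" and W: "\<And>t. t \<in> I \<Longrightarrow> W t = F (\<gamma> t)" and t: "t \<in> I"
  shows "cov_deriv_along A g \<gamma> W t = cov_deriv A g F (\<gamma> t) (V (\<gamma> t))"
proof
  fix c
  show "cov_deriv_along A g \<gamma> W t c = cov_deriv A g F (\<gamma> t) (V (\<gamma> t)) c"
  proof (cases "c \<in> A \<and> \<gamma> t \<in> fst c")
    case True
    then have c: "c \<in> A" "\<gamma> t \<in> fst c" by auto
    let ?x = "\<lambda>t. snd c (\<gamma> t)" and ?D = "FD (field_rep F c) (snd c (\<gamma> t))"
    have "?x t \<in> snd c ` (U \<inter> fst c)" using ic_interval(3)[OF t] c by blast
    then have D: "(field_rep F c has_derivative ?D) (at (?x t))"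
      by (rule smooth_on_has_derivative[OF field_rep_smooth[OF F c(1)]])
    have "(?x has_derivative (\<lambda>h. h *\<^sub>R V (\<gamma> t) c)) (at t)"
      using ic_derivative[OF t c] by (simp add: has_vector_derivative_def)
    from has_derivative_compose[OF this D]
    have "((\<lambda>t. field_rep F c (?x t)) has_derivative (\<lambda>h. h *\<^sub>R ?D (V (\<gamma> t) c))) (at t)"
      by (simp add: linear_cmul[OF has_derivative_linear[OF D]])
    then have "((\<lambda>s. W s c) has_derivative (\<lambda>h. h *\<^sub>R ?D (V (\<gamma> t) c))) (at t)"
      by (rule has_derivative_transform_within_open[OF _ curve_domain_open[OF ic_interval(1,2) c(1)]])
        (use t c W in \<open>auto simp: field_rep_coord\<close>)
    then have "vector_derivative (\<lambda>s. W s c) (at t) = ?D (V (\<gamma> t) c)"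
      by (intro vector_derivative_at) (simp add: has_vector_derivative_def)
    then show ?thesis
      unfolding cov_deriv_along_def cov_deriv_def using c by (simp add: ic_velocity[OF t] W[OF t] field_rep_def[abs_def])
  qed (auto simp: cov_deriv_along_def cov_deriv_def)
qed

end

text \<open>Along an integral curve the covariant derivatives become those of the frame in its own
  directions. For \<open>i \<ge> 2\<close>, acceleration and normal form the rotating pair that
  characterizes a horocycle.\<close>

lemma frame_geodesics_horocycles:
  assumes U: "openin M U" and fr: "orthonormal_frame_on A g U v" and du: "dual_forms_on A U v \<theta>"
    and eq: "frame_equations_on A g U v \<theta>"
  shows "tangent_to_geodesics M A g U (v 1)"
    and "i \<in> {2..DIM('e)} \<Longrightarrow> tangent_to_horocycles M A g U (v i)"
proof -
  note vf = frame_field[OF U fr du eq]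
  note one = one_le_DIM[where 'a = 'e]
  note cov = cov_deriv_frame[OF U fr du eq]
  show "tangent_to_geodesics M A g U (v 1)"
    unfolding tangent_to_geodesics_def
  proof (intro allI impI)
    fix I \<gamma> assume ic: "integral_curve M A U (v 1) I \<gamma>"
    note C = U vf[OF one] ic
    have "cov_deriv_along A g \<gamma> (velocity A \<gamma>) t = (\<lambda>_. 0)" if t: "t \<in> I" for t
      using ic_cov_deriv_along[OF C vf[OF one] ic_velocity[OF C] t] cov(1)[OF ic_interval(3)[OF C t]] by simp
    then show "geodesic M A g I \<gamma>" using ic_smooth_curve[OF C] by (simp add: geodesic_def)
  qed
  assume i: "i \<in> {2..DIM('e)}"
  then have i1: "i \<in> {1..DIM('e)}" "i \<noteq> 1" by auto
  show "tangent_to_horocycles M A g U (v i)"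
    unfolding tangent_to_horocycles_def
  proof (intro allI impI)
    fix I \<gamma> assume ic: "integral_curve M A U (v i) I \<gamma>"
    note C = U vf[OF i1(1)] ic
    have on: "g (\<gamma> t) (v j (\<gamma> t)) (v k (\<gamma> t)) = (if j = k then 1 else 0)"
      if "t \<in> I" "j \<in> {1..DIM('e)}" "k \<in> {1..DIM('e)}" for t j k
      using frame_basis[OF U fr du eq ic_interval(3)[OF C that(1)]] that(2,3)
      unfolding orthonormal_basis_at_def by blast
    have vel: "velocity A \<gamma> t = v i (\<gamma> t)" if "t \<in> I" for t by (rule ic_velocity[OF C that])
    have c1: "cov_deriv_along A g \<gamma> (velocity A \<gamma>) t = v 1 (\<gamma> t)" if t: "t \<in> I" for t
      by (rule trans[OF ic_cov_deriv_along[OF C vf[OF i1(1)] vel t] cov(2)[OF ic_interval(3)[OF C t] i]])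
    have c2: "cov_deriv_along A g \<gamma> (\<lambda>t. v 1 (\<gamma> t)) t = (\<lambda>c. - velocity A \<gamma> t c)" if t: "t \<in> I" for t
      unfolding vel[OF t]
      by (rule trans[OF ic_cov_deriv_along[OF C vf[OF one] refl t] cov(3)[OF ic_interval(3)[OF C t] i]])
    show "horocycle M A g I \<gamma>"
      unfolding horocycle_def
    \<comment> \<open>The unit normal along the curve is the restriction of \<open>v 1\<close>, the
      common normal of the horospheres.\<close>
    proof (intro conjI ballI exI[of _ "\<lambda>t. v 1 (\<gamma> t)"])
      show "smooth_curve M A I \<gamma>" by (rule ic_smooth_curve[OF C])
      show "field_along A I \<gamma> (\<lambda>t. v 1 (\<gamma> t))" by (rule ic_field_along[OF C vf[OF one]])
      fix t assume t: "t \<in> I"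
      show "g (\<gamma> t) (velocity A \<gamma> t) (velocity A \<gamma> t) = 1"
        "g (\<gamma> t) (v 1 (\<gamma> t)) (v 1 (\<gamma> t)) = 1" "g (\<gamma> t) (v 1 (\<gamma> t)) (velocity A \<gamma> t) = 0"
        unfolding vel[OF t] using on[OF t i1(1) i1(1)] on[OF t one one] on[OF t one i1(1)] i1(2) by auto
      show "cov_deriv_along A g \<gamma> (velocity A \<gamma>) t = v 1 (\<gamma> t)" by (rule c1[OF t])
      show "cov_deriv_along A g \<gamma> (\<lambda>t. v 1 (\<gamma> t)) t = (\<lambda>c. - velocity A \<gamma> t c)" by (rule c2[OF t])
    qed
  qed
qed

end

theorem theorem2:
  fixes M :: "'m topology"
    and A :: "('m, 'e::euclidean_space) chart set"
    and g :: "('m, 'e) metric"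
  assumes "riemannian_manifold M A g"
    and "DIM('e) \<ge> 2"
  shows
    "(constant_sectional_curvature M A g (-1) \<longleftrightarrow>
       (\<forall>p0\<in>topspace M. \<forall>v0. orthonormal_basis_at A g p0 v0 \<longrightarrow>
          (\<exists>U v \<theta>. openin M U \<and> p0 \<in> U \<and>
             orthonormal_frame_on A g U v \<and> (\<forall>i\<in>{1..DIM('e)}. v i p0 = v0 i) \<and>
             dual_forms_on A U v \<theta> \<and> frame_equations_on A g U v \<theta>)))
     \<and>
     (constant_sectional_curvature M A g (-1) \<longrightarrow>
       (\<forall>U v \<theta>. openin M U \<and> orthonormal_frame_on A g U v \<and>
          dual_forms_on A U v \<theta> \<and> frame_equations_on A g U v \<theta> \<longrightarrow>
          closed_form_on A U (\<theta> 1) \<and>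
          tangent_to_geodesics M A g U (v 1) \<and>
          (\<forall>i\<in>{2..DIM('e)}. tangent_to_horocycles M A g U (v i))))"
proof -
  interpret riemannian_mfd M A g by (rule riemannian_mfd.intro) (rule assms(1))
  show ?thesis
  proof (intro conjI iffI impI allI ballI)
    show "\<exists>U v \<theta>. openin M U \<and> p0 \<in> U \<and> orthonormal_frame_on A g U v \<and>
        (\<forall>i\<in>{1..DIM('e)}. v i p0 = v0 i) \<and> dual_forms_on A U v \<theta> \<and> frame_equations_on A g U v \<theta>"
      if "constant_sectional_curvature M A g (-1)" "p0 \<in> topspace M" "orthonormal_basis_at A g p0 v0" for p0 v0
      using that by (rule horospheric_frame_manifold)
  next
    assume H: "\<forall>p0\<in>topspace M. \<forall>v0. orthonormal_basis_at A g p0 v0 \<longrightarrow>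
          (\<exists>U v \<theta>. openin M U \<and> p0 \<in> U \<and>
             orthonormal_frame_on A g U v \<and> (\<forall>i\<in>{1..DIM('e)}. v i p0 = v0 i) \<and>
             dual_forms_on A U v \<theta> \<and> frame_equations_on A g U v \<theta>)"
    show "constant_sectional_curvature M A g (-1)"
    proof (rule constant_curvature_of_frames)
      fix p b assume p: "p \<in> topspace M" and b: "orthonormal_basis_at A g p b"
      from mp[OF spec[OF bspec[OF H p]] b]
      show "\<exists>U v \<theta>. openin M U \<and> p \<in> U \<and> orthonormal_frame_on A g U v \<and>
          dual_forms_on A U v \<theta> \<and> frame_equations_on A g U v \<theta>" by blast
    qed
  next
    fix U v \<theta>
    assume "openin M U \<and> orthonormal_frame_on A g U v \<and> dual_forms_on A U v \<theta> \<and> frame_equations_on A g U v \<theta>"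
    then have *: "openin M U" "orthonormal_frame_on A g U v" "dual_forms_on A U v \<theta>" "frame_equations_on A g U v \<theta>"
      by blast+
    show "closed_form_on A U (\<theta> 1)" "tangent_to_geodesics M A g U (v 1)"
      by (rule first_form_closed[OF *] frame_geodesics_horocycles(1)[OF *])+
    show "tangent_to_horocycles M A g U (v i)" if "i \<in> {2..DIM('e)}" for i
      by (rule frame_geodesics_horocycles(2)[OF * that])
  qed
qed

end
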